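(* Let $\tau,\tau',\tau_1,\tau_1'$ be source types and suppose $$x:\tau'\to\tau\vdash\lambda x_1'{:}\tau_1'.\,t_1:\tau_1'\to\tau_1\qquad\text{and}\qquad x:\tau'\to\tau\vdash\lambda x_2'{:}\tau_1'.\,t_2:\tau_1'\to\tau_1$$ in the source language $\lambda^\tau$. Then $$x:\tau'\to\tau\vdash\lambda x_1'{:}\tau_1'.\,t_1\simeq_{ctx}\lambda x_2'{:}\tau_1'.\,t_2:\tau_1'\to\tau_1\quad\Longleftrightarrow\quad x\vdash[\![\lambda x_1'{:}\tau_1'.\,t_1]\!]^m\simeq_{ctx}[\![\lambda x_2'{:}\tau_1'.\,t_2]\!]^m,$$ where $[\![\cdot]\!]^m$ is the modular compiler from $\lambda^\tau$ to $\lambda^u$.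
   Context: Source objects are written $t,v,E,C$; target objects $\mathsf t,\mathsf v,\mathsf E,\mathsf C$. **Source language $\lambda^\tau$.** Types: $\tau::=\mathtt{Unit}\mid\mathtt{Bool}\mid\tau\to\tau\mid\tau\times\tau\mid\tau\uplus\tau$. Terms: $t::=\mathtt{unit}\mid\mathtt{true}\mid\mathtt{false}\mid\lambda x{:}\tau.t\mid x\mid t\,t\mid t.1\mid t.2\mid\langle t,t\rangle\mid\mathrm{inl}\,t\mid\mathrm{inr}\,t\mid(\mathrm{case}\,t\,\mathrm{of}\,\mathrm{inl}\,x_1\mapsto t\mid\mathrm{inr}\,x_2\mapsto t)\mid t;t\mid\mathrm{if}\,t\,\mathrm{then}\,t\,\mathrm{else}\,t\mid\mathrm{fix}_{\tau\to\tau}\,t$. Values: $v::=\mathtt{unit}\mid\mathtt{true}\mid\mathtt{false}\mid\lambda x{:}\tau.t\mid\langle v,v\rangle\mid\mathrm{inl}\,v\mid\mathrm{inr}\,v$. Typing $\Gamma\vdash t:\tau$ is the standard simple typing; in particular $\Gamma\vdash t_1;t_2:\tau$ if $\Gamma\vdash t_1:\mathtt{Unit}$ and $\Gamma\vdash t_2:\tau$, and $\Gamma\vdash\mathrm{fix}_{\tau_1\to\tau_2}\,t:\tau_1\to\tau_2$ if $\Gamma\vdash t:(\tau_1\to\tau_2)\to(\tau_1\to\tau_2)$. Evaluation contexts (call-by-value, left-to-right): $E::=[\cdot]\mid E\,t\mid v\,E\mid E.1\mid E.2\mid\langle E,t\rangle\mid\langle v,E\rangle\mid\mathrm{inl}\,E\mid\mathrm{inr}\,E\mid(\mathrm{case}\,E\,\mathrm{of}\ldots)\mid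 E;t\mid\mathrm{if}\,E\,\mathrm{then}\,t\,\mathrm{else}\,t\mid\mathrm{fix}_{\tau\to\tau}\,E$. Reduction $\hookrightarrow$ is closed under evaluation contexts and generated by $(\lambda x{:}\tau.t)\,v\hookrightarrow t[v/x]$; $\langle v_1,v_2\rangle.i\hookrightarrow v_i$; $\mathrm{case}\,\mathrm{inl}\,v\,\mathrm{of}\,\mathrm{inl}\,x_1\mapsto t_1\mid\mathrm{inr}\,x_2\mapsto t_2\hookrightarrow t_1[v/x_1]$ and symmetrically $t_2[v/x_2]$ for $\mathrm{inr}\,v$; $\mathtt{unit};t\hookrightarrow t$; the usual rules for $\mathrm{if}$; and $\mathrm{fix}_{\tau_1\to\tau_2}(\lambda x{:}\tau_1\to\tau_2.t)\hookrightarrow t[(\lambda y{:}\tau_1.\,\mathrm{fix}_{\tau_1\to\tau_2}(\lambda x{:}\tau_1\to\tau_2.t)\,y)/x]$. $t\Downarrow$ means $t\hookrightarrow^*v$ for some value $v$. **Target language $\lambda^u$.** Terms: the same grammar without types and without $\mathrm{fix}$, i.e. $\mathtt{unit},\mathtt{true},\mathtt{false}$, $\lambda x.\mathsf t$, variables, application, projections, pairs, $\mathrm{inl}/\mathrm{inr}$, $\mathrm{case}$, $;$, $\mathrm{if}$, plus a non-value term $\mathsf{wrong}$. Values and evaluation contexts are as in the source (without types and $\mathrm{fix}$). Reduction uses the same rules (except $\mathrm{fix}$), plus: $\mathsf E[\mathsf{wrong}]\hookrightarrow\mathsf{wrong}$ for $\mathsf E\neq[\cdot]$, and every elimination of a value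 of the wrong shape reduces to $\mathsf{wrong}$ (applying a non-$\lambda$, projecting from a non-pair, case on a value not of the form $\mathrm{inl}/\mathrm{inr}$, $\mathrm{if}$ on a non-boolean, $\mathsf v;\mathsf t$ with $\mathsf v\ne\mathtt{unit}$). $\mathsf t\Downarrow$ means $\mathsf t\hookrightarrow^*\mathsf v$ for a value $\mathsf v$ (so not $\mathsf{wrong}$). Target contexts $\Gamma$ are lists of variables; $\Gamma\vdash\mathsf t$ means the free variables of $\mathsf t$ are in $\Gamma$. **Contextual equivalence.** A program context is a term with exactly one hole in place of a subterm (possibly under binders; plugging may capture variables). $\vdash C:\Gamma',\tau'\to\Gamma,\tau$ is the standard typing of source contexts, guaranteeing $\Gamma\vdash C[t]:\tau$ whenever $\Gamma'\vdash t:\tau'$; $\vdash\mathsf C:\Gamma'\to\Gamma$ is the analogous well-scopedness judgement for target contexts. $\Gamma\vdash t_1\simeq_{ctx}t_2:\tau$ means: for all $\tau'$ and $C$ with $\vdash C:\Gamma,\tau\to\emptyset,\tau'$, $C[t_1]\Downarrow$ iff $C[t_2]\Downarrow$. $\Gamma\vdash\mathsf t_1\simeq_{ctx}\mathsf t_2$ means: for all $\mathsf C$ with $\vdash\mathsf C:\Gamma\to\emptyset$, $\mathsf C[\mathsf t_1]\Downarrow$ iff $\mathsf C[\mathsf t_2]\Downarrow$. **Erasure and wrappers.** $\mathrm{erase}$ maps each source construct to the corresponding target construct, dropping type annotations, with $\mathrm{erase}(\mathrm{fix}_{\tau_1\to\tau_2}\,t)=\mathsf{fix}\;\mathrm{erase}(t)$,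 where $\mathsf{fix}=\lambda f.(\lambda x.f(\lambda y.x\,x\,y))(\lambda x.f(\lambda y.x\,x\,y))$. The target terms $\mathsf{protect}_\tau,\mathsf{confine}_\tau$ are defined by mutual recursion on $\tau$: - $\mathsf{protect}_{\mathtt{Unit}}=\mathsf{protect}_{\mathtt{Bool}}=\lambda x.x$; - $\mathsf{protect}_{\tau_1\times\tau_2}=\lambda y.\langle\mathsf{protect}_{\tau_1}(y.1),\mathsf{protect}_{\tau_2}(y.2)\rangle$; - $\mathsf{protect}_{\tau_1\uplus\tau_2}=\lambda y.\mathrm{case}\,y\,\mathrm{of}\,\mathrm{inl}\,x\mapsto\mathrm{inl}(\mathsf{protect}_{\tau_1}x)\mid\mathrm{inr}\,x\mapsto\mathrm{inr}(\mathsf{protect}_{\tau_2}x)$; - $\mathsf{protect}_{\tau_1\to\tau_2}=\lambda y.\lambda x.\mathsf{protect}_{\tau_2}(y(\mathsf{confine}_{\tau_1}x))$; - $\mathsf{confine}_{\mathtt{Unit}}=\lambda y.(y;\mathtt{unit})$; $\mathsf{confine}_{\mathtt{Bool}}=\lambda y.\mathrm{if}\,y\,\mathrm{then}\,\mathtt{true}\,\mathrm{else}\,\mathtt{false}$; - $\mathsf{confine}_{\tau_1\times\tau_2}$, $\mathsf{confine}_{\tau_1\uplus\tau_2}$: as for $\mathsf{protect}$, with $\mathsf{confine}_{\tau_i}$ in place of $\mathsf{protect}_{\tau_i}$; - $\mathsf{confine}_{\tau_1\to\tau_2}=\lambda y.\lambda x.\mathsf{confine}_{\tau_2}(y(\mathsf{protect}_{\tau_1}x))$.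 **Modular compiler.** For a $\lambda$-abstraction with one free variable, $z:\sigma'\to\sigma\vdash\lambda w{:}\rho'.\,t:\rho'\to\rho$, define $$[\![\lambda w{:}\rho'.\,t]\!]^m:=\mathsf{protect}_{\rho'\to\rho}\,\bigl(\lambda w.\,((\lambda z.\,\mathrm{erase}(t))\,(\mathsf{confine}_{\sigma'\to\sigma}\,z))\bigr).$$ *)

theory Defs
  imports Main
begin

(* Terms of both languages are in de Bruijn form: index 0 refers to the innermost binder.
   A typing context is a list of types whose i-th entry is the type of index i. *)

section \<open>The source language\<close>

datatype ty =
    TUnit
  | TBool
  | TFun ty ty
  | TProd ty ty
  | TSum ty ty

(* SFix t1 t2 is annotated with the function type TFun t1 t2.
   Each branch of SCase binds one variable. *)
datatype stm =
    SUnit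
  | STrue
  | SFalse
  | SLam ty stm
  | SVar nat
  | SApp stm stm
  | SFst stm
  | SSnd stm
  | SPair stm stm
  | SInl stm
  | SInr stm
  | SCase stm stm stm
  | SSeq stm stm
  | SIf stm stm stm
  | SFix ty ty stm

inductive svalue :: "stm \<Rightarrow> bool" where
  "svalue SUnit"
| "svalue STrue"
| "svalue SFalse"
| "svalue (SLam \<tau> t)"
| "svalue v1 \<Longrightarrow> svalue v2 \<Longrightarrow> svalue (SPair v1 v2)"
| "svalue v \<Longrightarrow> svalue (SInl v)"
| "svalue v \<Longrightarrow> svalue (SInr v)"

inductive has_type :: "ty list \<Rightarrow> stm \<Rightarrow> ty \<Rightarrow> bool" where
  T_Unit: "has_type \<Gamma> SUnit TUnit"
| T_True: "has_type \<Gamma> STrue TBool"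
| T_False: "has_type \<Gamma> SFalse TBool"
| T_Lam: "has_type (\<tau>1 # \<Gamma>) t \<tau>2 \<Longrightarrow> has_type \<Gamma> (SLam \<tau>1 t) (TFun \<tau>1 \<tau>2)"
| T_Var: "i < length \<Gamma> \<Longrightarrow> has_type \<Gamma> (SVar i) (\<Gamma> ! i)"
| T_App: "has_type \<Gamma> t1 (TFun \<tau>1 \<tau>2) \<Longrightarrow> has_type \<Gamma> t2 \<tau>1 \<Longrightarrow> has_type \<Gamma> (SApp t1 t2) \<tau>2"
| T_Fst: "has_type \<Gamma> t (TProd \<tau>1 \<tau>2) \<Longrightarrow> has_type \<Gamma> (SFst t) \<tau>1"
| T_Snd: "has_type \<Gamma> t (TProd \<tau>1 \<tau>2) \<Longrightarrow> has_type \<Gamma> (SSnd t) \<tau>2"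
| T_Pair: "has_type \<Gamma> t1 \<tau>1 \<Longrightarrow> has_type \<Gamma> t2 \<tau>2 \<Longrightarrow> has_type \<Gamma> (SPair t1 t2) (TProd \<tau>1 \<tau>2)"
| T_Inl: "has_type \<Gamma> t \<tau>1 \<Longrightarrow> has_type \<Gamma> (SInl t) (TSum \<tau>1 \<tau>2)"
| T_Inr: "has_type \<Gamma> t \<tau>2 \<Longrightarrow> has_type \<Gamma> (SInr t) (TSum \<tau>1 \<tau>2)"
| T_Case: "has_type \<Gamma> t (TSum \<tau>1 \<tau>2) \<Longrightarrow> has_type (\<tau>1 # \<Gamma>) t1 \<tau> \<Longrightarrow> has_type (\<tau>2 # \<Gamma>) t2 \<tau>
    \<Longrightarrow> has_type \<Gamma> (SCase t t1 t2) \<tau>"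
| T_Seq: "has_type \<Gamma> t1 TUnit \<Longrightarrow> has_type \<Gamma> t2 \<tau> \<Longrightarrow> has_type \<Gamma> (SSeq t1 t2) \<tau>"
| T_If: "has_type \<Gamma> t TBool \<Longrightarrow> has_type \<Gamma> t1 \<tau> \<Longrightarrow> has_type \<Gamma> t2 \<tau> \<Longrightarrow> has_type \<Gamma> (SIf t t1 t2) \<tau>"
| T_Fix: "has_type \<Gamma> t (TFun (TFun \<tau>1 \<tau>2) (TFun \<tau>1 \<tau>2))
    \<Longrightarrow> has_type \<Gamma> (SFix \<tau>1 \<tau>2 t) (TFun \<tau>1 \<tau>2)"

(* A renaming lifted under one binder; used for both languages. *)
definition up_ren :: "(nat \<Rightarrow> nat) \<Rightarrow> nat \<Rightarrow> nat" where
  "up_ren r = case_nat 0 (\<lambda>i. Suc (r i))"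

primrec sren :: "(nat \<Rightarrow> nat) \<Rightarrow> stm \<Rightarrow> stm" where
  "sren r SUnit = SUnit"
| "sren r STrue = STrue"
| "sren r SFalse = SFalse"
| "sren r (SLam \<tau> t) = SLam \<tau> (sren (up_ren r) t)"
| "sren r (SVar i) = SVar (r i)"
| "sren r (SApp t1 t2) = SApp (sren r t1) (sren r t2)"
| "sren r (SFst t) = SFst (sren r t)"
| "sren r (SSnd t) = SSnd (sren r t)"
| "sren r (SPair t1 t2) = SPair (sren r t1) (sren r t2)"
| "sren r (SInl t) = SInl (sren r t)"
| "sren r (SInr t) = SInr (sren r t)"
| "sren r (SCase t t1 t2) = SCase (sren r t) (sren (up_ren r) t1) (sren (up_ren r) t2)"
| "sren r (SSeq t1 t2) = SSeq (sren r t1) (sren r t2)"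
| "sren r (SIf t t1 t2) = SIf (sren r t) (sren r t1) (sren r t2)"
| "sren r (SFix \<tau>1 \<tau>2 t) = SFix \<tau>1 \<tau>2 (sren r t)"

definition up_ssub :: "(nat \<Rightarrow> stm) \<Rightarrow> nat \<Rightarrow> stm" where
  "up_ssub s = case_nat (SVar 0) (\<lambda>i. sren Suc (s i))"

primrec ssub :: "(nat \<Rightarrow> stm) \<Rightarrow> stm \<Rightarrow> stm" where
  "ssub s SUnit = SUnit"
| "ssub s STrue = STrue"
| "ssub s SFalse = SFalse"
| "ssub s (SLam \<tau> t) = SLam \<tau> (ssub (up_ssub s) t)"
| "ssub s (SVar i) = s i"
| "ssub s (SApp t1 t2) = SApp (ssub s t1) (ssub s t2)"
| "ssub s (SFst t) = SFst (ssub s t)"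
| "ssub s (SSnd t) = SSnd (ssub s t)"
| "ssub s (SPair t1 t2) = SPair (ssub s t1) (ssub s t2)"
| "ssub s (SInl t) = SInl (ssub s t)"
| "ssub s (SInr t) = SInr (ssub s t)"
| "ssub s (SCase t t1 t2) = SCase (ssub s t) (ssub (up_ssub s) t1) (ssub (up_ssub s) t2)"
| "ssub s (SSeq t1 t2) = SSeq (ssub s t1) (ssub s t2)"
| "ssub s (SIf t t1 t2) = SIf (ssub s t) (ssub s t1) (ssub s t2)"
| "ssub s (SFix \<tau>1 \<tau>2 t) = SFix \<tau>1 \<tau>2 (ssub s t)"

(* t[v/0]; the remaining indices are lowered by one. *)
definition ssub0 :: "stm \<Rightarrow> stm \<Rightarrow> stm" where
  "ssub0 v t = ssub (case_nat v SVar) t"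

(* Program contexts: terms with exactly one hole, possibly under binders. *)
datatype sctx =
    SCHole
  | SCLam ty sctx
  | SCApp1 sctx stm
  | SCApp2 stm sctx
  | SCFst sctx
  | SCSnd sctx
  | SCPair1 sctx stm
  | SCPair2 stm sctx
  | SCInl sctx
  | SCInr sctx
  | SCCase0 sctx stm stm
  | SCCase1 stm sctx stm
  | SCCase2 stm stm sctx
  | SCSeq1 sctx stm
  | SCSeq2 stm sctx
  | SCIf0 sctx stm stm
  | SCIf1 stm sctx stm
  | SCIf2 stm stm sctx
  | SCFix ty ty sctx

(* Capturing, hence no shifting of the plugged term. *)
primrec splug :: "sctx \<Rightarrow> stm \<Rightarrow> stm" where
  "splug SCHole t = t"
| "splug (SCLam \<tau> C) t = SLam \<tau> (splug C t)"
| "splug (SCApp1 C u) t = SApp (splug C t) u"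
| "splug (SCApp2 u C) t = SApp u (splug C t)"
| "splug (SCFst C) t = SFst (splug C t)"
| "splug (SCSnd C) t = SSnd (splug C t)"
| "splug (SCPair1 C u) t = SPair (splug C t) u"
| "splug (SCPair2 u C) t = SPair u (splug C t)"
| "splug (SCInl C) t = SInl (splug C t)"
| "splug (SCInr C) t = SInr (splug C t)"
| "splug (SCCase0 C u1 u2) t = SCase (splug C t) u1 u2"
| "splug (SCCase1 u C u2) t = SCase u (splug C t) u2"
| "splug (SCCase2 u u1 C) t = SCase u u1 (splug C t)"
| "splug (SCSeq1 C u) t = SSeq (splug C t) u"
| "splug (SCSeq2 u C) t = SSeq u (splug C t)"
| "splug (SCIf0 C u1 u2) t = SIf (splug C t) u1 u2"
| "splug (SCIf1 u C u2) t = SIf u (splug C t) u2"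
| "splug (SCIf2 u u1 C) t = SIf u u1 (splug C t)"
| "splug (SCFix \<tau>1 \<tau>2 C) t = SFix \<tau>1 \<tau>2 (splug C t)"

inductive sectx :: "sctx \<Rightarrow> bool" where
  "sectx SCHole"
| "sectx E \<Longrightarrow> sectx (SCApp1 E t)"
| "svalue v \<Longrightarrow> sectx E \<Longrightarrow> sectx (SCApp2 v E)"
| "sectx E \<Longrightarrow> sectx (SCFst E)"
| "sectx E \<Longrightarrow> sectx (SCSnd E)"
| "sectx E \<Longrightarrow> sectx (SCPair1 E t)"
| "svalue v \<Longrightarrow> sectx E \<Longrightarrow> sectx (SCPair2 v E)"
| "sectx E \<Longrightarrow> sectx (SCInl E)"
| "sectx E \<Longrightarrow> sectx (SCInr E)"
| "sectx E \<Longrightarrow> sectx (SCCase0 E t1 t2)"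
| "sectx E \<Longrightarrow> sectx (SCSeq1 E t)"
| "sectx E \<Longrightarrow> sectx (SCIf0 E t1 t2)"
| "sectx E \<Longrightarrow> sectx (SCFix \<tau>1 \<tau>2 E)"

inductive shead :: "stm \<Rightarrow> stm \<Rightarrow> bool" where
  SH_Beta: "svalue v \<Longrightarrow> shead (SApp (SLam \<tau> t) v) (ssub0 v t)"
| SH_Fst: "svalue v1 \<Longrightarrow> svalue v2 \<Longrightarrow> shead (SFst (SPair v1 v2)) v1"
| SH_Snd: "svalue v1 \<Longrightarrow> svalue v2 \<Longrightarrow> shead (SSnd (SPair v1 v2)) v2"
| SH_CaseInl: "svalue v \<Longrightarrow> shead (SCase (SInl v) t1 t2) (ssub0 v t1)"
| SH_CaseInr: "svalue v \<Longrightarrow> shead (SCase (SInr v) t1 t2) (ssub0 v t2)"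
| SH_Seq: "shead (SSeq SUnit t) t"
| SH_IfTrue: "shead (SIf STrue t1 t2) t1"
| SH_IfFalse: "shead (SIf SFalse t1 t2) t2"
| SH_Fix: "F = SFix \<tau>1 \<tau>2 (SLam (TFun \<tau>1 \<tau>2) t)
    \<Longrightarrow> shead F (ssub0 (SLam \<tau>1 (SApp (sren Suc F) (SVar 0))) t)"

inductive sstep :: "stm \<Rightarrow> stm \<Rightarrow> bool" where
  "sectx E \<Longrightarrow> shead t t' \<Longrightarrow> sstep (splug E t) (splug E t')"

definition sterminates :: "stm \<Rightarrow> bool" where
  "sterminates t \<longleftrightarrow> (\<exists>v. svalue v \<and> sstep\<^sup>*\<^sup>* t v)"

(* sctx_type C G' t' G t renders the judgement C : G',t' -> G,t. *)
inductive sctx_type :: "sctx \<Rightarrow> ty list \<Rightarrow> ty \<Rightarrow> ty list \<Rightarrow> ty \<Rightarrow> bool" where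
  CT_Hole: "sctx_type SCHole \<Delta> \<delta> \<Delta> \<delta>"
| CT_Lam: "sctx_type C \<Delta> \<delta> (\<tau>1 # \<Gamma>) \<tau>2 \<Longrightarrow> sctx_type (SCLam \<tau>1 C) \<Delta> \<delta> \<Gamma> (TFun \<tau>1 \<tau>2)"
| CT_App1: "sctx_type C \<Delta> \<delta> \<Gamma> (TFun \<tau>1 \<tau>2) \<Longrightarrow> has_type \<Gamma> t \<tau>1 \<Longrightarrow> sctx_type (SCApp1 C t) \<Delta> \<delta> \<Gamma> \<tau>2"
| CT_App2: "has_type \<Gamma> t (TFun \<tau>1 \<tau>2) \<Longrightarrow> sctx_type C \<Delta> \<delta> \<Gamma> \<tau>1 \<Longrightarrow> sctx_type (SCApp2 t C) \<Delta> \<delta> \<Gamma> \<tau>2"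
| CT_Fst: "sctx_type C \<Delta> \<delta> \<Gamma> (TProd \<tau>1 \<tau>2) \<Longrightarrow> sctx_type (SCFst C) \<Delta> \<delta> \<Gamma> \<tau>1"
| CT_Snd: "sctx_type C \<Delta> \<delta> \<Gamma> (TProd \<tau>1 \<tau>2) \<Longrightarrow> sctx_type (SCSnd C) \<Delta> \<delta> \<Gamma> \<tau>2"
| CT_Pair1: "sctx_type C \<Delta> \<delta> \<Gamma> \<tau>1 \<Longrightarrow> has_type \<Gamma> t \<tau>2 \<Longrightarrow> sctx_type (SCPair1 C t) \<Delta> \<delta> \<Gamma> (TProd \<tau>1 \<tau>2)"
| CT_Pair2: "has_type \<Gamma> t \<tau>1 \<Longrightarrow> sctx_type C \<Delta> \<delta> \<Gamma> \<tau>2 \<Longrightarrow> sctx_type (SCPair2 t C) \<Delta> \<delta> \<Gamma> (TProd \<tau>1 \<tau>2)"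
| CT_Inl: "sctx_type C \<Delta> \<delta> \<Gamma> \<tau>1 \<Longrightarrow> sctx_type (SCInl C) \<Delta> \<delta> \<Gamma> (TSum \<tau>1 \<tau>2)"
| CT_Inr: "sctx_type C \<Delta> \<delta> \<Gamma> \<tau>2 \<Longrightarrow> sctx_type (SCInr C) \<Delta> \<delta> \<Gamma> (TSum \<tau>1 \<tau>2)"
| CT_Case0: "sctx_type C \<Delta> \<delta> \<Gamma> (TSum \<tau>1 \<tau>2) \<Longrightarrow> has_type (\<tau>1 # \<Gamma>) t1 \<tau> \<Longrightarrow> has_type (\<tau>2 # \<Gamma>) t2 \<tau>
    \<Longrightarrow> sctx_type (SCCase0 C t1 t2) \<Delta> \<delta> \<Gamma> \<tau>"
| CT_Case1: "has_type \<Gamma> t (TSum \<tau>1 \<tau>2) \<Longrightarrow> sctx_type C \<Delta> \<delta> (\<tau>1 # \<Gamma>) \<tau> \<Longrightarrow> has_type (\<tau>2 # \<Gamma>) t2 \<tau>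
    \<Longrightarrow> sctx_type (SCCase1 t C t2) \<Delta> \<delta> \<Gamma> \<tau>"
| CT_Case2: "has_type \<Gamma> t (TSum \<tau>1 \<tau>2) \<Longrightarrow> has_type (\<tau>1 # \<Gamma>) t1 \<tau> \<Longrightarrow> sctx_type C \<Delta> \<delta> (\<tau>2 # \<Gamma>) \<tau>
    \<Longrightarrow> sctx_type (SCCase2 t t1 C) \<Delta> \<delta> \<Gamma> \<tau>"
| CT_Seq1: "sctx_type C \<Delta> \<delta> \<Gamma> TUnit \<Longrightarrow> has_type \<Gamma> t \<tau> \<Longrightarrow> sctx_type (SCSeq1 C t) \<Delta> \<delta> \<Gamma> \<tau>"
| CT_Seq2: "has_type \<Gamma> t TUnit \<Longrightarrow> sctx_type C \<Delta> \<delta> \<Gamma> \<tau> \<Longrightarrow> sctx_type (SCSeq2 t C) \<Delta> \<delta> \<Gamma> \<tau>"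
| CT_If0: "sctx_type C \<Delta> \<delta> \<Gamma> TBool \<Longrightarrow> has_type \<Gamma> t1 \<tau> \<Longrightarrow> has_type \<Gamma> t2 \<tau>
    \<Longrightarrow> sctx_type (SCIf0 C t1 t2) \<Delta> \<delta> \<Gamma> \<tau>"
| CT_If1: "has_type \<Gamma> t TBool \<Longrightarrow> sctx_type C \<Delta> \<delta> \<Gamma> \<tau> \<Longrightarrow> has_type \<Gamma> t2 \<tau>
    \<Longrightarrow> sctx_type (SCIf1 t C t2) \<Delta> \<delta> \<Gamma> \<tau>"
| CT_If2: "has_type \<Gamma> t TBool \<Longrightarrow> has_type \<Gamma> t1 \<tau> \<Longrightarrow> sctx_type C \<Delta> \<delta> \<Gamma> \<tau>
    \<Longrightarrow> sctx_type (SCIf2 t t1 C) \<Delta> \<delta> \<Gamma> \<tau>"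
| CT_Fix: "sctx_type C \<Delta> \<delta> \<Gamma> (TFun (TFun \<tau>1 \<tau>2) (TFun \<tau>1 \<tau>2))
    \<Longrightarrow> sctx_type (SCFix \<tau>1 \<tau>2 C) \<Delta> \<delta> \<Gamma> (TFun \<tau>1 \<tau>2)"

definition sctx_equiv :: "ty list \<Rightarrow> stm \<Rightarrow> stm \<Rightarrow> ty \<Rightarrow> bool" where
  "sctx_equiv \<Gamma> t1 t2 \<tau> \<longleftrightarrow>
     (\<forall>\<tau>' C. sctx_type C \<Gamma> \<tau> [] \<tau>' \<longrightarrow> (sterminates (splug C t1) \<longleftrightarrow> sterminates (splug C t2)))"


section \<open>The target language\<close>

datatype utm =
    UUnit
  | UTrue
  | UFalse
  | ULam utm
  | UVar nat
  | UApp utm utm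
  | UFst utm
  | USnd utm
  | UPair utm utm
  | UInl utm
  | UInr utm
  | UCase utm utm utm
  | USeq utm utm
  | UIf utm utm utm
  | UWrong

inductive uvalue :: "utm \<Rightarrow> bool" where
  "uvalue UUnit"
| "uvalue UTrue"
| "uvalue UFalse"
| "uvalue (ULam t)"
| "uvalue v1 \<Longrightarrow> uvalue v2 \<Longrightarrow> uvalue (UPair v1 v2)"
| "uvalue v \<Longrightarrow> uvalue (UInl v)"
| "uvalue v \<Longrightarrow> uvalue (UInr v)"

primrec ufv :: "utm \<Rightarrow> nat set" where
  "ufv UUnit = {}"
| "ufv UTrue = {}"
| "ufv UFalse = {}"
| "ufv (ULam t) = {i. Suc i \<in> ufv t}"
| "ufv (UVar i) = {i}"
| "ufv (UApp t1 t2) = ufv t1 \<union> ufv t2"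
| "ufv (UFst t) = ufv t"
| "ufv (USnd t) = ufv t"
| "ufv (UPair t1 t2) = ufv t1 \<union> ufv t2"
| "ufv (UInl t) = ufv t"
| "ufv (UInr t) = ufv t"
| "ufv (UCase t t1 t2) = ufv t \<union> {i. Suc i \<in> ufv t1} \<union> {i. Suc i \<in> ufv t2}"
| "ufv (USeq t1 t2) = ufv t1 \<union> ufv t2"
| "ufv (UIf t t1 t2) = ufv t \<union> ufv t1 \<union> ufv t2"
| "ufv UWrong = {}"

(* An untyped context is represented by its length n; its variables are the indices below n. *)
definition uscoped :: "nat \<Rightarrow> utm \<Rightarrow> bool" where
  "uscoped n t \<longleftrightarrow> ufv t \<subseteq> {..<n}"

primrec uren :: "(nat \<Rightarrow> nat) \<Rightarrow> utm \<Rightarrow> utm" where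
  "uren r UUnit = UUnit"
| "uren r UTrue = UTrue"
| "uren r UFalse = UFalse"
| "uren r (ULam t) = ULam (uren (up_ren r) t)"
| "uren r (UVar i) = UVar (r i)"
| "uren r (UApp t1 t2) = UApp (uren r t1) (uren r t2)"
| "uren r (UFst t) = UFst (uren r t)"
| "uren r (USnd t) = USnd (uren r t)"
| "uren r (UPair t1 t2) = UPair (uren r t1) (uren r t2)"
| "uren r (UInl t) = UInl (uren r t)"
| "uren r (UInr t) = UInr (uren r t)"
| "uren r (UCase t t1 t2) = UCase (uren r t) (uren (up_ren r) t1) (uren (up_ren r) t2)"
| "uren r (USeq t1 t2) = USeq (uren r t1) (uren r t2)"
| "uren r (UIf t t1 t2) = UIf (uren r t) (uren r t1) (uren r t2)"
| "uren r UWrong = UWrong"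

definition up_usub :: "(nat \<Rightarrow> utm) \<Rightarrow> nat \<Rightarrow> utm" where
  "up_usub s = case_nat (UVar 0) (\<lambda>i. uren Suc (s i))"

primrec usub :: "(nat \<Rightarrow> utm) \<Rightarrow> utm \<Rightarrow> utm" where
  "usub s UUnit = UUnit"
| "usub s UTrue = UTrue"
| "usub s UFalse = UFalse"
| "usub s (ULam t) = ULam (usub (up_usub s) t)"
| "usub s (UVar i) = s i"
| "usub s (UApp t1 t2) = UApp (usub s t1) (usub s t2)"
| "usub s (UFst t) = UFst (usub s t)"
| "usub s (USnd t) = USnd (usub s t)"
| "usub s (UPair t1 t2) = UPair (usub s t1) (usub s t2)"
| "usub s (UInl t) = UInl (usub s t)"
| "usub s (UInr t) = UInr (usub s t)"
| "usub s (UCase t t1 t2) = UCase (usub s t) (usub (up_usub s) t1) (usub (up_usub s) t2)"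
| "usub s (USeq t1 t2) = USeq (usub s t1) (usub s t2)"
| "usub s (UIf t t1 t2) = UIf (usub s t) (usub s t1) (usub s t2)"
| "usub s UWrong = UWrong"

definition usub0 :: "utm \<Rightarrow> utm \<Rightarrow> utm" where
  "usub0 v t = usub (case_nat v UVar) t"

datatype uctx =
    UCHole
  | UCLam uctx
  | UCApp1 uctx utm
  | UCApp2 utm uctx
  | UCFst uctx
  | UCSnd uctx
  | UCPair1 uctx utm
  | UCPair2 utm uctx
  | UCInl uctx
  | UCInr uctx
  | UCCase0 uctx utm utm
  | UCCase1 utm uctx utm
  | UCCase2 utm utm uctx
  | UCSeq1 uctx utm
  | UCSeq2 utm uctx
  | UCIf0 uctx utm utm
  | UCIf1 utm uctx utm
  | UCIf2 utm utm uctx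

primrec uplug :: "uctx \<Rightarrow> utm \<Rightarrow> utm" where
  "uplug UCHole t = t"
| "uplug (UCLam C) t = ULam (uplug C t)"
| "uplug (UCApp1 C u) t = UApp (uplug C t) u"
| "uplug (UCApp2 u C) t = UApp u (uplug C t)"
| "uplug (UCFst C) t = UFst (uplug C t)"
| "uplug (UCSnd C) t = USnd (uplug C t)"
| "uplug (UCPair1 C u) t = UPair (uplug C t) u"
| "uplug (UCPair2 u C) t = UPair u (uplug C t)"
| "uplug (UCInl C) t = UInl (uplug C t)"
| "uplug (UCInr C) t = UInr (uplug C t)"
| "uplug (UCCase0 C u1 u2) t = UCase (uplug C t) u1 u2"
| "uplug (UCCase1 u C u2) t = UCase u (uplug C t) u2"
| "uplug (UCCase2 u u1 C) t = UCase u u1 (uplug C t)"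
| "uplug (UCSeq1 C u) t = USeq (uplug C t) u"
| "uplug (UCSeq2 u C) t = USeq u (uplug C t)"
| "uplug (UCIf0 C u1 u2) t = UIf (uplug C t) u1 u2"
| "uplug (UCIf1 u C u2) t = UIf u (uplug C t) u2"
| "uplug (UCIf2 u u1 C) t = UIf u u1 (uplug C t)"

inductive uectx :: "uctx \<Rightarrow> bool" where
  "uectx UCHole"
| "uectx E \<Longrightarrow> uectx (UCApp1 E t)"
| "uvalue v \<Longrightarrow> uectx E \<Longrightarrow> uectx (UCApp2 v E)"
| "uectx E \<Longrightarrow> uectx (UCFst E)"
| "uectx E \<Longrightarrow> uectx (UCSnd E)"
| "uectx E \<Longrightarrow> uectx (UCPair1 E t)"
| "uvalue v \<Longrightarrow> uectx E \<Longrightarrow> uectx (UCPair2 v E)"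
| "uectx E \<Longrightarrow> uectx (UCInl E)"
| "uectx E \<Longrightarrow> uectx (UCInr E)"
| "uectx E \<Longrightarrow> uectx (UCCase0 E t1 t2)"
| "uectx E \<Longrightarrow> uectx (UCSeq1 E t)"
| "uectx E \<Longrightarrow> uectx (UCIf0 E t1 t2)"

inductive uhead :: "utm \<Rightarrow> utm \<Rightarrow> bool" where
  UH_Beta: "uvalue v \<Longrightarrow> uhead (UApp (ULam t) v) (usub0 v t)"
| UH_Fst: "uvalue v1 \<Longrightarrow> uvalue v2 \<Longrightarrow> uhead (UFst (UPair v1 v2)) v1"
| UH_Snd: "uvalue v1 \<Longrightarrow> uvalue v2 \<Longrightarrow> uhead (USnd (UPair v1 v2)) v2"
| UH_CaseInl: "uvalue v \<Longrightarrow> uhead (UCase (UInl v) t1 t2) (usub0 v t1)"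
| UH_CaseInr: "uvalue v \<Longrightarrow> uhead (UCase (UInr v) t1 t2) (usub0 v t2)"
| UH_Seq: "uhead (USeq UUnit t) t"
| UH_IfTrue: "uhead (UIf UTrue t1 t2) t1"
| UH_IfFalse: "uhead (UIf UFalse t1 t2) t2"
| UH_AppWrong: "uvalue v1 \<Longrightarrow> uvalue v2 \<Longrightarrow> \<nexists>t. v1 = ULam t \<Longrightarrow> uhead (UApp v1 v2) UWrong"
| UH_FstWrong: "uvalue v \<Longrightarrow> \<nexists>v1 v2. v = UPair v1 v2 \<Longrightarrow> uhead (UFst v) UWrong"
| UH_SndWrong: "uvalue v \<Longrightarrow> \<nexists>v1 v2. v = UPair v1 v2 \<Longrightarrow> uhead (USnd v) UWrong"
| UH_CaseWrong: "uvalue v \<Longrightarrow> \<nexists>v'. v = UInl v' \<or> v = UInr v' \<Longrightarrow> uhead (UCase v t1 t2) UWrong"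
| UH_SeqWrong: "uvalue v \<Longrightarrow> v \<noteq> UUnit \<Longrightarrow> uhead (USeq v t) UWrong"
| UH_IfWrong: "uvalue v \<Longrightarrow> v \<noteq> UTrue \<Longrightarrow> v \<noteq> UFalse \<Longrightarrow> uhead (UIf v t1 t2) UWrong"

inductive ustep :: "utm \<Rightarrow> utm \<Rightarrow> bool" where
  US_Ctx: "uectx E \<Longrightarrow> uhead t t' \<Longrightarrow> ustep (uplug E t) (uplug E t')"
| US_Wrong: "uectx E \<Longrightarrow> E \<noteq> UCHole \<Longrightarrow> ustep (uplug E UWrong) UWrong"

definition uterminates :: "utm \<Rightarrow> bool" where
  "uterminates t \<longleftrightarrow> (\<exists>v. uvalue v \<and> ustep\<^sup>*\<^sup>* t v)"

(* uctx_scoped C m n: plugging a term scoped in m variables into C gives one scoped in n variables. *)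
inductive uctx_scoped :: "uctx \<Rightarrow> nat \<Rightarrow> nat \<Rightarrow> bool" where
  CS_Hole: "uctx_scoped UCHole m m"
| CS_Lam: "uctx_scoped C m (Suc n) \<Longrightarrow> uctx_scoped (UCLam C) m n"
| CS_App1: "uctx_scoped C m n \<Longrightarrow> uscoped n t \<Longrightarrow> uctx_scoped (UCApp1 C t) m n"
| CS_App2: "uscoped n t \<Longrightarrow> uctx_scoped C m n \<Longrightarrow> uctx_scoped (UCApp2 t C) m n"
| CS_Fst: "uctx_scoped C m n \<Longrightarrow> uctx_scoped (UCFst C) m n"
| CS_Snd: "uctx_scoped C m n \<Longrightarrow> uctx_scoped (UCSnd C) m n"
| CS_Pair1: "uctx_scoped C m n \<Longrightarrow> uscoped n t \<Longrightarrow> uctx_scoped (UCPair1 C t) m n"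
| CS_Pair2: "uscoped n t \<Longrightarrow> uctx_scoped C m n \<Longrightarrow> uctx_scoped (UCPair2 t C) m n"
| CS_Inl: "uctx_scoped C m n \<Longrightarrow> uctx_scoped (UCInl C) m n"
| CS_Inr: "uctx_scoped C m n \<Longrightarrow> uctx_scoped (UCInr C) m n"
| CS_Case0: "uctx_scoped C m n \<Longrightarrow> uscoped (Suc n) t1 \<Longrightarrow> uscoped (Suc n) t2
    \<Longrightarrow> uctx_scoped (UCCase0 C t1 t2) m n"
| CS_Case1: "uscoped n t \<Longrightarrow> uctx_scoped C m (Suc n) \<Longrightarrow> uscoped (Suc n) t2
    \<Longrightarrow> uctx_scoped (UCCase1 t C t2) m n"
| CS_Case2: "uscoped n t \<Longrightarrow> uscoped (Suc n) t1 \<Longrightarrow> uctx_scoped C m (Suc n)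
    \<Longrightarrow> uctx_scoped (UCCase2 t t1 C) m n"
| CS_Seq1: "uctx_scoped C m n \<Longrightarrow> uscoped n t \<Longrightarrow> uctx_scoped (UCSeq1 C t) m n"
| CS_Seq2: "uscoped n t \<Longrightarrow> uctx_scoped C m n \<Longrightarrow> uctx_scoped (UCSeq2 t C) m n"
| CS_If0: "uctx_scoped C m n \<Longrightarrow> uscoped n t1 \<Longrightarrow> uscoped n t2 \<Longrightarrow> uctx_scoped (UCIf0 C t1 t2) m n"
| CS_If1: "uscoped n t \<Longrightarrow> uctx_scoped C m n \<Longrightarrow> uscoped n t2 \<Longrightarrow> uctx_scoped (UCIf1 t C t2) m n"
| CS_If2: "uscoped n t \<Longrightarrow> uscoped n t1 \<Longrightarrow> uctx_scoped C m n \<Longrightarrow> uctx_scoped (UCIf2 t t1 C) m n"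

definition uctx_equiv :: "nat \<Rightarrow> utm \<Rightarrow> utm \<Rightarrow> bool" where
  "uctx_equiv n t1 t2 \<longleftrightarrow>
     (\<forall>C. uctx_scoped C n 0 \<longrightarrow> (uterminates (uplug C t1) \<longleftrightarrow> uterminates (uplug C t2)))"


section \<open>The modular compiler\<close>

(* The call-by-value combinator \f. (\x. f (\y. x x y)) (\x. f (\y. x x y)). *)
definition ufix :: utm where
  "ufix =
     (let w = ULam (UApp (UVar 1) (ULam (UApp (UApp (UVar 1) (UVar 1)) (UVar 0))))
      in ULam (UApp w w))"

primrec erase :: "stm \<Rightarrow> utm" where
  "erase SUnit = UUnit"
| "erase STrue = UTrue"
| "erase SFalse = UFalse"
| "erase (SLam \<tau> t) = ULam (erase t)"
| "erase (SVar i) = UVar i"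
| "erase (SApp t1 t2) = UApp (erase t1) (erase t2)"
| "erase (SFst t) = UFst (erase t)"
| "erase (SSnd t) = USnd (erase t)"
| "erase (SPair t1 t2) = UPair (erase t1) (erase t2)"
| "erase (SInl t) = UInl (erase t)"
| "erase (SInr t) = UInr (erase t)"
| "erase (SCase t t1 t2) = UCase (erase t) (erase t1) (erase t2)"
| "erase (SSeq t1 t2) = USeq (erase t1) (erase t2)"
| "erase (SIf t t1 t2) = UIf (erase t) (erase t1) (erase t2)"
| "erase (SFix \<tau>1 \<tau>2 t) = UApp ufix (erase t)"

(* These terms are closed, so the recursive calls need no shifting. *)
fun protect :: "ty \<Rightarrow> utm" and confine :: "ty \<Rightarrow> utm" where
  "protect TUnit = ULam (UVar 0)"
| "protect TBool = ULam (UVar 0)"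
| "protect (TProd \<tau>1 \<tau>2) =
     ULam (UPair (UApp (protect \<tau>1) (UFst (UVar 0))) (UApp (protect \<tau>2) (USnd (UVar 0))))"
| "protect (TSum \<tau>1 \<tau>2) =
     ULam (UCase (UVar 0) (UInl (UApp (protect \<tau>1) (UVar 0))) (UInr (UApp (protect \<tau>2) (UVar 0))))"
| "protect (TFun \<tau>1 \<tau>2) =
     ULam (ULam (UApp (protect \<tau>2) (UApp (UVar 1) (UApp (confine \<tau>1) (UVar 0)))))"
| "confine TUnit = ULam (USeq (UVar 0) UUnit)"
| "confine TBool = ULam (UIf (UVar 0) UTrue UFalse)"
| "confine (TProd \<tau>1 \<tau>2) =
     ULam (UPair (UApp (confine \<tau>1) (UFst (UVar 0))) (UApp (confine \<tau>2) (USnd (UVar 0))))"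
| "confine (TSum \<tau>1 \<tau>2) =
     ULam (UCase (UVar 0) (UInl (UApp (confine \<tau>1) (UVar 0))) (UInr (UApp (confine \<tau>2) (UVar 0))))"
| "confine (TFun \<tau>1 \<tau>2) =
     ULam (ULam (UApp (confine \<tau>2) (UApp (UVar 1) (UApp (protect \<tau>1) (UVar 0)))))"

(* modcomp \<sigma>' \<sigma> \<rho>' \<rho> t compiles SLam \<rho>' t, where [TFun \<sigma>' \<sigma>] is the typing context and
   TFun \<rho>' \<rho> the type of that abstraction. In t, index 0 is the argument w and index 1 the
   free variable z. The compiled body is \w. (\z. erase t) (confine z): under its binder for z,
   index 0 is z and index 1 is w, so the first two indices of erase t are exchanged and indices
   from 2 on are shifted over the additional binder. *)
definition modcomp :: "ty \<Rightarrow> ty \<Rightarrow> ty \<Rightarrow> ty \<Rightarrow> stm \<Rightarrow> utm" where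
  "modcomp \<sigma>' \<sigma> \<rho>' \<rho> t =
     UApp (protect (TFun \<rho>' \<rho>))
       (ULam (UApp
         (ULam (uren (\<lambda>i. case i of 0 \<Rightarrow> 1 | Suc 0 \<Rightarrow> 0 | Suc (Suc j) \<Rightarrow> j + 3) (erase t)))
         (UApp (confine (TFun \<sigma>' \<sigma>)) (UVar 1))))"

end

theory Submission
  imports Defs
begin

text \<open>
  Both languages get an environment semantics with costs, in which a computation is a relation between
  costs and values. A step-indexed simulation between computations, parametric in its direction,
  bounds the cost of one side and asks the other side for a related value.

  Equivalence of the compiled terms implies equivalence of the source terms: a well-typed term is
  related to its erasure, and the wrappers protect and confine send related values to related values,
  so \<open>C[t]\<close> terminates iff its erasure around the compiled \<open>t\<close> does.

  For the converse, a target context is translated back into a source context. The untyped values are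
  represented in the simple types \<open>uvt n\<close>, the \<open>n\<close>-th unfolding of the recursive type of untyped
  values, with an extra summand for values about which too little is known. Injection into and
  extraction from \<open>uvt n\<close> mirror protect and confine, and failure is emulated by divergence. The
  emulation is sound for all computations in one direction and precise for the first \<open>n\<close> steps in the
  other. Hence if the context terminates with \<open>t1\<close> in \<open>j\<close> steps, then so does the back-translation at
  level \<open>j + 1\<close>, by equivalence it terminates with \<open>t2\<close>, and by soundness so does the target context.

  A target context may bind the free variable at a type \<open>uvt l\<close> while the source hole expects it at its
  own type, so the hole is first abstracted to a function of that variable, which the
  back-translation applies to the extracted value.
\<close>

section \<open>Computations with a cost\<close>

text \<open>The obstacle is that the simple types contain no recursive type of untyped values, so a
  target context has no exact typed counterpart. Only finite unfoldings exist, and every elimination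
  of a function, a pair or a sum uses one up; the cost counts exactly these eliminations. One
  direction of simulation would not do. Carrying a given run with \<open>t1\<close> into the source
  needs precision, but only for the length of that run. The source run with \<open>t2\<close>
  obtained in return may have any length, so going back needs soundness without bound. One family of
  relations serves both purposes: the direction is a parameter, and the bound by the level is
  imposed on \<open>Bwd\<close> alone. Failure and divergence both count as having no outcome, which
  is why a diverging source term may stand for a failing target term. One-sided ticks are harmless
  in both directions, so the administrative steps of wrappers and back-translation never have to be
  counted.\<close>

type_synonym 'a comp = "nat \<Rightarrow> 'a \<Rightarrow> bool"

definition ret :: "'a \<Rightarrow> 'a comp" where
  "ret v = (\<lambda>j w. j = 0 \<and> w = v)"

definition bind :: "'a comp \<Rightarrow> ('a \<Rightarrow> 'b comp) \<Rightarrow> 'b comp" where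
  "bind c f = (\<lambda>j w. \<exists>i l v. c i v \<and> f v l w \<and> j = i + l)"

definition tick :: "'a comp \<Rightarrow> 'a comp" where
  "tick c = (\<lambda>j w. \<exists>i. j = Suc i \<and> c i w)"

definition fail :: "'a comp" where
  "fail = (\<lambda>_ _. False)"

lemma retI: "ret v 0 v"
  by (simp add: ret_def)

lemma tickI: "c j v \<Longrightarrow> tick c (Suc j) v"
  by (simp add: tick_def)

lemma bindI: "c i v \<Longrightarrow> f v = c' \<Longrightarrow> c' l w \<Longrightarrow> j = i + l \<Longrightarrow> bind c f j w"
  by (auto simp: bind_def)

lemma bindE:
  assumes "bind c f j w"
  obtains i l v where "c i v" "f v l w" "j = i + l"
  using assms by (auto simp: bind_def)

lemma bind_ret [simp]: "bind (ret v) f = f v"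
  by (auto simp: bind_def ret_def fun_eq_iff)

lemma bind_ret_right [simp]: "bind c ret = c"
  by (auto simp: bind_def ret_def fun_eq_iff)

lemma bind_bind [simp]: "bind (bind c f) g = bind c (\<lambda>v. bind (f v) g)"
  unfolding bind_def fun_eq_iff by (metis add.assoc)

lemma bind_tick [simp]: "bind (tick c) f = tick (bind c f)"
  unfolding bind_def tick_def fun_eq_iff by (metis add_Suc)

lemma bind_fail [simp]: "bind fail f = fail"
  by (auto simp: bind_def fail_def)

lemma bind_fail_right [simp]: "bind c (\<lambda>_. fail) = fail"
  by (auto simp: bind_def fail_def)

lemma tick_fail [simp]: "tick fail = fail"
  by (auto simp: tick_def fail_def)

lemma bind_funpow_tick [simp]: "bind ((tick ^^ n) c) f = (tick ^^ n) (bind c f)"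
  by (induction n) auto

text \<open>An outcome of cost j would give one of cost j - 2, and so on without end. Divergence is
  thus proved by induction on the cost alone.\<close>

lemma tick_loop_eq_fail:
  assumes "c = tick (tick c)"
  shows "c = fail"
proof -
  have "\<not> c j v" for j v
  proof (induction j rule: less_induct)
    case (less j)
    show ?case
    proof
      assume "c j v"
      then have "tick (tick c) j v" using assms by simp
      then obtain i where "j = Suc (Suc i)" "c i v" unfolding tick_def by blast
      then show False using less by auto
    qed
  qed
  then show ?thesis by (auto simp: fail_def)
qed

section \<open>Step-indexed simulation of computations\<close>

datatype dir = Fwd | Bwd

(* The step index k bounds the cost of the side whose outcome is given: the left side for Fwd,
   the right side for Bwd. *)
definition sim :: "dir \<Rightarrow> (nat \<Rightarrow> 'a \<Rightarrow> 'b \<Rightarrow> bool) \<Rightarrow> nat \<Rightarrow> 'a comp \<Rightarrow> 'b comp \<Rightarrow> bool" where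
  "sim d P k c c' \<longleftrightarrow> (case d of
     Fwd \<Rightarrow> \<forall>j v. c j v \<longrightarrow> j < k \<longrightarrow> (\<exists>j' v'. c' j' v' \<and> P (k - j) v v')
   | Bwd \<Rightarrow> \<forall>j v'. c' j v' \<longrightarrow> j < k \<longrightarrow> (\<exists>j' v. c j' v \<and> P (k - j) v v'))"

definition antimono_rel :: "(nat \<Rightarrow> 'a \<Rightarrow> 'b \<Rightarrow> bool) \<Rightarrow> bool" where
  "antimono_rel P \<longleftrightarrow> (\<forall>j k v w. j \<le> k \<longrightarrow> P k v w \<longrightarrow> P j v w)"

lemma antimono_relD: "antimono_rel P \<Longrightarrow> P k v w \<Longrightarrow> j \<le> k \<Longrightarrow> P j v w"
  by (auto simp: antimono_rel_def)

lemma sim_0 [simp]: "sim d P 0 c c'"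
  by (cases d) (auto simp: sim_def)

lemma sim_ret: "P k v w \<Longrightarrow> sim d P k (ret v) (ret w)"
  by (cases d) (auto simp: sim_def ret_def)

lemma sim_fail [simp]: "sim d P k fail fail"
  by (cases d) (auto simp: sim_def fail_def)

lemma sim_fail_left [simp]: "sim Fwd P k fail c"
  by (auto simp: sim_def fail_def)

lemma sim_fail_right [simp]: "sim Bwd P k c fail"
  by (auto simp: sim_def fail_def)

text \<open>If the first part of the given run costs i, the index k - i is left for the second part,
  while the cost of the matching run is never compared. Runs of cost k or more demand nothing, so
  only positive remaining indices occur.\<close>

lemma sim_bind:
  assumes "sim d P k c c'"
    and "\<And>j v w. j \<le> k \<Longrightarrow> 0 < j \<Longrightarrow> P j v w \<Longrightarrow> sim d Q j (f v) (g w)"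
  shows "sim d Q k (bind c f) (bind c' g)"
proof (cases d)
  case Fwd
  have "\<exists>j' v'. bind c' g j' v' \<and> Q (k - j) v v'" if h: "bind c f j v" "j < k" for j v
  proof -
    obtain i l u where u: "c i u" "f u l v" "j = i + l" using h by (auto simp: bind_def)
    then obtain i' u' where u': "c' i' u'" "P (k - i) u u'"
      using assms(1) h Fwd by (fastforce simp: sim_def)
    then have "sim d Q (k - i) (f u) (g u')" using assms(2) u h by auto
    then obtain l' v' where "g u' l' v'" "Q (k - i - l) v v'"
      using u h Fwd by (fastforce simp: sim_def)
    then have "bind c' g (i' + l') v'" "Q (k - j) v v'" using u u' by (auto intro: bindI)
    then show ?thesis by blast
  qed
  then show ?thesis using Fwd by (simp add: sim_def)
next
  case Bwd
  have "\<exists>j' v'. bind c f j' v' \<and> Q (k - j) v' v" if h: "bind c' g j v" "j < k" for j v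
  proof -
    obtain i l u where u: "c' i u" "g u l v" "j = i + l" using h by (auto simp: bind_def)
    then obtain i' u' where u': "c i' u'" "P (k - i) u' u"
      using assms(1) h Bwd by (fastforce simp: sim_def)
    then have "sim d Q (k - i) (f u') (g u)" using assms(2) u h by auto
    then obtain l' v' where "f u' l' v'" "Q (k - i - l) v' v"
      using u h Bwd by (fastforce simp: sim_def)
    then have "bind c f (i' + l') v'" "Q (k - j) v' v" using u u' by (auto intro: bindI)
    then show ?thesis by blast
  qed
  then show ?thesis using Bwd by (simp add: sim_def)
qed

text \<open>A tick shared by both sides uses up one step; this is where the index decreases.\<close>

lemma sim_tick:
  assumes "\<And>j. k = Suc j \<Longrightarrow> sim d P j c c'"
  shows "sim d P k (tick c) (tick c')"
proof (cases k)
  case (Suc j)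
  then have *: "sim d P j c c'" using assms by simp
  show ?thesis
  proof (cases d)
    case Fwd
    then show ?thesis using * Suc by (fastforce simp: sim_def tick_def)
  next
    case Bwd
    then show ?thesis using * Suc by (fastforce simp: sim_def tick_def)
  qed
qed simp

text \<open>If the left cost is counted, the tick merely lowers the index of the result, which
  antimonotonicity absorbs; if it is not counted, nothing changes.\<close>

lemma sim_tick_left:
  assumes "antimono_rel P" "sim d P k c c'"
  shows "sim d P k (tick c) c'"
proof (cases d)
  case Fwd
  have "\<exists>j' v'. c' j' v' \<and> P (k - j) v v'" if h: "tick c j v" "j < k" for j v
  proof -
    obtain i where i: "j = Suc i" "c i v" using h by (auto simp: tick_def)
    then obtain j' v' where "c' j' v'" "P (k - i) v v'"
      using assms(2) Fwd h by (fastforce simp: sim_def)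
    then show ?thesis using antimono_relD[OF assms(1), of "k - i" v v' "k - j"] i by fastforce
  qed
  then show ?thesis using Fwd by (simp add: sim_def)
next
  case Bwd
  then show ?thesis using assms(2) by (fastforce simp: sim_def tick_def)
qed

lemma sim_tick_right:
  assumes "antimono_rel P" "sim d P k c c'"
  shows "sim d P k c (tick c')"
proof (cases d)
  case Bwd
  have "\<exists>j' v'. c j' v' \<and> P (k - j) v' v" if h: "tick c' j v" "j < k" for j v
  proof -
    obtain i where i: "j = Suc i" "c' i v" using h by (auto simp: tick_def)
    then obtain j' v' where "c j' v'" "P (k - i) v' v"
      using assms(2) Bwd h by (fastforce simp: sim_def)
    then show ?thesis using antimono_relD[OF assms(1), of "k - i" v' v "k - j"] i by fastforce
  qed
  then show ?thesis using Bwd by (simp add: sim_def)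
next
  case Fwd
  then show ?thesis using assms(2) by (fastforce simp: sim_def tick_def)
qed

lemma sim_funpow_tick_left:
  "antimono_rel P \<Longrightarrow> sim d P k c c' \<Longrightarrow> sim d P k ((tick ^^ n) c) c'"
  by (induction n) (auto intro: sim_tick_left)

section \<open>Environment semantics of the source language\<close>

datatype sval =
    VUnit
  | VTrue
  | VFalse
  | VClos ty "nat \<Rightarrow> sval" stm
  | VPair sval sval
  | VInl sval
  | VInr sval

(* The value of the function \y. fix f y that the rule for fix substitutes. *)
definition vfix :: "ty \<Rightarrow> ty \<Rightarrow> sval \<Rightarrow> sval" where
  "vfix \<tau>1 \<tau>2 f = VClos \<tau>1 (\<lambda>_. f) (SApp (SFix \<tau>1 \<tau>2 (SVar 1)) (SVar 0))"

(* Only the eliminations of functions, pairs and sums have a cost: they are the places where the level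
   of an approximation uvt n drops. *)
inductive sev :: "(nat \<Rightarrow> sval) \<Rightarrow> stm \<Rightarrow> nat \<Rightarrow> sval \<Rightarrow> bool" where
  "sev \<rho> SUnit 0 VUnit"
| "sev \<rho> STrue 0 VTrue"
| "sev \<rho> SFalse 0 VFalse"
| "sev \<rho> (SLam \<tau> t) 0 (VClos \<tau> \<rho> t)"
| "sev \<rho> (SVar i) 0 (\<rho> i)"
| "sev \<rho> t1 i (VClos \<tau> \<rho>' b) \<Longrightarrow> sev \<rho> t2 j a \<Longrightarrow> sev (case_nat a \<rho>') b k r
    \<Longrightarrow> sev \<rho> (SApp t1 t2) (Suc (i + (j + k))) r"
| "sev \<rho> t i (VPair a b) \<Longrightarrow> sev \<rho> (SFst t) (Suc i) a"
| "sev \<rho> t i (VPair a b) \<Longrightarrow> sev \<rho> (SSnd t) (Suc i) b"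
| "sev \<rho> t1 i a \<Longrightarrow> sev \<rho> t2 j b \<Longrightarrow> sev \<rho> (SPair t1 t2) (i + j) (VPair a b)"
| "sev \<rho> t i a \<Longrightarrow> sev \<rho> (SInl t) i (VInl a)"
| "sev \<rho> t i a \<Longrightarrow> sev \<rho> (SInr t) i (VInr a)"
| "sev \<rho> t i (VInl a) \<Longrightarrow> sev (case_nat a \<rho>) t1 k r \<Longrightarrow> sev \<rho> (SCase t t1 t2) (Suc (i + k)) r"
| "sev \<rho> t i (VInr a) \<Longrightarrow> sev (case_nat a \<rho>) t2 k r \<Longrightarrow> sev \<rho> (SCase t t1 t2) (Suc (i + k)) r"
| "sev \<rho> t1 i VUnit \<Longrightarrow> sev \<rho> t2 k r \<Longrightarrow> sev \<rho> (SSeq t1 t2) (i + k) r"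
| "sev \<rho> t i VTrue \<Longrightarrow> sev \<rho> t1 k r \<Longrightarrow> sev \<rho> (SIf t t1 t2) (i + k) r"
| "sev \<rho> t i VFalse \<Longrightarrow> sev \<rho> t2 k r \<Longrightarrow> sev \<rho> (SIf t t1 t2) (i + k) r"
| "sev \<rho> t i (VClos (TFun \<tau>1 \<tau>2) \<rho>' b)
    \<Longrightarrow> sev (case_nat (vfix \<tau>1 \<tau>2 (VClos (TFun \<tau>1 \<tau>2) \<rho>' b)) \<rho>') b k r
    \<Longrightarrow> sev \<rho> (SFix \<tau>1 \<tau>2 t) (Suc (i + k)) r"

inductive_cases sev_elims:
  "sev \<rho> SUnit j v" "sev \<rho> STrue j v" "sev \<rho> SFalse j v" "sev \<rho> (SLam \<tau> t) j v"
  "sev \<rho> (SVar i) j v" "sev \<rho> (SApp t1 t2) j v" "sev \<rho> (SFst t) j v" "sev \<rho> (SSnd t) j v"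
  "sev \<rho> (SPair t1 t2) j v" "sev \<rho> (SInl t) j v" "sev \<rho> (SInr t) j v" "sev \<rho> (SCase t t1 t2) j v"
  "sev \<rho> (SSeq t1 t2) j v" "sev \<rho> (SIf t t1 t2) j v" "sev \<rho> (SFix \<tau>1 \<tau>2 t) j v"

definition sapp :: "sval \<Rightarrow> sval \<Rightarrow> sval comp" where
  "sapp f v = (case f of VClos \<tau> \<rho> b \<Rightarrow> tick (sev (case_nat v \<rho>) b) | _ \<Rightarrow> fail)"

lemma sapp_VClos [simp]: "sapp (VClos \<tau> \<rho> b) = (\<lambda>v. tick (sev (case_nat v \<rho>) b))"
  by (simp add: fun_eq_iff sapp_def)

text \<open>From here on evaluation is available as equations between computations. The rules serve
  inductions on derivations, the equations let the simplifier run concrete terms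
  symbolically.\<close>

lemma sev_SUnit [simp]: "sev \<rho> SUnit = ret VUnit"
  by (auto simp: fun_eq_iff ret_def intro: sev.intros elim: sev_elims)
lemma sev_STrue [simp]: "sev \<rho> STrue = ret VTrue"
  by (auto simp: fun_eq_iff ret_def intro: sev.intros elim: sev_elims)
lemma sev_SFalse [simp]: "sev \<rho> SFalse = ret VFalse"
  by (auto simp: fun_eq_iff ret_def intro: sev.intros elim: sev_elims)
lemma sev_SLam [simp]: "sev \<rho> (SLam \<tau> t) = ret (VClos \<tau> \<rho> t)"
  by (auto simp: fun_eq_iff ret_def intro: sev.intros elim: sev_elims)
lemma sev_SVar [simp]: "sev \<rho> (SVar i) = ret (\<rho> i)"
  by (auto simp: fun_eq_iff ret_def intro: sev.intros elim: sev_elims)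

lemma sev_SApp [simp]: "sev \<rho> (SApp t1 t2) = bind (sev \<rho> t1) (\<lambda>f. bind (sev \<rho> t2) (sapp f))"
  (is "?l = ?r")
proof (intro ext iffI)
  show "?r j v" if "?l j v" for j v
    using that by (elim sev_elims; clarify)
      (rule bindI, assumption, rule refl, rule bindI, assumption, simp, rule tickI, assumption,
        rule refl, simp)
  show "?l j v" if "?r j v" for j v
  proof -
    obtain i l f where f: "sev \<rho> t1 i f" "bind (sev \<rho> t2) (sapp f) l v" "j = i + l"
      using \<open>?r j v\<close> by (rule bindE)
    obtain i' l' a where "sev \<rho> t2 i' a" "sapp f a l' v" "l = i' + l'"
      using f(2) by (rule bindE)
    then show ?thesis
      using f by (cases f) (auto simp: sapp_def tick_def fail_def intro: sev.intros)
  qed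
qed

lemma sev_SFst [simp]:
  "sev \<rho> (SFst t) = bind (sev \<rho> t) (\<lambda>v. case v of VPair a b \<Rightarrow> tick (ret a) | _ \<Rightarrow> fail)"
  (is "?l = ?r")
proof (intro ext iffI)
  show "?r j v" if "?l j v" for j v
    using that by (elim sev_elims; clarify)
      (rule bindI, assumption, simp, (rule tickI)?, (assumption | rule retI), simp)+
  show "?l j v" if "?r j v" for j v
    using that by (rule bindE, rename_tac w, case_tac w)
      (auto simp: tick_def ret_def fail_def intro: sev.intros split: if_split_asm)
qed

lemma sev_SSnd [simp]:
  "sev \<rho> (SSnd t) = bind (sev \<rho> t) (\<lambda>v. case v of VPair a b \<Rightarrow> tick (ret b) | _ \<Rightarrow> fail)"
  (is "?l = ?r")
proof (intro ext iffI)
  show "?r j v" if "?l j v" for j v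
    using that by (elim sev_elims; clarify)
      (rule bindI, assumption, simp, (rule tickI)?, (assumption | rule retI), simp)+
  show "?l j v" if "?r j v" for j v
    using that by (rule bindE, rename_tac w, case_tac w)
      (auto simp: tick_def ret_def fail_def intro: sev.intros split: if_split_asm)
qed

lemma sev_SPair [simp]:
  "sev \<rho> (SPair t1 t2) = bind (sev \<rho> t1) (\<lambda>a. bind (sev \<rho> t2) (\<lambda>b. ret (VPair a b)))"
  by (auto simp: fun_eq_iff bind_def ret_def intro: sev.intros elim!: sev_elims)

lemma sev_SInl [simp]: "sev \<rho> (SInl t) = bind (sev \<rho> t) (\<lambda>a. ret (VInl a))"
  by (auto simp: fun_eq_iff bind_def ret_def intro: sev.intros elim!: sev_elims)

lemma sev_SInr [simp]: "sev \<rho> (SInr t) = bind (sev \<rho> t) (\<lambda>a. ret (VInr a))"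
  by (auto simp: fun_eq_iff bind_def ret_def intro: sev.intros elim!: sev_elims)

lemma sev_SCase [simp]:
  "sev \<rho> (SCase t t1 t2) = bind (sev \<rho> t) (\<lambda>v. case v of
      VInl a \<Rightarrow> tick (sev (case_nat a \<rho>) t1)
    | VInr a \<Rightarrow> tick (sev (case_nat a \<rho>) t2)
    | _ \<Rightarrow> fail)"
  (is "?l = ?r")
proof (intro ext iffI)
  show "?r j v" if "?l j v" for j v
    using that by (elim sev_elims; clarify)
      (rule bindI, assumption, simp, (rule tickI)?, (assumption | rule retI), simp)+
  show "?l j v" if "?r j v" for j v
    using that by (rule bindE, rename_tac w, case_tac w)
      (auto simp: tick_def ret_def fail_def intro: sev.intros split: if_split_asm)
qed

lemma sev_SSeq [simp]:
  "sev \<rho> (SSeq t1 t2) = bind (sev \<rho> t1) (\<lambda>v. case v of VUnit \<Rightarrow> sev \<rho> t2 | _ \<Rightarrow> fail)"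
  (is "?l = ?r")
proof (intro ext iffI)
  show "?r j v" if "?l j v" for j v
    using that by (elim sev_elims; clarify)
      (rule bindI, assumption, simp, (rule tickI)?, (assumption | rule retI), simp)+
  show "?l j v" if "?r j v" for j v
    using that by (rule bindE, rename_tac w, case_tac w)
      (auto simp: tick_def ret_def fail_def intro: sev.intros split: if_split_asm)
qed

lemma sev_SIf [simp]:
  "sev \<rho> (SIf t t1 t2) =
     bind (sev \<rho> t) (\<lambda>v. case v of VTrue \<Rightarrow> sev \<rho> t1 | VFalse \<Rightarrow> sev \<rho> t2 | _ \<Rightarrow> fail)"
  (is "?l = ?r")
proof (intro ext iffI)
  show "?r j v" if "?l j v" for j v
    using that by (elim sev_elims; clarify)
      (rule bindI, assumption, simp, (rule tickI)?, (assumption | rule retI), simp)+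
  show "?l j v" if "?r j v" for j v
    using that by (rule bindE, rename_tac w, case_tac w)
      (auto simp: tick_def ret_def fail_def intro: sev.intros split: if_split_asm)
qed

text \<open>The test on the annotation reflects that reduction of \<open>SFix\<close> fires only on
  an abstraction with the matching type; closures store their argument type for this reason.\<close>

lemma sev_SFix [simp]:
  "sev \<rho> (SFix \<tau>1 \<tau>2 t) = bind (sev \<rho> t) (\<lambda>f. case f of
      VClos \<tau> _ _ \<Rightarrow> if \<tau> = TFun \<tau>1 \<tau>2 then sapp f (vfix \<tau>1 \<tau>2 f) else fail
    | _ \<Rightarrow> fail)"
  (is "?l = ?r")
proof (intro ext iffI)
  show "?r j v" if "?l j v" for j v
    using that by (elim sev_elims; clarify)
      (rule bindI, assumption, simp, (rule tickI)?, (assumption | rule retI), simp)+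
  show "?l j v" if "?r j v" for j v
    using that by (rule bindE, rename_tac w, case_tac w)
      (auto simp: tick_def ret_def fail_def intro: sev.intros split: if_split_asm)
qed

section \<open>Adequacy of the source semantics\<close>

lemma up_ren_comp: "up_ren r \<circ> up_ren r' = up_ren (r \<circ> r')"
  by (auto simp: up_ren_def fun_eq_iff split: nat.splits)

lemma up_ren_Suc: "up_ren r \<circ> Suc = Suc \<circ> r"
  by (auto simp: up_ren_def fun_eq_iff)

lemma up_ren_id: "up_ren id = id"
  by (auto simp: up_ren_def fun_eq_iff split: nat.splits)

text \<open>First of the four composition laws. Commuting a renaming with a lifted substitution
  rests on this law, and composing two lifted substitutions rests on both mixed laws.\<close>

lemma sren_sren: "sren r (sren r' t) = sren (r \<circ> r') t"
  by (induction t arbitrary: r r') (simp_all add: up_ren_comp)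

lemma up_ssub_up_ren: "up_ssub s \<circ> up_ren r = up_ssub (s \<circ> r)"
  by (auto simp: up_ren_def up_ssub_def fun_eq_iff split: nat.splits)

lemma ssub_sren: "ssub s (sren r t) = ssub (s \<circ> r) t"
  by (induction t arbitrary: s r) (simp_all add: up_ssub_up_ren)

lemma sren_up_ssub: "sren (up_ren r) \<circ> up_ssub s = up_ssub (sren r \<circ> s)"
  by (auto simp: up_ssub_def fun_eq_iff sren_sren up_ren_Suc split: nat.splits)
    (simp add: up_ren_def)

lemma sren_ssub: "sren r (ssub s t) = ssub (sren r \<circ> s) t"
  by (induction t arbitrary: s r) (simp_all add: sren_up_ssub)

lemma up_ssub_Suc: "up_ssub s \<circ> Suc = sren Suc \<circ> s"
  by (auto simp: up_ssub_def fun_eq_iff)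

lemma ssub_up_ssub: "ssub (up_ssub s) \<circ> up_ssub s' = up_ssub (ssub s \<circ> s')"
proof
  fix i show "(ssub (up_ssub s) \<circ> up_ssub s') i = up_ssub (ssub s \<circ> s') i"
    by (cases i) (simp_all add: up_ssub_def[of s'] up_ssub_def[of "ssub s \<circ> s'"] ssub_sren
        up_ssub_Suc sren_ssub, simp add: up_ssub_def)
qed

lemma ssub_ssub: "ssub s (ssub s' t) = ssub (ssub s \<circ> s') t"
  by (induction t arbitrary: s s') (simp_all add: ssub_up_ssub)

lemma ssub_id: "ssub SVar t = t"
proof -
  have "up_ssub SVar = SVar"
    by (auto simp: up_ssub_def fun_eq_iff split: nat.splits)
  then show ?thesis by (induction t) simp_all
qed

text \<open>This is the link between the two semantics: substituting an argument into the body of a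
  read-back closure amounts to extending the environment of the closure.\<close>

lemma ssub0_ssub_up: "ssub0 v (ssub (up_ssub s) t) = ssub (case_nat v s) t"
proof -
  have "ssub (case_nat v SVar) \<circ> up_ssub s = case_nat v s"
    by (auto simp: up_ssub_def fun_eq_iff ssub_sren comp_def ssub_id split: nat.splits)
  then show ?thesis by (simp add: ssub0_def ssub_ssub)
qed

text \<open>Typing provides the notion of closedness for source terms: a program is its own instance
  under any environment.\<close>

lemma has_type_ssub_closed:
  "has_type \<Gamma> t \<tau> \<Longrightarrow> (\<And>i. i < length \<Gamma> \<Longrightarrow> s i = SVar i) \<Longrightarrow> ssub s t = t"
proof (induction arbitrary: s rule: has_type.induct)
  case (T_Lam \<tau>1 \<Gamma> t \<tau>2)
  have "up_ssub s i = SVar i" if "i < length (\<tau>1 # \<Gamma>)" for i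
    using that T_Lam.prems by (cases i) (auto simp: up_ssub_def)
  then show ?case using T_Lam.IH by simp
next
  case (T_Case \<Gamma> t \<tau>1 \<tau>2 t1 \<tau> t2)
  have "up_ssub s i = SVar i" if "i < Suc (length \<Gamma>)" for i
    using that T_Case.prems by (cases i) (auto simp: up_ssub_def)
  then show ?case using T_Case by simp
qed auto

section \<open>From environment evaluation to reduction\<close>

primrec readback :: "sval \<Rightarrow> stm" where
  "readback VUnit = SUnit"
| "readback VTrue = STrue"
| "readback VFalse = SFalse"
| "readback (VClos \<tau> \<rho> t) = SLam \<tau> (ssub (up_ssub (\<lambda>i. readback (\<rho> i))) t)"
| "readback (VPair v w) = SPair (readback v) (readback w)"
| "readback (VInl v) = SInl (readback v)"
| "readback (VInr v) = SInr (readback v)"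

lemma svalue_readback: "svalue (readback v)"
  by (induction v) (auto intro: svalue.intros)

lemma readback_case_nat:
  "(\<lambda>i. readback (case_nat v \<rho> i)) = case_nat (readback v) (\<lambda>i. readback (\<rho> i))"
  by (auto simp: fun_eq_iff split: nat.splits)

lemma readback_vfix:
  "readback (vfix \<tau>1 \<tau>2 f) = SLam \<tau>1 (SApp (sren Suc (SFix \<tau>1 \<tau>2 (readback f))) (SVar 0))"
  by (simp add: vfix_def up_ssub_def)

text \<open>This gives closure of reduction under evaluation contexts. Only the effect of the
  composite under plugging matters, hence the existential form.\<close>

lemma sectx_compose:
  "sectx E \<Longrightarrow> sectx E' \<Longrightarrow> \<exists>E''. sectx E'' \<and> (\<forall>t. splug E'' t = splug E (splug E' t))"
  by (induction rule: sectx.induct) (metis sectx.intros splug.simps)+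

lemma ssteps_frame:
  assumes "sstep\<^sup>*\<^sup>* t t'" "sectx E"
  shows "sstep\<^sup>*\<^sup>* (splug E t) (splug E t')"
  using assms(1)
proof induction
  case (step u u')
  have "sstep (splug E u) (splug E u')"
    using step(2) by cases (metis sectx_compose[OF assms(2)] sstep.intros)
  with step show ?case by simp
qed simp

lemma sstep_head: "shead t t' \<Longrightarrow> sstep t t'"
  using sstep.intros[of SCHole] by (simp add: sectx.intros)

lemma ssteps_head: "sstep\<^sup>*\<^sup>* s t \<Longrightarrow> shead t t' \<Longrightarrow> sstep\<^sup>*\<^sup>* t' u \<Longrightarrow> sstep\<^sup>*\<^sup>* s u"
  by (meson converse_rtranclp_into_rtranclp rtranclp_trans sstep_head)

lemma ssteps_frame2:
  assumes "sectx E" "sectx E'" "sstep\<^sup>*\<^sup>* t t'" "sstep\<^sup>*\<^sup>* u u'" "splug E t' = splug E' u"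
  shows "sstep\<^sup>*\<^sup>* (splug E t) (splug E' u')"
  using ssteps_frame[OF assms(3,1)] ssteps_frame[OF assms(4,2)] assms(5) by simp

lemma ssteps_SApp:
  "sstep\<^sup>*\<^sup>* t1 f \<Longrightarrow> svalue f \<Longrightarrow> sstep\<^sup>*\<^sup>* t2 a \<Longrightarrow> sstep\<^sup>*\<^sup>* (SApp t1 t2) (SApp f a)"
  using ssteps_frame2[of "SCApp1 SCHole t2" "SCApp2 f SCHole" t1 f] by (simp add: sectx.intros)

lemma ssteps_SPair:
  "sstep\<^sup>*\<^sup>* t1 a \<Longrightarrow> svalue a \<Longrightarrow> sstep\<^sup>*\<^sup>* t2 b \<Longrightarrow> sstep\<^sup>*\<^sup>* (SPair t1 t2) (SPair a b)"
  using ssteps_frame2[of "SCPair1 SCHole t2" "SCPair2 a SCHole" t1 a] by (simp add: sectx.intros)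

lemma ssteps_unary:
  assumes "sstep\<^sup>*\<^sup>* t t'"
  shows "sstep\<^sup>*\<^sup>* (SFst t) (SFst t')" "sstep\<^sup>*\<^sup>* (SSnd t) (SSnd t')"
    "sstep\<^sup>*\<^sup>* (SInl t) (SInl t')" "sstep\<^sup>*\<^sup>* (SInr t) (SInr t')"
    "sstep\<^sup>*\<^sup>* (SCase t t1 t2) (SCase t' t1 t2)" "sstep\<^sup>*\<^sup>* (SSeq t t1) (SSeq t' t1)"
    "sstep\<^sup>*\<^sup>* (SIf t t1 t2) (SIf t' t1 t2)" "sstep\<^sup>*\<^sup>* (SFix \<tau>1 \<tau>2 t) (SFix \<tau>1 \<tau>2 t')"
  using ssteps_frame[OF assms, of "SCFst SCHole"] ssteps_frame[OF assms, of "SCSnd SCHole"]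
    ssteps_frame[OF assms, of "SCInl SCHole"] ssteps_frame[OF assms, of "SCInr SCHole"]
    ssteps_frame[OF assms, of "SCCase0 SCHole t1 t2"] ssteps_frame[OF assms, of "SCSeq1 SCHole t1"]
    ssteps_frame[OF assms, of "SCIf0 SCHole t1 t2"] ssteps_frame[OF assms, of "SCFix \<tau>1 \<tau>2 SCHole"]
  by (simp_all add: sectx.intros)

text \<open>Reduction runs the subterms inside evaluation contexts and then makes a head step, whose
  result is the instance of the body under the extended environment.\<close>

lemma sev_ssteps: "sev \<rho> t j v \<Longrightarrow> sstep\<^sup>*\<^sup>* (ssub (\<lambda>i. readback (\<rho> i)) t) (readback v)"
proof (induction rule: sev.induct)
  case (6 \<rho> t1 i \<tau> \<rho>' b t2 j a k r)
  have "shead (SApp (readback (VClos \<tau> \<rho>' b)) (readback a))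
      (ssub (\<lambda>i. readback (case_nat a \<rho>' i)) b)"
    using SH_Beta[OF svalue_readback, where t="ssub (up_ssub (\<lambda>i. readback (\<rho>' i))) b"]
    by (simp add: ssub0_ssub_up readback_case_nat)
  then show ?case
    using ssteps_head[OF ssteps_SApp[OF 6(4) svalue_readback 6(5)] _ 6(6)] by simp
next
  case (7 \<rho> t i a b)
  show ?case
    using ssteps_head[OF ssteps_unary(1)[OF 7(2)[unfolded readback.simps]]
        SH_Fst[OF svalue_readback svalue_readback] rtranclp.rtrancl_refl] by simp
next
  case (8 \<rho> t i a b)
  show ?case
    using ssteps_head[OF ssteps_unary(2)[OF 8(2)[unfolded readback.simps]]
        SH_Snd[OF svalue_readback svalue_readback] rtranclp.rtrancl_refl] by simp
next
  case (12 \<rho> t i a t1 k r t2)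
  have "shead (SCase (readback (VInl a)) u1 u2) (ssub (\<lambda>i. readback (case_nat a \<rho> i)) t1)"
    if "u1 = ssub (up_ssub (\<lambda>i. readback (\<rho> i))) t1" for u1 u2
    using SH_CaseInl[OF svalue_readback, of a u1 u2] that
    by (simp add: ssub0_ssub_up readback_case_nat)
  then show ?case
    using ssteps_head[OF ssteps_unary(5)[OF 12(3)] _ 12(4)] by simp
next
  case (13 \<rho> t i a t2 k r t1)
  have "shead (SCase (readback (VInr a)) u1 u2) (ssub (\<lambda>i. readback (case_nat a \<rho> i)) t2)"
    if "u2 = ssub (up_ssub (\<lambda>i. readback (\<rho> i))) t2" for u1 u2
    using SH_CaseInr[OF svalue_readback, of a u1 u2] that
    by (simp add: ssub0_ssub_up readback_case_nat)
  then show ?case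
    using ssteps_head[OF ssteps_unary(5)[OF 13(3)] _ 13(4)] by simp
next
  case (14 \<rho> t1 i t2 k r)
  show ?case using ssteps_head[OF ssteps_unary(6)[OF 14(3)[unfolded readback.simps]] SH_Seq 14(4)] by simp
next
  case (15 \<rho> t i t1 k r t2)
  show ?case using ssteps_head[OF ssteps_unary(7)[OF 15(3)[unfolded readback.simps]] SH_IfTrue 15(4)] by simp
next
  case (16 \<rho> t i t2 k r t1)
  show ?case using ssteps_head[OF ssteps_unary(7)[OF 16(3)[unfolded readback.simps]] SH_IfFalse 16(4)] by simp
next
  case (17 \<rho> t i \<tau>1 \<tau>2 \<rho>' b k r)
  let ?f = "VClos (TFun \<tau>1 \<tau>2) \<rho>' b"
  have "shead (SFix \<tau>1 \<tau>2 (readback ?f))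
      (ssub (\<lambda>i. readback (case_nat (vfix \<tau>1 \<tau>2 ?f) \<rho>' i)) b)"
    using SH_Fix[OF refl, of _ _ "ssub (up_ssub (\<lambda>i. readback (\<rho>' i))) b"]
    by (simp only: ssub0_ssub_up readback_case_nat readback_vfix readback.simps)
  then show ?case
    using ssteps_head[OF ssteps_unary(8)[OF 17(3)] _ 17(4)] by simp
qed (simp_all add: ssteps_SPair ssteps_unary svalue_readback)

text \<open>Natural semantics as a bridge from reduction to environments: it is closed under
  expansion by a reduction step, and its derivations follow the structure of the term, as those of
  \<open>sev\<close> do.\<close>

inductive sbig :: "stm \<Rightarrow> stm \<Rightarrow> bool" where
  "sbig SUnit SUnit"
| "sbig STrue STrue"
| "sbig SFalse SFalse"
| "sbig (SLam \<tau> t) (SLam \<tau> t)"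
| "sbig t1 (SLam \<tau> b) \<Longrightarrow> sbig t2 a \<Longrightarrow> sbig (ssub0 a b) r \<Longrightarrow> sbig (SApp t1 t2) r"
| "sbig t (SPair a b) \<Longrightarrow> sbig (SFst t) a"
| "sbig t (SPair a b) \<Longrightarrow> sbig (SSnd t) b"
| "sbig t1 a \<Longrightarrow> sbig t2 b \<Longrightarrow> sbig (SPair t1 t2) (SPair a b)"
| "sbig t a \<Longrightarrow> sbig (SInl t) (SInl a)"
| "sbig t a \<Longrightarrow> sbig (SInr t) (SInr a)"
| "sbig t (SInl a) \<Longrightarrow> sbig (ssub0 a t1) r \<Longrightarrow> sbig (SCase t t1 t2) r"
| "sbig t (SInr a) \<Longrightarrow> sbig (ssub0 a t2) r \<Longrightarrow> sbig (SCase t t1 t2) r"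
| "sbig t1 SUnit \<Longrightarrow> sbig t2 r \<Longrightarrow> sbig (SSeq t1 t2) r"
| "sbig t STrue \<Longrightarrow> sbig t1 r \<Longrightarrow> sbig (SIf t t1 t2) r"
| "sbig t SFalse \<Longrightarrow> sbig t2 r \<Longrightarrow> sbig (SIf t t1 t2) r"
| "sbig t (SLam (TFun \<tau>1 \<tau>2) b)
    \<Longrightarrow> sbig (ssub0 (SLam \<tau>1 (SApp (sren Suc (SFix \<tau>1 \<tau>2 (SLam (TFun \<tau>1 \<tau>2) b))) (SVar 0))) b) r
    \<Longrightarrow> sbig (SFix \<tau>1 \<tau>2 t) r"

inductive_cases sbig_elims:
  "sbig SUnit w" "sbig STrue w" "sbig SFalse w" "sbig (SLam \<tau> t) w" "sbig (SVar i) w"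
  "sbig (SApp t1 t2) w" "sbig (SFst t) w" "sbig (SSnd t) w" "sbig (SPair t1 t2) w"
  "sbig (SInl t) w" "sbig (SInr t) w" "sbig (SCase t t1 t2) w" "sbig (SSeq t1 t2) w"
  "sbig (SIf t t1 t2) w" "sbig (SFix \<tau>1 \<tau>2 t) w"

lemma sbig_value: "svalue v \<Longrightarrow> sbig v v"
  by (induction rule: svalue.induct) (auto intro: sbig.intros)

lemma sbig_value_unique: "svalue v \<Longrightarrow> sbig v w \<Longrightarrow> w = v"
  by (induction arbitrary: w rule: svalue.induct) (blast elim: sbig_elims)+

lemma sbig_shead: "shead t t' \<Longrightarrow> sbig t' w \<Longrightarrow> sbig t w"
  by (induction rule: shead.induct) (auto intro: sbig.intros sbig_value svalue.intros)

lemma sbig_sectx: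
  assumes "sectx E" "\<And>w. sbig t' w \<Longrightarrow> sbig t w"
  shows "sbig (splug E t') w \<Longrightarrow> sbig (splug E t) w"
  using assms(1)
proof (induction arbitrary: w rule: sectx.induct)
  case 1
  then show ?case using assms(2) by simp
next
  case (13 E \<tau>1 \<tau>2)
  then show ?case by (simp only: splug.simps, elim sbig_elims) (rule sbig.intros(16), rule 13(2), assumption, simp)
qed (simp only: splug.simps, (elim sbig_elims; auto intro: sbig.intros))+

lemma ssteps_sbig:
  assumes "sstep\<^sup>*\<^sup>* t v" "svalue v"
  shows "sbig t v"
  using assms(1)
proof (induction rule: converse_rtranclp_induct)
  case base
  then show ?case using assms(2) by (rule sbig_value)
next
  case (step t u)
  from step(1) show ?case
    by cases (use step(3) sbig_sectx sbig_shead in blast)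
qed

lemma readback_eqD:
  "readback v = SUnit \<Longrightarrow> v = VUnit" "readback v = STrue \<Longrightarrow> v = VTrue"
  "readback v = SFalse \<Longrightarrow> v = VFalse"
  by (cases v; simp)+

lemma readback_eq_SLam:
  assumes "readback v = SLam \<tau> b"
  obtains \<rho> t where "v = VClos \<tau> \<rho> t" "b = ssub (up_ssub (\<lambda>i. readback (\<rho> i))) t"
  using assms by (cases v) simp_all

lemma readback_eq_SPair:
  assumes "readback v = SPair a b"
  obtains w w' where "v = VPair w w'" "a = readback w" "b = readback w'"
  using assms by (cases v) simp_all

lemma readback_eq_SInl:
  assumes "readback v = SInl a"
  obtains w where "v = VInl w" "a = readback w"
  using assms by (cases v) simp_all

lemma readback_eq_SInr:
  assumes "readback v = SInr a"
  obtains w where "v = VInr w" "a = readback w"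
  using assms by (cases v) simp_all

lemma readback_noneq [simp]:
  "readback v \<noteq> SApp t1 t2" "readback v \<noteq> SFst t" "readback v \<noteq> SSnd t"
  "readback v \<noteq> SCase t t1 t2" "readback v \<noteq> SSeq t1 t2" "readback v \<noteq> SIf t t1 t2"
  "readback v \<noteq> SFix \<tau>1 \<tau>2 t"
  by (cases v; simp)+

declare readback_noneq [THEN not_sym, simp]

text \<open>The term evaluated is known only up to the substitution of read-back values, so \<rho>
  and t vary in the induction. For an elimination, t has the same head constructor, because no
  read-back value is an elimination. For an introduction, t may also be a variable.\<close>

lemma sbig_sev:
  "sbig s w \<Longrightarrow> s = ssub (\<lambda>i. readback (\<rho> i)) t \<Longrightarrow> \<exists>j v. sev \<rho> t j v \<and> readback v = w"
proof (induction arbitrary: \<rho> t rule: sbig.induct)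
  case 1
  then show ?case using sev.intros(1) sev.intros(5)
    by (cases t) (simp_all, metis readback.simps(1), metis)
next
  case 2
  then show ?case using sev.intros(2) sev.intros(5)
    by (cases t) (simp_all, metis readback.simps(2), metis)
next
  case 3
  then show ?case using sev.intros(3) sev.intros(5)
    by (cases t) (simp_all, metis readback.simps(3), metis)
next
  case (4 \<tau> b)
  show ?case
  proof (cases t)
    case (SVar i)
    then show ?thesis using 4 sev.intros(5)[of \<rho> i] by (metis ssub.simps(5))
  next
    case (SLam \<tau>' u)
    then show ?thesis
      using 4 sev.intros(4)[of \<rho> \<tau>' u] by (metis readback.simps(4) ssub.simps(4))
  qed (use 4 in simp_all)
next
  case (5 t1 \<tau> b t2 a r)
  from 5(7) obtain s1 s2 where t: "t = SApp s1 s2" "t1 = ssub (\<lambda>i. readback (\<rho> i)) s1"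
      "t2 = ssub (\<lambda>i. readback (\<rho> i)) s2"
    by (cases t) auto
  obtain i v where "sev \<rho> s1 i v" "readback v = SLam \<tau> b" using 5(4) t by blast
  then obtain \<rho>' b' where f: "sev \<rho> s1 i (VClos \<tau> \<rho>' b')"
      "b = ssub (up_ssub (\<lambda>i. readback (\<rho>' i))) b'"
    by (auto elim: readback_eq_SLam)
  obtain j x where x: "sev \<rho> s2 j x" "readback x = a" using 5(5) t by blast
  have "ssub0 a b = ssub (\<lambda>i. readback (case_nat x \<rho>' i)) b'"
    by (simp add: f x(2)[symmetric] ssub0_ssub_up readback_case_nat)
  then obtain k y where "sev (case_nat x \<rho>') b' k y" "readback y = r" using 5(6) by blast
  then show ?case using sev.intros(6)[OF f(1) x(1)] t(1) by blast
next
  case (6 u a b)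
  from 6(3) obtain s1 where t: "t = SFst s1" "u = ssub (\<lambda>i. readback (\<rho> i)) s1"
    by (cases t) auto
  show ?case using 6(2)[OF t(2)] t(1) sev.intros(7) by (metis readback_eq_SPair)
next
  case (7 u a b)
  from 7(3) obtain s1 where t: "t = SSnd s1" "u = ssub (\<lambda>i. readback (\<rho> i)) s1"
    by (cases t) auto
  show ?case using 7(2)[OF t(2)] t(1) sev.intros(8) by (metis readback_eq_SPair)
next
  case (8 t1 a t2 b)
  show ?case
  \<comment> \<open>If t is a variable, the whole pair is already a value and evaluates only to
    itself; otherwise t is a pair and the induction hypotheses apply to its components.\<close>
  proof (cases "\<exists>i. t = SVar i")
    case True
    have "sbig (SPair t1 t2) (SPair a b)" using 8 sbig.intros(8) by blast
    then have "SPair a b = SPair t1 t2" using True 8(5) sbig_value_unique svalue_readback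
      by (metis ssub.simps(5))
    then show ?thesis using True 8(5) sev.intros(5) by (metis ssub.simps(5))
  next
    case False
    then obtain s1 s2 where "t = SPair s1 s2" "t1 = ssub (\<lambda>i. readback (\<rho> i)) s1"
        "t2 = ssub (\<lambda>i. readback (\<rho> i)) s2"
      using 8(5) by (cases t) auto
    then show ?thesis using 8(3)[of \<rho> s1] 8(4)[of \<rho> s2] sev.intros(9)
      by (metis readback.simps(5))
  qed
next
  case (9 u a)
  show ?case
  proof (cases "\<exists>i. t = SVar i")
    case True
    have "sbig (SInl u) (SInl a)" using 9 sbig.intros(9) by blast
    then have "SInl a = SInl u" using True 9(3) sbig_value_unique svalue_readback
      by (metis ssub.simps(5))
    then show ?thesis using True 9(3) sev.intros(5) by (metis ssub.simps(5))
  next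
    case False
    then obtain s1 where "t = SInl s1" "u = ssub (\<lambda>i. readback (\<rho> i)) s1"
      using 9(3) by (cases t) auto
    then show ?thesis using 9(2)[of \<rho> s1] sev.intros(10) by (metis readback.simps(6))
  qed
next
  case (10 u a)
  show ?case
  proof (cases "\<exists>i. t = SVar i")
    case True
    have "sbig (SInr u) (SInr a)" using 10 sbig.intros(10) by blast
    then have "SInr a = SInr u" using True 10(3) sbig_value_unique svalue_readback
      by (metis ssub.simps(5))
    then show ?thesis using True 10(3) sev.intros(5) by (metis ssub.simps(5))
  next
    case False
    then obtain s1 where "t = SInr s1" "u = ssub (\<lambda>i. readback (\<rho> i)) s1"
      using 10(3) by (cases t) auto
    then show ?thesis using 10(2)[of \<rho> s1] sev.intros(11) by (metis readback.simps(7))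
  qed
next
  case (11 u a t1 r t2)
  from 11(5) obtain s s1 s2 where t: "t = SCase s s1 s2" "u = ssub (\<lambda>i. readback (\<rho> i)) s"
      "t1 = ssub (up_ssub (\<lambda>i. readback (\<rho> i))) s1"
    by (cases t) auto
  obtain i x where x: "sev \<rho> s i (VInl x)" "a = readback x"
    using 11(3)[OF t(2)] by (metis readback_eq_SInl)
  have "ssub0 a t1 = ssub (\<lambda>i. readback (case_nat x \<rho> i)) s1"
    by (simp add: t(3) x(2) ssub0_ssub_up readback_case_nat)
  then obtain k y where "sev (case_nat x \<rho>) s1 k y" "readback y = r" using 11(4) by blast
  then show ?case using sev.intros(12)[OF x(1)] t(1) by blast
next
  case (12 u a t2 r t1)
  from 12(5) obtain s s1 s2 where t: "t = SCase s s1 s2" "u = ssub (\<lambda>i. readback (\<rho> i)) s"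
      "t2 = ssub (up_ssub (\<lambda>i. readback (\<rho> i))) s2"
    by (cases t) auto
  obtain i x where x: "sev \<rho> s i (VInr x)" "a = readback x"
    using 12(3)[OF t(2)] by (metis readback_eq_SInr)
  have "ssub0 a t2 = ssub (\<lambda>i. readback (case_nat x \<rho> i)) s2"
    by (simp add: t(3) x(2) ssub0_ssub_up readback_case_nat)
  then obtain k y where "sev (case_nat x \<rho>) s2 k y" "readback y = r" using 12(4) by blast
  then show ?case using sev.intros(13)[OF x(1)] t(1) by blast
next
  case (13 t1 t2 r)
  from 13(5) obtain s1 s2 where t: "t = SSeq s1 s2" "t1 = ssub (\<lambda>i. readback (\<rho> i)) s1"
      "t2 = ssub (\<lambda>i. readback (\<rho> i)) s2"
    by (cases t) auto
  show ?case using 13(3)[OF t(2)] 13(4)[OF t(3)] readback_eqD(1) t(1) sev.intros(14) by blast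
next
  case (14 u t1 r t2)
  from 14(5) obtain s s1 s2 where t: "t = SIf s s1 s2" "u = ssub (\<lambda>i. readback (\<rho> i)) s"
      "t1 = ssub (\<lambda>i. readback (\<rho> i)) s1"
    by (cases t) auto
  show ?case using 14(3)[OF t(2)] 14(4)[OF t(3)] readback_eqD(2) t(1) sev.intros(15) by blast
next
  case (15 u t2 r t1)
  from 15(5) obtain s s1 s2 where t: "t = SIf s s1 s2" "u = ssub (\<lambda>i. readback (\<rho> i)) s"
      "t2 = ssub (\<lambda>i. readback (\<rho> i)) s2"
    by (cases t) auto
  show ?case using 15(3)[OF t(2)] 15(4)[OF t(3)] readback_eqD(3) t(1) sev.intros(16) by blast
next
  case (16 u \<tau>1 \<tau>2 b r)
  from 16(5) obtain s where t: "t = SFix \<tau>1 \<tau>2 s" "u = ssub (\<lambda>i. readback (\<rho> i)) s"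
    by (cases t) auto
  obtain i v where v: "sev \<rho> s i v" "readback v = SLam (TFun \<tau>1 \<tau>2) b"
    using 16(3)[OF t(2)] by blast
  then obtain \<rho>' b' where f: "v = VClos (TFun \<tau>1 \<tau>2) \<rho>' b'"
      "b = ssub (up_ssub (\<lambda>i. readback (\<rho>' i))) b'"
    by (auto elim: readback_eq_SLam)
  have "ssub0 (SLam \<tau>1 (SApp (sren Suc (SFix \<tau>1 \<tau>2 (SLam (TFun \<tau>1 \<tau>2) b))) (SVar 0))) b =
      ssub (\<lambda>i. readback (case_nat (vfix \<tau>1 \<tau>2 v) \<rho>' i)) b'"
    by (simp only: f(2) ssub0_ssub_up readback_case_nat readback_vfix v(2))
  then obtain k y where "sev (case_nat (vfix \<tau>1 \<tau>2 v) \<rho>') b' k y" "readback y = r"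
    using 16(4) by blast
  then show ?case using sev.intros(17)[of \<rho> s i \<tau>1 \<tau>2 \<rho>' b'] v(1) f(1) t(1) by blast
qed

text \<open>The environment \<rho> is arbitrary because a program does not look at it; later it is
  fixed to any convenient constant.\<close>

lemma sterminates_iff:
  assumes "has_type [] t \<tau>"
  shows "sterminates t \<longleftrightarrow> (\<exists>j v. sev \<rho> t j v)"
proof -
  have t: "ssub (\<lambda>i. readback (\<rho> i)) t = t"
    using has_type_ssub_closed[OF assms] by simp
  show ?thesis
  proof
    assume "sterminates t"
    then show "\<exists>j v. sev \<rho> t j v"
      unfolding sterminates_def using ssteps_sbig sbig_sev[OF _ t[symmetric]] by blast
  next
    assume "\<exists>j v. sev \<rho> t j v"
    then show "sterminates t"
      unfolding sterminates_def using sev_ssteps[of \<rho> t] svalue_readback t by metis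
  qed
qed

section \<open>Environment semantics of the target language\<close>

datatype uval =
    WUnit
  | WTrue
  | WFalse
  | WClos "nat \<Rightarrow> uval" utm
  | WPair uval uval
  | WInl uval
  | WInr uval

text \<open>The costs agree with those of \<open>sev\<close>. There is no rule for
  \<open>UWrong\<close> or for ill-shaped eliminations: \<open>uterminates\<close> asks for a value,
  so a computation that goes wrong may be identified with one that diverges.\<close>

inductive uev :: "(nat \<Rightarrow> uval) \<Rightarrow> utm \<Rightarrow> nat \<Rightarrow> uval \<Rightarrow> bool" where
  "uev \<rho> UUnit 0 WUnit"
| "uev \<rho> UTrue 0 WTrue"
| "uev \<rho> UFalse 0 WFalse"
| "uev \<rho> (ULam t) 0 (WClos \<rho> t)"
| "uev \<rho> (UVar i) 0 (\<rho> i)"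
| "uev \<rho> t1 i (WClos \<rho>' b) \<Longrightarrow> uev \<rho> t2 j a \<Longrightarrow> uev (case_nat a \<rho>') b k r
    \<Longrightarrow> uev \<rho> (UApp t1 t2) (Suc (i + (j + k))) r"
| "uev \<rho> t i (WPair a b) \<Longrightarrow> uev \<rho> (UFst t) (Suc i) a"
| "uev \<rho> t i (WPair a b) \<Longrightarrow> uev \<rho> (USnd t) (Suc i) b"
| "uev \<rho> t1 i a \<Longrightarrow> uev \<rho> t2 j b \<Longrightarrow> uev \<rho> (UPair t1 t2) (i + j) (WPair a b)"
| "uev \<rho> t i a \<Longrightarrow> uev \<rho> (UInl t) i (WInl a)"
| "uev \<rho> t i a \<Longrightarrow> uev \<rho> (UInr t) i (WInr a)"
| "uev \<rho> t i (WInl a) \<Longrightarrow> uev (case_nat a \<rho>) t1 k r \<Longrightarrow> uev \<rho> (UCase t t1 t2) (Suc (i + k)) r"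
| "uev \<rho> t i (WInr a) \<Longrightarrow> uev (case_nat a \<rho>) t2 k r \<Longrightarrow> uev \<rho> (UCase t t1 t2) (Suc (i + k)) r"
| "uev \<rho> t1 i WUnit \<Longrightarrow> uev \<rho> t2 k r \<Longrightarrow> uev \<rho> (USeq t1 t2) (i + k) r"
| "uev \<rho> t i WTrue \<Longrightarrow> uev \<rho> t1 k r \<Longrightarrow> uev \<rho> (UIf t t1 t2) (i + k) r"
| "uev \<rho> t i WFalse \<Longrightarrow> uev \<rho> t2 k r \<Longrightarrow> uev \<rho> (UIf t t1 t2) (i + k) r"

inductive_cases uev_elims:
  "uev \<rho> UUnit j v" "uev \<rho> UTrue j v" "uev \<rho> UFalse j v" "uev \<rho> (ULam t) j v"
  "uev \<rho> (UVar i) j v" "uev \<rho> (UApp t1 t2) j v" "uev \<rho> (UFst t) j v" "uev \<rho> (USnd t) j v"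
  "uev \<rho> (UPair t1 t2) j v" "uev \<rho> (UInl t) j v" "uev \<rho> (UInr t) j v" "uev \<rho> (UCase t t1 t2) j v"
  "uev \<rho> (USeq t1 t2) j v" "uev \<rho> (UIf t t1 t2) j v" "uev \<rho> UWrong j v"

definition uapp :: "uval \<Rightarrow> uval \<Rightarrow> uval comp" where
  "uapp f v = (case f of WClos \<rho> b \<Rightarrow> tick (uev (case_nat v \<rho>) b) | _ \<Rightarrow> fail)"

lemma uapp_WClos [simp]: "uapp (WClos \<rho> b) = (\<lambda>v. tick (uev (case_nat v \<rho>) b))"
  by (simp add: fun_eq_iff uapp_def)

lemma uev_UUnit [simp]: "uev \<rho> UUnit = ret WUnit"
  by (auto simp: fun_eq_iff ret_def intro: uev.intros elim: uev_elims)
lemma uev_UTrue [simp]: "uev \<rho> UTrue = ret WTrue"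
  by (auto simp: fun_eq_iff ret_def intro: uev.intros elim: uev_elims)
lemma uev_UFalse [simp]: "uev \<rho> UFalse = ret WFalse"
  by (auto simp: fun_eq_iff ret_def intro: uev.intros elim: uev_elims)
lemma uev_ULam [simp]: "uev \<rho> (ULam t) = ret (WClos \<rho> t)"
  by (auto simp: fun_eq_iff ret_def intro: uev.intros elim: uev_elims)
lemma uev_UVar [simp]: "uev \<rho> (UVar i) = ret (\<rho> i)"
  by (auto simp: fun_eq_iff ret_def intro: uev.intros elim: uev_elims)

lemma uev_UApp [simp]: "uev \<rho> (UApp t1 t2) = bind (uev \<rho> t1) (\<lambda>f. bind (uev \<rho> t2) (uapp f))"
  (is "?l = ?r")
proof (intro ext iffI)
  show "?r j v" if "?l j v" for j v
    using that by (elim uev_elims; clarify)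
      (rule bindI, assumption, rule refl, rule bindI, assumption, simp, rule tickI, assumption,
        rule refl, simp)
  show "?l j v" if "?r j v" for j v
  proof -
    obtain i l f where f: "uev \<rho> t1 i f" "bind (uev \<rho> t2) (uapp f) l v" "j = i + l"
      using \<open>?r j v\<close> by (rule bindE)
    obtain i' l' a where "uev \<rho> t2 i' a" "uapp f a l' v" "l = i' + l'"
      using f(2) by (rule bindE)
    then show ?thesis
      using f by (cases f) (auto simp: uapp_def tick_def fail_def intro: uev.intros)
  qed
qed

lemma uev_UFst [simp]:
  "uev \<rho> (UFst t) = bind (uev \<rho> t) (\<lambda>v. case v of WPair a b \<Rightarrow> tick (ret a) | _ \<Rightarrow> fail)"
  (is "?l = ?r")
proof (intro ext iffI)
  show "?r j v" if "?l j v" for j v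
    using that by (elim uev_elims; clarify)
      (rule bindI, assumption, simp, (rule tickI)?, (assumption | rule retI), simp)+
  show "?l j v" if "?r j v" for j v
    using that by (rule bindE, rename_tac w, case_tac w)
      (auto simp: tick_def ret_def fail_def intro: uev.intros split: if_split_asm)
qed

lemma uev_USnd [simp]:
  "uev \<rho> (USnd t) = bind (uev \<rho> t) (\<lambda>v. case v of WPair a b \<Rightarrow> tick (ret b) | _ \<Rightarrow> fail)"
  (is "?l = ?r")
proof (intro ext iffI)
  show "?r j v" if "?l j v" for j v
    using that by (elim uev_elims; clarify)
      (rule bindI, assumption, simp, (rule tickI)?, (assumption | rule retI), simp)+
  show "?l j v" if "?r j v" for j v
    using that by (rule bindE, rename_tac w, case_tac w)
      (auto simp: tick_def ret_def fail_def intro: uev.intros split: if_split_asm)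
qed

lemma uev_UPair [simp]:
  "uev \<rho> (UPair t1 t2) = bind (uev \<rho> t1) (\<lambda>a. bind (uev \<rho> t2) (\<lambda>b. ret (WPair a b)))"
  by (auto simp: fun_eq_iff bind_def ret_def intro: uev.intros elim!: uev_elims)

lemma uev_UInl [simp]: "uev \<rho> (UInl t) = bind (uev \<rho> t) (\<lambda>a. ret (WInl a))"
  by (auto simp: fun_eq_iff bind_def ret_def intro: uev.intros elim!: uev_elims)

lemma uev_UInr [simp]: "uev \<rho> (UInr t) = bind (uev \<rho> t) (\<lambda>a. ret (WInr a))"
  by (auto simp: fun_eq_iff bind_def ret_def intro: uev.intros elim!: uev_elims)

lemma uev_UCase [simp]:
  "uev \<rho> (UCase t t1 t2) = bind (uev \<rho> t) (\<lambda>v. case v of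
      WInl a \<Rightarrow> tick (uev (case_nat a \<rho>) t1)
    | WInr a \<Rightarrow> tick (uev (case_nat a \<rho>) t2)
    | _ \<Rightarrow> fail)"
  (is "?l = ?r")
proof (intro ext iffI)
  show "?r j v" if "?l j v" for j v
    using that by (elim uev_elims; clarify)
      (rule bindI, assumption, simp, (rule tickI)?, (assumption | rule retI), simp)+
  show "?l j v" if "?r j v" for j v
    using that by (rule bindE, rename_tac w, case_tac w)
      (auto simp: tick_def ret_def fail_def intro: uev.intros split: if_split_asm)
qed

lemma uev_USeq [simp]:
  "uev \<rho> (USeq t1 t2) = bind (uev \<rho> t1) (\<lambda>v. case v of WUnit \<Rightarrow> uev \<rho> t2 | _ \<Rightarrow> fail)"
  (is "?l = ?r")
proof (intro ext iffI)
  show "?r j v" if "?l j v" for j v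
    using that by (elim uev_elims; clarify)
      (rule bindI, assumption, simp, (rule tickI)?, (assumption | rule retI), simp)+
  show "?l j v" if "?r j v" for j v
    using that by (rule bindE, rename_tac w, case_tac w)
      (auto simp: tick_def ret_def fail_def intro: uev.intros split: if_split_asm)
qed

lemma uev_UIf [simp]:
  "uev \<rho> (UIf t t1 t2) =
     bind (uev \<rho> t) (\<lambda>v. case v of WTrue \<Rightarrow> uev \<rho> t1 | WFalse \<Rightarrow> uev \<rho> t2 | _ \<Rightarrow> fail)"
  (is "?l = ?r")
proof (intro ext iffI)
  show "?r j v" if "?l j v" for j v
    using that by (elim uev_elims; clarify)
      (rule bindI, assumption, simp, (rule tickI)?, (assumption | rule retI), simp)+
  show "?l j v" if "?r j v" for j v
    using that by (rule bindE, rename_tac w, case_tac w)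
      (auto simp: tick_def ret_def fail_def intro: uev.intros split: if_split_asm)
qed

lemma uev_UWrong [simp]: "uev \<rho> UWrong = fail"
  by (auto simp: fun_eq_iff fail_def elim: uev_elims)

section \<open>Adequacy of the target semantics\<close>

lemma uren_uren: "uren r (uren r' t) = uren (r \<circ> r') t"
  by (induction t arbitrary: r r') (simp_all add: up_ren_comp)

lemma up_usub_up_ren: "up_usub s \<circ> up_ren r = up_usub (s \<circ> r)"
  by (auto simp: up_ren_def up_usub_def fun_eq_iff split: nat.splits)

lemma usub_uren: "usub s (uren r t) = usub (s \<circ> r) t"
  by (induction t arbitrary: s r) (simp_all add: up_usub_up_ren)

lemma uren_up_usub: "uren (up_ren r) \<circ> up_usub s = up_usub (uren r \<circ> s)"
  by (auto simp: up_usub_def fun_eq_iff uren_uren up_ren_Suc split: nat.splits)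
    (simp add: up_ren_def)

lemma uren_usub: "uren r (usub s t) = usub (uren r \<circ> s) t"
  by (induction t arbitrary: s r) (simp_all add: uren_up_usub)

lemma up_usub_Suc: "up_usub s \<circ> Suc = uren Suc \<circ> s"
  by (auto simp: up_usub_def fun_eq_iff)

lemma usub_up_usub: "usub (up_usub s) \<circ> up_usub s' = up_usub (usub s \<circ> s')"
proof
  fix i show "(usub (up_usub s) \<circ> up_usub s') i = up_usub (usub s \<circ> s') i"
    by (cases i) (simp_all add: up_usub_def[of s'] up_usub_def[of "usub s \<circ> s'"] usub_uren
        up_usub_Suc uren_usub, simp add: up_usub_def)
qed

lemma usub_usub: "usub s (usub s' t) = usub (usub s \<circ> s') t"
  by (induction t arbitrary: s s') (simp_all add: usub_up_usub)

lemma usub_id: "usub UVar t = t"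
proof -
  have "up_usub UVar = UVar"
    by (auto simp: up_usub_def fun_eq_iff split: nat.splits)
  then show ?thesis by (induction t) simp_all
qed

lemma usub0_usub_up: "usub0 v (usub (up_usub s) t) = usub (case_nat v s) t"
proof -
  have "usub (case_nat v UVar) \<circ> up_usub s = case_nat v s"
    by (auto simp: up_usub_def fun_eq_iff usub_uren comp_def usub_id split: nat.splits)
  then show ?thesis by (simp add: usub0_def usub_usub)
qed

lemma usub_closed: "(\<And>i. i \<in> ufv t \<Longrightarrow> s i = UVar i) \<Longrightarrow> usub s t = t"
proof (induction t arbitrary: s)
  case (ULam t)
  have "up_usub s i = UVar i" if "i \<in> ufv t" for i
    using that ULam.prems by (cases i) (auto simp: up_usub_def)
  then show ?case using ULam.IH by simp
next
  case (UCase t t1 t2)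
  have "up_usub s i = UVar i" if "i \<in> ufv t1 \<union> ufv t2" for i
    using that UCase.prems by (cases i) (auto simp: up_usub_def)
  then show ?case using UCase by simp
qed auto

primrec ureadback :: "uval \<Rightarrow> utm" where
  "ureadback WUnit = UUnit"
| "ureadback WTrue = UTrue"
| "ureadback WFalse = UFalse"
| "ureadback (WClos \<rho> t) = ULam (usub (up_usub (\<lambda>i. ureadback (\<rho> i))) t)"
| "ureadback (WPair v w) = UPair (ureadback v) (ureadback w)"
| "ureadback (WInl v) = UInl (ureadback v)"
| "ureadback (WInr v) = UInr (ureadback v)"

lemma uvalue_ureadback: "uvalue (ureadback v)"
  by (induction v) (auto intro: uvalue.intros)

lemma ureadback_case_nat:
  "(\<lambda>i. ureadback (case_nat v \<rho> i)) = case_nat (ureadback v) (\<lambda>i. ureadback (\<rho> i))"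
  by (auto simp: fun_eq_iff split: nat.splits)

lemma uectx_compose:
  "uectx E \<Longrightarrow> uectx E' \<Longrightarrow> \<exists>E''. uectx E'' \<and> (\<forall>t. uplug E'' t = uplug E (uplug E' t))"
  by (induction rule: uectx.induct) (metis uectx.intros uplug.simps)+

(* Without the propagation of UWrong, which makes ustep fail to be closed under evaluation contexts:
   E[E'[UWrong]] steps to UWrong rather than to E[UWrong]. *)
inductive uhstep :: "utm \<Rightarrow> utm \<Rightarrow> bool" where
  "uectx E \<Longrightarrow> uhead t t' \<Longrightarrow> uhstep (uplug E t) (uplug E t')"

lemma uhstep_ustep: "uhstep t t' \<Longrightarrow> ustep t t'"
  by (auto elim!: uhstep.cases intro: US_Ctx)

lemma uhsteps_frame:
  assumes "uhstep\<^sup>*\<^sup>* t t'" "uectx E"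
  shows "uhstep\<^sup>*\<^sup>* (uplug E t) (uplug E t')"
  using assms(1)
proof induction
  case (step u u')
  have "uhstep (uplug E u) (uplug E u')"
    using step(2) by cases (metis uectx_compose[OF assms(2)] uhstep.intros)
  with step show ?case by simp
qed simp

lemma uhstep_head: "uhead t t' \<Longrightarrow> uhstep t t'"
  using uhstep.intros[of UCHole] by (simp add: uectx.intros)

lemma uhsteps_head: "uhstep\<^sup>*\<^sup>* s t \<Longrightarrow> uhead t t' \<Longrightarrow> uhstep\<^sup>*\<^sup>* t' u \<Longrightarrow> uhstep\<^sup>*\<^sup>* s u"
  by (meson converse_rtranclp_into_rtranclp rtranclp_trans uhstep_head)

lemma uhsteps_frame2:
  assumes "uectx E" "uectx E'" "uhstep\<^sup>*\<^sup>* t t'" "uhstep\<^sup>*\<^sup>* u u'" "uplug E t' = uplug E' u"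
  shows "uhstep\<^sup>*\<^sup>* (uplug E t) (uplug E' u')"
  using uhsteps_frame[OF assms(3,1)] uhsteps_frame[OF assms(4,2)] assms(5) by simp

lemma uhsteps_UApp:
  "uhstep\<^sup>*\<^sup>* t1 f \<Longrightarrow> uvalue f \<Longrightarrow> uhstep\<^sup>*\<^sup>* t2 a \<Longrightarrow> uhstep\<^sup>*\<^sup>* (UApp t1 t2) (UApp f a)"
  using uhsteps_frame2[of "UCApp1 UCHole t2" "UCApp2 f UCHole" t1 f] by (simp add: uectx.intros)

lemma uhsteps_UPair:
  "uhstep\<^sup>*\<^sup>* t1 a \<Longrightarrow> uvalue a \<Longrightarrow> uhstep\<^sup>*\<^sup>* t2 b \<Longrightarrow> uhstep\<^sup>*\<^sup>* (UPair t1 t2) (UPair a b)"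
  using uhsteps_frame2[of "UCPair1 UCHole t2" "UCPair2 a UCHole" t1 a] by (simp add: uectx.intros)

lemma uhsteps_unary:
  assumes "uhstep\<^sup>*\<^sup>* t t'"
  shows "uhstep\<^sup>*\<^sup>* (UFst t) (UFst t')" "uhstep\<^sup>*\<^sup>* (USnd t) (USnd t')"
    "uhstep\<^sup>*\<^sup>* (UInl t) (UInl t')" "uhstep\<^sup>*\<^sup>* (UInr t) (UInr t')"
    "uhstep\<^sup>*\<^sup>* (UCase t t1 t2) (UCase t' t1 t2)" "uhstep\<^sup>*\<^sup>* (USeq t t1) (USeq t' t1)"
    "uhstep\<^sup>*\<^sup>* (UIf t t1 t2) (UIf t' t1 t2)"
  using uhsteps_frame[OF assms, of "UCFst UCHole"] uhsteps_frame[OF assms, of "UCSnd UCHole"]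
    uhsteps_frame[OF assms, of "UCInl UCHole"] uhsteps_frame[OF assms, of "UCInr UCHole"]
    uhsteps_frame[OF assms, of "UCCase0 UCHole t1 t2"] uhsteps_frame[OF assms, of "UCSeq1 UCHole t1"]
    uhsteps_frame[OF assms, of "UCIf0 UCHole t1 t2"]
  by (simp_all add: uectx.intros)

lemma uev_uhsteps: "uev \<rho> t j v \<Longrightarrow> uhstep\<^sup>*\<^sup>* (usub (\<lambda>i. ureadback (\<rho> i)) t) (ureadback v)"
proof (induction rule: uev.induct)
  case (6 \<rho> t1 i \<rho>' b t2 j a k r)
  have "uhead (UApp (ureadback (WClos \<rho>' b)) (ureadback a))
      (usub (\<lambda>i. ureadback (case_nat a \<rho>' i)) b)"
    using UH_Beta[OF uvalue_ureadback, where t="usub (up_usub (\<lambda>i. ureadback (\<rho>' i))) b"]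
    by (simp add: usub0_usub_up ureadback_case_nat)
  then show ?case
    using uhsteps_head[OF uhsteps_UApp[OF 6(4) uvalue_ureadback 6(5)] _ 6(6)] by simp
next
  case (7 \<rho> t i a b)
  show ?case
    using uhsteps_head[OF uhsteps_unary(1)[OF 7(2)[unfolded ureadback.simps]]
        UH_Fst[OF uvalue_ureadback uvalue_ureadback] rtranclp.rtrancl_refl] by simp
next
  case (8 \<rho> t i a b)
  show ?case
    using uhsteps_head[OF uhsteps_unary(2)[OF 8(2)[unfolded ureadback.simps]]
        UH_Snd[OF uvalue_ureadback uvalue_ureadback] rtranclp.rtrancl_refl] by simp
next
  case (12 \<rho> t i a t1 k r t2)
  have "uhead (UCase (ureadback (WInl a)) u1 u2) (usub (\<lambda>i. ureadback (case_nat a \<rho> i)) t1)"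
    if "u1 = usub (up_usub (\<lambda>i. ureadback (\<rho> i))) t1" for u1 u2
    using UH_CaseInl[OF uvalue_ureadback, of a u1 u2] that
    by (simp add: usub0_usub_up ureadback_case_nat)
  then show ?case
    using uhsteps_head[OF uhsteps_unary(5)[OF 12(3)] _ 12(4)] by simp
next
  case (13 \<rho> t i a t2 k r t1)
  have "uhead (UCase (ureadback (WInr a)) u1 u2) (usub (\<lambda>i. ureadback (case_nat a \<rho> i)) t2)"
    if "u2 = usub (up_usub (\<lambda>i. ureadback (\<rho> i))) t2" for u1 u2
    using UH_CaseInr[OF uvalue_ureadback, of a u1 u2] that
    by (simp add: usub0_usub_up ureadback_case_nat)
  then show ?case
    using uhsteps_head[OF uhsteps_unary(5)[OF 13(3)] _ 13(4)] by simp
next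
  case (14 \<rho> t1 i t2 k r)
  show ?case using uhsteps_head[OF uhsteps_unary(6)[OF 14(3)[unfolded ureadback.simps]] UH_Seq 14(4)] by simp
next
  case (15 \<rho> t i t1 k r t2)
  show ?case using uhsteps_head[OF uhsteps_unary(7)[OF 15(3)[unfolded ureadback.simps]] UH_IfTrue 15(4)] by simp
next
  case (16 \<rho> t i t2 k r t1)
  show ?case using uhsteps_head[OF uhsteps_unary(7)[OF 16(3)[unfolded ureadback.simps]] UH_IfFalse 16(4)] by simp
qed (simp_all add: uhsteps_UPair uhsteps_unary uvalue_ureadback)

inductive ubig :: "utm \<Rightarrow> utm \<Rightarrow> bool" where
  "ubig UUnit UUnit"
| "ubig UTrue UTrue"
| "ubig UFalse UFalse"
| "ubig (ULam t) (ULam t)"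
| "ubig t1 (ULam b) \<Longrightarrow> ubig t2 a \<Longrightarrow> ubig (usub0 a b) r \<Longrightarrow> ubig (UApp t1 t2) r"
| "ubig t (UPair a b) \<Longrightarrow> ubig (UFst t) a"
| "ubig t (UPair a b) \<Longrightarrow> ubig (USnd t) b"
| "ubig t1 a \<Longrightarrow> ubig t2 b \<Longrightarrow> ubig (UPair t1 t2) (UPair a b)"
| "ubig t a \<Longrightarrow> ubig (UInl t) (UInl a)"
| "ubig t a \<Longrightarrow> ubig (UInr t) (UInr a)"
| "ubig t (UInl a) \<Longrightarrow> ubig (usub0 a t1) r \<Longrightarrow> ubig (UCase t t1 t2) r"
| "ubig t (UInr a) \<Longrightarrow> ubig (usub0 a t2) r \<Longrightarrow> ubig (UCase t t1 t2) r"
| "ubig t1 UUnit \<Longrightarrow> ubig t2 r \<Longrightarrow> ubig (USeq t1 t2) r"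
| "ubig t UTrue \<Longrightarrow> ubig t1 r \<Longrightarrow> ubig (UIf t t1 t2) r"
| "ubig t UFalse \<Longrightarrow> ubig t2 r \<Longrightarrow> ubig (UIf t t1 t2) r"

inductive_cases ubig_elims:
  "ubig UUnit w" "ubig UTrue w" "ubig UFalse w" "ubig (ULam t) w" "ubig (UVar i) w"
  "ubig (UApp t1 t2) w" "ubig (UFst t) w" "ubig (USnd t) w" "ubig (UPair t1 t2) w"
  "ubig (UInl t) w" "ubig (UInr t) w" "ubig (UCase t t1 t2) w" "ubig (USeq t1 t2) w"
  "ubig (UIf t t1 t2) w" "ubig UWrong w"

lemma ubig_value: "uvalue v \<Longrightarrow> ubig v v"
  by (induction rule: uvalue.induct) (auto intro: ubig.intros)

lemma ubig_value_unique: "uvalue v \<Longrightarrow> ubig v w \<Longrightarrow> w = v"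
  by (induction arbitrary: w rule: uvalue.induct) (blast elim: ubig_elims)+

text \<open>The head steps to \<open>UWrong\<close> are vacuous here, since \<open>UWrong\<close>
  evaluates to nothing.\<close>

lemma ubig_uhead: "uhead t t' \<Longrightarrow> ubig t' w \<Longrightarrow> ubig t w"
  by (induction rule: uhead.induct) (auto intro: ubig.intros ubig_value uvalue.intros elim: ubig_elims(15))

lemma ubig_uectx:
  assumes "uectx E" "\<And>w. ubig t' w \<Longrightarrow> ubig t w"
  shows "ubig (uplug E t') w \<Longrightarrow> ubig (uplug E t) w"
  using assms(1)
proof (induction arbitrary: w rule: uectx.induct)
  case 1
  then show ?case using assms(2) by simp
qed (simp only: uplug.simps, (elim ubig_elims; auto intro: ubig.intros))+

lemma usteps_ubig:
  assumes "ustep\<^sup>*\<^sup>* t v" "uvalue v"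
  shows "ubig t v"
  using assms(1)
proof (induction rule: converse_rtranclp_induct)
  case base
  then show ?case using assms(2) by (rule ubig_value)
next
  case (step t u)
  from step(1) show ?case
    \<comment> \<open>In the propagation case u is \<open>UWrong\<close>, contradicting that u
      evaluates to v.\<close>
    by cases (use step(3) ubig_uectx ubig_uhead ubig_elims(15) in blast)+
qed

lemma ureadback_eqD:
  "ureadback v = UUnit \<Longrightarrow> v = WUnit" "ureadback v = UTrue \<Longrightarrow> v = WTrue"
  "ureadback v = UFalse \<Longrightarrow> v = WFalse"
  by (cases v; simp)+

lemma ureadback_eq_ULam:
  assumes "ureadback v = ULam b"
  obtains \<rho> t where "v = WClos \<rho> t" "b = usub (up_usub (\<lambda>i. ureadback (\<rho> i))) t"
  using assms by (cases v) simp_all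

lemma ureadback_eq_UPair:
  assumes "ureadback v = UPair a b"
  obtains w w' where "v = WPair w w'" "a = ureadback w" "b = ureadback w'"
  using assms by (cases v) simp_all

lemma ureadback_eq_UInl:
  assumes "ureadback v = UInl a"
  obtains w where "v = WInl w" "a = ureadback w"
  using assms by (cases v) simp_all

lemma ureadback_eq_UInr:
  assumes "ureadback v = UInr a"
  obtains w where "v = WInr w" "a = ureadback w"
  using assms by (cases v) simp_all

lemma ureadback_noneq [simp]:
  "ureadback v \<noteq> UApp t1 t2" "ureadback v \<noteq> UFst t" "ureadback v \<noteq> USnd t"
  "ureadback v \<noteq> UCase t t1 t2" "ureadback v \<noteq> USeq t1 t2" "ureadback v \<noteq> UIf t t1 t2"
  by (cases v; simp)+

declare ureadback_noneq [THEN not_sym, simp]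

lemma ubig_uev:
  "ubig s w \<Longrightarrow> s = usub (\<lambda>i. ureadback (\<rho> i)) t \<Longrightarrow> \<exists>j v. uev \<rho> t j v \<and> ureadback v = w"
proof (induction arbitrary: \<rho> t rule: ubig.induct)
  case 1
  then show ?case using uev.intros(1) uev.intros(5)
    by (cases t) (simp_all, metis ureadback.simps(1), metis)
next
  case 2
  then show ?case using uev.intros(2) uev.intros(5)
    by (cases t) (simp_all, metis ureadback.simps(2), metis)
next
  case 3
  then show ?case using uev.intros(3) uev.intros(5)
    by (cases t) (simp_all, metis ureadback.simps(3), metis)
next
  case (4 b)
  show ?case
  proof (cases t)
    case (UVar i)
    then show ?thesis using 4 uev.intros(5)[of \<rho> i] by (metis usub.simps(5))
  next
    case (ULam u)
    then show ?thesis
      using 4 uev.intros(4)[of \<rho> u] by (metis ureadback.simps(4) usub.simps(4))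
  qed (use 4 in simp_all)
next
  case (5 t1 b t2 a r)
  from 5(7) obtain s1 s2 where t: "t = UApp s1 s2" "t1 = usub (\<lambda>i. ureadback (\<rho> i)) s1"
      "t2 = usub (\<lambda>i. ureadback (\<rho> i)) s2"
    by (cases t) auto
  obtain i v where "uev \<rho> s1 i v" "ureadback v = ULam b" using 5(4) t by blast
  then obtain \<rho>' b' where f: "uev \<rho> s1 i (WClos \<rho>' b')"
      "b = usub (up_usub (\<lambda>i. ureadback (\<rho>' i))) b'"
    by (auto elim: ureadback_eq_ULam)
  obtain j x where x: "uev \<rho> s2 j x" "ureadback x = a" using 5(5) t by blast
  have "usub0 a b = usub (\<lambda>i. ureadback (case_nat x \<rho>' i)) b'"
    by (simp add: f x(2)[symmetric] usub0_usub_up ureadback_case_nat)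
  then obtain k y where "uev (case_nat x \<rho>') b' k y" "ureadback y = r" using 5(6) by blast
  then show ?case using uev.intros(6)[OF f(1) x(1)] t(1) by blast
next
  case (6 u a b)
  from 6(3) obtain s1 where t: "t = UFst s1" "u = usub (\<lambda>i. ureadback (\<rho> i)) s1"
    by (cases t) auto
  show ?case using 6(2)[OF t(2)] t(1) uev.intros(7) by (metis ureadback_eq_UPair)
next
  case (7 u a b)
  from 7(3) obtain s1 where t: "t = USnd s1" "u = usub (\<lambda>i. ureadback (\<rho> i)) s1"
    by (cases t) auto
  show ?case using 7(2)[OF t(2)] t(1) uev.intros(8) by (metis ureadback_eq_UPair)
next
  case (8 t1 a t2 b)
  show ?case
  proof (cases "\<exists>i. t = UVar i")
    case True
    have "ubig (UPair t1 t2) (UPair a b)" using 8 ubig.intros(8) by blast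
    then have "UPair a b = UPair t1 t2" using True 8(5) ubig_value_unique uvalue_ureadback
      by (metis usub.simps(5))
    then show ?thesis using True 8(5) uev.intros(5) by (metis usub.simps(5))
  next
    case False
    then obtain s1 s2 where "t = UPair s1 s2" "t1 = usub (\<lambda>i. ureadback (\<rho> i)) s1"
        "t2 = usub (\<lambda>i. ureadback (\<rho> i)) s2"
      using 8(5) by (cases t) auto
    then show ?thesis using 8(3)[of \<rho> s1] 8(4)[of \<rho> s2] uev.intros(9)
      by (metis ureadback.simps(5))
  qed
next
  case (9 u a)
  show ?case
  proof (cases "\<exists>i. t = UVar i")
    case True
    have "ubig (UInl u) (UInl a)" using 9 ubig.intros(9) by blast
    then have "UInl a = UInl u" using True 9(3) ubig_value_unique uvalue_ureadback
      by (metis usub.simps(5))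
    then show ?thesis using True 9(3) uev.intros(5) by (metis usub.simps(5))
  next
    case False
    then obtain s1 where "t = UInl s1" "u = usub (\<lambda>i. ureadback (\<rho> i)) s1"
      using 9(3) by (cases t) auto
    then show ?thesis using 9(2)[of \<rho> s1] uev.intros(10) by (metis ureadback.simps(6))
  qed
next
  case (10 u a)
  show ?case
  proof (cases "\<exists>i. t = UVar i")
    case True
    have "ubig (UInr u) (UInr a)" using 10 ubig.intros(10) by blast
    then have "UInr a = UInr u" using True 10(3) ubig_value_unique uvalue_ureadback
      by (metis usub.simps(5))
    then show ?thesis using True 10(3) uev.intros(5) by (metis usub.simps(5))
  next
    case False
    then obtain s1 where "t = UInr s1" "u = usub (\<lambda>i. ureadback (\<rho> i)) s1"
      using 10(3) by (cases t) auto
    then show ?thesis using 10(2)[of \<rho> s1] uev.intros(11) by (metis ureadback.simps(7))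
  qed
next
  case (11 u a t1 r t2)
  from 11(5) obtain s s1 s2 where t: "t = UCase s s1 s2" "u = usub (\<lambda>i. ureadback (\<rho> i)) s"
      "t1 = usub (up_usub (\<lambda>i. ureadback (\<rho> i))) s1"
    by (cases t) auto
  obtain i x where x: "uev \<rho> s i (WInl x)" "a = ureadback x"
    using 11(3)[OF t(2)] by (metis ureadback_eq_UInl)
  have "usub0 a t1 = usub (\<lambda>i. ureadback (case_nat x \<rho> i)) s1"
    by (simp add: t(3) x(2) usub0_usub_up ureadback_case_nat)
  then obtain k y where "uev (case_nat x \<rho>) s1 k y" "ureadback y = r" using 11(4) by blast
  then show ?case using uev.intros(12)[OF x(1)] t(1) by blast
next
  case (12 u a t2 r t1)
  from 12(5) obtain s s1 s2 where t: "t = UCase s s1 s2" "u = usub (\<lambda>i. ureadback (\<rho> i)) s"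
      "t2 = usub (up_usub (\<lambda>i. ureadback (\<rho> i))) s2"
    by (cases t) auto
  obtain i x where x: "uev \<rho> s i (WInr x)" "a = ureadback x"
    using 12(3)[OF t(2)] by (metis ureadback_eq_UInr)
  have "usub0 a t2 = usub (\<lambda>i. ureadback (case_nat x \<rho> i)) s2"
    by (simp add: t(3) x(2) usub0_usub_up ureadback_case_nat)
  then obtain k y where "uev (case_nat x \<rho>) s2 k y" "ureadback y = r" using 12(4) by blast
  then show ?case using uev.intros(13)[OF x(1)] t(1) by blast
next
  case (13 t1 t2 r)
  from 13(5) obtain s1 s2 where t: "t = USeq s1 s2" "t1 = usub (\<lambda>i. ureadback (\<rho> i)) s1"
      "t2 = usub (\<lambda>i. ureadback (\<rho> i)) s2"
    by (cases t) auto
  show ?case using 13(3)[OF t(2)] 13(4)[OF t(3)] ureadback_eqD(1) t(1) uev.intros(14) by blast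
next
  case (14 u t1 r t2)
  from 14(5) obtain s s1 s2 where t: "t = UIf s s1 s2" "u = usub (\<lambda>i. ureadback (\<rho> i)) s"
      "t1 = usub (\<lambda>i. ureadback (\<rho> i)) s1"
    by (cases t) auto
  show ?case using 14(3)[OF t(2)] 14(4)[OF t(3)] ureadback_eqD(2) t(1) uev.intros(15) by blast
next
  case (15 u t2 r t1)
  from 15(5) obtain s s1 s2 where t: "t = UIf s s1 s2" "u = usub (\<lambda>i. ureadback (\<rho> i)) s"
      "t2 = usub (\<lambda>i. ureadback (\<rho> i)) s2"
    by (cases t) auto
  show ?case using 15(3)[OF t(2)] 15(4)[OF t(3)] ureadback_eqD(3) t(1) uev.intros(16) by blast
qed

lemma uterminates_iff:
  assumes "uscoped 0 t"
  shows "uterminates t \<longleftrightarrow> (\<exists>j v. uev \<rho> t j v)"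
proof -
  have t: "usub (\<lambda>i. ureadback (\<rho> i)) t = t"
    by (rule usub_closed) (use assms in \<open>auto simp: uscoped_def\<close>)
  show ?thesis
  proof
    assume "uterminates t"
    then show "\<exists>j v. uev \<rho> t j v"
      unfolding uterminates_def using usteps_ubig ubig_uev[OF _ t[symmetric]] by blast
  next
    assume "\<exists>j v. uev \<rho> t j v"
    then obtain v where "uhstep\<^sup>*\<^sup>* t (ureadback v)" using uev_uhsteps t by metis
    then show "uterminates t"
      unfolding uterminates_def
      using uvalue_ureadback mono_rtranclp[of uhstep ustep] uhstep_ustep by blast
  qed
qed

section \<open>The logical relation on source types\<close>

text \<open>The bodies are compared at indices strictly below k since entering them costs a tick on
  both sides; this strictness founds the treatment of recursion. The relations for argument and
  result are parameters, so that the definition serves both source types and the approximations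
  \<open>uvt n\<close>.\<close>

definition funrel :: "dir \<Rightarrow> ty \<Rightarrow> (nat \<Rightarrow> sval \<Rightarrow> uval \<Rightarrow> bool) \<Rightarrow> (nat \<Rightarrow> sval \<Rightarrow> uval \<Rightarrow> bool)
    \<Rightarrow> nat \<Rightarrow> sval \<Rightarrow> uval \<Rightarrow> bool" where
  "funrel d \<tau> P Q k f g \<longleftrightarrow> (\<exists>\<rho> b \<rho>' c. f = VClos \<tau> \<rho> b \<and> g = WClos \<rho>' c \<and>
     (\<forall>j<k. \<forall>x y. P j x y \<longrightarrow> sim d Q j (sev (case_nat x \<rho>) b) (uev (case_nat y \<rho>') c)))"

lemma antimono_funrel: "antimono_rel (funrel d \<tau> P Q)"
proof -
  have "funrel d \<tau> P Q j f g" if "funrel d \<tau> P Q k f g" "j \<le> k" for j k f g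
    using that less_le_trans[of _ j k] unfolding funrel_def by fast
  then show ?thesis by (auto simp: antimono_rel_def)
qed

lemma funrel_app:
  assumes "funrel d \<tau> P Q k f g" "P k x y" "antimono_rel P"
  shows "sim d Q k (sapp f x) (uapp g y)"
proof -
  obtain \<rho> b \<rho>' c where fg: "f = VClos \<tau> \<rho> b" "g = WClos \<rho>' c"
    and *: "\<And>j x y. j < k \<Longrightarrow> P j x y \<Longrightarrow> sim d Q j (sev (case_nat x \<rho>) b) (uev (case_nat y \<rho>') c)"
    using assms(1) by (auto simp: funrel_def)
  show ?thesis
    unfolding fg sapp_VClos uapp_WClos
    by (rule sim_tick, rule *) (use assms antimono_relD in \<open>auto, fastforce\<close>)
qed

text \<open>Components keep the index k, unlike in \<open>urel\<close> below: there a component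
  lives at a lower level, and the step that reaches it has to pay for this.\<close>

primrec vrel :: "ty \<Rightarrow> dir \<Rightarrow> nat \<Rightarrow> sval \<Rightarrow> uval \<Rightarrow> bool" where
  "vrel TUnit = (\<lambda>d k v w. v = VUnit \<and> w = WUnit)"
| "vrel TBool = (\<lambda>d k v w. v = VTrue \<and> w = WTrue \<or> v = VFalse \<and> w = WFalse)"
| "vrel (TFun \<tau>1 \<tau>2) = (\<lambda>d. funrel d \<tau>1 (vrel \<tau>1 d) (vrel \<tau>2 d))"
| "vrel (TProd \<tau>1 \<tau>2) = (\<lambda>d k v w. \<exists>v1 v2 w1 w2. v = VPair v1 v2 \<and> w = WPair w1 w2 \<and>
     vrel \<tau>1 d k v1 w1 \<and> vrel \<tau>2 d k v2 w2)"
| "vrel (TSum \<tau>1 \<tau>2) = (\<lambda>d k v w. (\<exists>v1 w1. v = VInl v1 \<and> w = WInl w1 \<and> vrel \<tau>1 d k v1 w1) \<or>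
     (\<exists>v2 w2. v = VInr v2 \<and> w = WInr w2 \<and> vrel \<tau>2 d k v2 w2))"

lemma antimono_vrel: "antimono_rel (vrel \<tau> d)"
proof (induction \<tau>)
  case (TFun \<tau>1 \<tau>2)
  then show ?case using antimono_funrel by simp
next
  case (TProd \<tau>1 \<tau>2)
  then show ?case unfolding antimono_rel_def vrel.simps by blast
next
  case (TSum \<tau>1 \<tau>2)
  then show ?case unfolding antimono_rel_def vrel.simps by blast
qed (auto simp: antimono_rel_def)

lemmas vrel_antimono = antimono_relD[OF antimono_vrel]

lemma vrel_Suc: "vrel \<tau> d (Suc k) v w \<Longrightarrow> vrel \<tau> d k v w"
  by (erule vrel_antimono) simp

lemma vrel_app:
  "vrel (TFun \<tau>1 \<tau>2) d k f g \<Longrightarrow> vrel \<tau>1 d k x y \<Longrightarrow> sim d (vrel \<tau>2 d) k (sapp f x) (uapp g y)"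
  using funrel_app antimono_vrel by simp

definition envrel :: "dir \<Rightarrow> nat \<Rightarrow> ty list \<Rightarrow> (nat \<Rightarrow> nat) \<Rightarrow> (nat \<Rightarrow> sval) \<Rightarrow> (nat \<Rightarrow> uval) \<Rightarrow> bool" where
  "envrel d k \<Gamma> r \<rho> \<rho>' \<longleftrightarrow> (\<forall>i < length \<Gamma>. vrel (\<Gamma> ! i) d k (\<rho> i) (\<rho>' (r i)))"

lemma envrel_antimono: "envrel d k \<Gamma> r \<rho> \<rho>' \<Longrightarrow> j \<le> k \<Longrightarrow> envrel d j \<Gamma> r \<rho> \<rho>'"
  using vrel_antimono by (auto simp: envrel_def)

lemma envrel_Cons:
  "vrel \<tau> d k v w \<Longrightarrow> envrel d k \<Gamma> r \<rho> \<rho>' \<Longrightarrow>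
   envrel d k (\<tau> # \<Gamma>) (up_ren r) (case_nat v \<rho>) (case_nat w \<rho>')"
  by (auto simp: envrel_def up_ren_def less_Suc_eq_0_disj split: nat.splits)

(* The relocation r of variables is there because modcomp exchanges the variables of erase t. *)
definition logrel :: "ty list \<Rightarrow> (nat \<Rightarrow> nat) \<Rightarrow> stm \<Rightarrow> utm \<Rightarrow> ty \<Rightarrow> bool" where
  "logrel \<Gamma> r s u \<tau> \<longleftrightarrow>
     (\<forall>d k \<rho> \<rho>'. envrel d k \<Gamma> r \<rho> \<rho>' \<longrightarrow> sim d (vrel \<tau> d) k (sev \<rho> s) (uev \<rho>' u))"

lemma logrelD:
  "logrel \<Gamma> r s u \<tau> \<Longrightarrow> envrel d k \<Gamma> r \<rho> \<rho>' \<Longrightarrow> j \<le> k \<Longrightarrow> sim d (vrel \<tau> d) j (sev \<rho> s) (uev \<rho>' u)"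
  unfolding logrel_def using envrel_antimono by blast

lemma logrel_SUnit: "logrel \<Gamma> r SUnit UUnit TUnit"
  by (simp add: logrel_def sim_ret)

lemma logrel_STrue: "logrel \<Gamma> r STrue UTrue TBool"
  by (simp add: logrel_def sim_ret)

lemma logrel_SFalse: "logrel \<Gamma> r SFalse UFalse TBool"
  by (simp add: logrel_def sim_ret)

lemma logrel_SVar: "i < length \<Gamma> \<Longrightarrow> logrel \<Gamma> r (SVar i) (UVar (r i)) (\<Gamma> ! i)"
  by (simp add: logrel_def envrel_def sim_ret)

lemma logrel_SLam:
  assumes "logrel (\<tau>1 # \<Gamma>) (up_ren r) s u \<tau>2"
  shows "logrel \<Gamma> r (SLam \<tau>1 s) (ULam u) (TFun \<tau>1 \<tau>2)"
  using assms envrel_Cons envrel_antimono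
  unfolding logrel_def by (fastforce intro!: sim_ret simp: funrel_def)

lemma logrel_SApp:
  assumes "logrel \<Gamma> r s1 u1 (TFun \<tau>1 \<tau>2)" "logrel \<Gamma> r s2 u2 \<tau>1"
  shows "logrel \<Gamma> r (SApp s1 s2) (UApp u1 u2) \<tau>2"
  unfolding logrel_def sev_SApp uev_UApp
proof (intro allI impI)
  fix d k \<rho> \<rho>' assume env: "envrel d k \<Gamma> r \<rho> \<rho>'"
  show "sim d (vrel \<tau>2 d) k (bind (sev \<rho> s1) (\<lambda>f. bind (sev \<rho> s2) (sapp f)))
      (bind (uev \<rho>' u1) (\<lambda>f. bind (uev \<rho>' u2) (uapp f)))"
  proof (rule sim_bind[OF logrelD[OF assms(1) env order_refl]])
    fix j f g assume j: "j \<le> k" and fg: "vrel (TFun \<tau>1 \<tau>2) d j f g"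
    show "sim d (vrel \<tau>2 d) j (bind (sev \<rho> s2) (sapp f)) (bind (uev \<rho>' u2) (uapp g))"
      by (rule sim_bind[OF logrelD[OF assms(2) env j]]) (meson fg vrel_antimono vrel_app)
  qed
qed

lemma logrel_SFst:
  assumes "logrel \<Gamma> r s u (TProd \<tau>1 \<tau>2)"
  shows "logrel \<Gamma> r (SFst s) (UFst u) \<tau>1"
  unfolding logrel_def sev_SFst uev_UFst
  by (intro allI impI, rule sim_bind, erule logrelD[OF assms], simp)
    (auto intro!: sim_tick sim_ret intro: vrel_Suc)

lemma logrel_SSnd:
  assumes "logrel \<Gamma> r s u (TProd \<tau>1 \<tau>2)"
  shows "logrel \<Gamma> r (SSnd s) (USnd u) \<tau>2"
  unfolding logrel_def sev_SSnd uev_USnd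
  by (intro allI impI, rule sim_bind, erule logrelD[OF assms], simp)
    (auto intro!: sim_tick sim_ret intro: vrel_Suc)

lemma sim_pair:
  assumes "sim d (vrel \<tau>1 d) k c1 c1'" "\<And>j. j \<le> k \<Longrightarrow> sim d (vrel \<tau>2 d) j c2 c2'"
  shows "sim d (vrel (TProd \<tau>1 \<tau>2) d) k (bind c1 (\<lambda>x. bind c2 (\<lambda>y. ret (VPair x y))))
    (bind c1' (\<lambda>x. bind c2' (\<lambda>y. ret (WPair x y))))"
  by (rule sim_bind[OF assms(1)], rule sim_bind[OF assms(2)])
    (auto intro!: sim_ret intro: vrel_antimono)

lemma logrel_SPair:
  assumes "logrel \<Gamma> r s1 u1 \<tau>1" "logrel \<Gamma> r s2 u2 \<tau>2"
  shows "logrel \<Gamma> r (SPair s1 s2) (UPair u1 u2) (TProd \<tau>1 \<tau>2)"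
  using logrelD[OF assms(1)] logrelD[OF assms(2)] unfolding logrel_def sev_SPair uev_UPair
  by (blast intro: sim_pair)

lemma sim_inl:
  assumes "sim d (vrel \<tau>1 d) k c c'"
  shows "sim d (vrel (TSum \<tau>1 \<tau>2) d) k (bind c (\<lambda>x. ret (VInl x))) (bind c' (\<lambda>x. ret (WInl x)))"
  by (rule sim_bind[OF assms]) (simp add: sim_ret)

lemma sim_inr:
  assumes "sim d (vrel \<tau>2 d) k c c'"
  shows "sim d (vrel (TSum \<tau>1 \<tau>2) d) k (bind c (\<lambda>x. ret (VInr x))) (bind c' (\<lambda>x. ret (WInr x)))"
  by (rule sim_bind[OF assms]) (simp add: sim_ret)

lemma logrel_SInl:
  assumes "logrel \<Gamma> r s u \<tau>1"
  shows "logrel \<Gamma> r (SInl s) (UInl u) (TSum \<tau>1 \<tau>2)"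
  using logrelD[OF assms] unfolding logrel_def sev_SInl uev_UInl by (blast intro: sim_inl)

lemma logrel_SInr:
  assumes "logrel \<Gamma> r s u \<tau>2"
  shows "logrel \<Gamma> r (SInr s) (UInr u) (TSum \<tau>1 \<tau>2)"
  using logrelD[OF assms] unfolding logrel_def sev_SInr uev_UInr by (blast intro: sim_inr)

lemma logrel_SCase:
  assumes "logrel \<Gamma> r s u (TSum \<tau>1 \<tau>2)" "logrel (\<tau>1 # \<Gamma>) (up_ren r) s1 u1 \<tau>"
    "logrel (\<tau>2 # \<Gamma>) (up_ren r) s2 u2 \<tau>"
  shows "logrel \<Gamma> r (SCase s s1 s2) (UCase u u1 u2) \<tau>"
  unfolding logrel_def sev_SCase uev_UCase
proof (intro allI impI, rule sim_bind, erule logrelD[OF assms(1)], simp)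
  fix d k \<rho> \<rho>' j v w
  assume env: "envrel d k \<Gamma> r \<rho> \<rho>'" and "j \<le> k" and vw: "vrel (TSum \<tau>1 \<tau>2) d j v w"
  then have env: "envrel d j \<Gamma> r \<rho> \<rho>'" using envrel_antimono by blast
  show "sim d (vrel \<tau> d) j
      (case v of VInl a \<Rightarrow> tick (sev (case_nat a \<rho>) s1) | VInr a \<Rightarrow> tick (sev (case_nat a \<rho>) s2)
        | _ \<Rightarrow> fail)
      (case w of WInl a \<Rightarrow> tick (uev (case_nat a \<rho>') u1) | WInr a \<Rightarrow> tick (uev (case_nat a \<rho>') u2)
        | _ \<Rightarrow> fail)"
    using vw logrelD[OF assms(2) envrel_Cons[OF _ env]] logrelD[OF assms(3) envrel_Cons[OF _ env]]
    by (auto intro!: sim_tick)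
qed

lemma logrel_SSeq:
  assumes "logrel \<Gamma> r s1 u1 TUnit" "logrel \<Gamma> r s2 u2 \<tau>"
  shows "logrel \<Gamma> r (SSeq s1 s2) (USeq u1 u2) \<tau>"
  unfolding logrel_def sev_SSeq uev_USeq
  by (intro allI impI, rule sim_bind, erule logrelD[OF assms(1)], simp)
    (auto intro: logrelD[OF assms(2)])

lemma logrel_SIf:
  assumes "logrel \<Gamma> r s u TBool" "logrel \<Gamma> r s1 u1 \<tau>" "logrel \<Gamma> r s2 u2 \<tau>"
  shows "logrel \<Gamma> r (SIf s s1 s2) (UIf u u1 u2) \<tau>"
  unfolding logrel_def sev_SIf uev_UIf
  by (intro allI impI, rule sim_bind, erule logrelD[OF assms(1)], simp)
    (auto intro: logrelD[OF assms(2)] logrelD[OF assms(3)])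

(* The body of both halves of ufix, and the value of \y. x x y there. *)
definition ufix_body :: utm where
  "ufix_body = UApp (UVar 1) (ULam (UApp (UApp (UVar 1) (UVar 1)) (UVar 0)))"

definition wfix :: "(nat \<Rightarrow> uval) \<Rightarrow> uval \<Rightarrow> uval" where
  "wfix \<rho> f = WClos (case_nat (WClos (case_nat f \<rho>) ufix_body) (case_nat f \<rho>))
     (UApp (UApp (UVar 1) (UVar 1)) (UVar 0))"

text \<open>The two ticks are the call of \<open>ufix\<close> on f and the self-application of its
  inner abstraction.\<close>

lemma uev_ufix: "uev \<rho> (UApp ufix u) = bind (uev \<rho> u) (\<lambda>f. tick (tick (uapp f (wfix \<rho> f))))"
  by (simp add: ufix_def wfix_def ufix_body_def Let_def)

lemma uev_wfix_body:
  "wfix \<rho> f = WClos \<rho>' b \<Longrightarrow>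
   uev (case_nat y \<rho>') b = tick (bind (uapp f (wfix \<rho> f)) (\<lambda>h. uapp h y))"
  by (auto simp: wfix_def ufix_body_def)

lemma sev_vfix_body:
  "vfix \<tau>1 \<tau>2 f = VClos \<tau> \<rho> b \<Longrightarrow> f = VClos (TFun \<tau>1 \<tau>2) \<rho>' b' \<Longrightarrow>
   sev (case_nat y \<rho>) b = bind (sapp f (vfix \<tau>1 \<tau>2 f)) (\<lambda>h. sapp h y)"
  by (auto simp: vfix_def)

text \<open>Related functions need only be related when called at a smaller index, and there the
  recursive values are related by induction. The target spends one more tick on each unrolling, for
  its self-application.\<close>

lemma vrel_fix:
  assumes "vrel (TFun (TFun \<tau>1 \<tau>2) (TFun \<tau>1 \<tau>2)) d k f g"
  shows "vrel (TFun \<tau>1 \<tau>2) d k (vfix \<tau>1 \<tau>2 f) (wfix \<rho> g)"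
  using assms
proof (induction k rule: less_induct)
  case (less k)
  obtain \<rho>f b where f: "f = VClos (TFun \<tau>1 \<tau>2) \<rho>f b"
    using less.prems by (auto simp: funrel_def)
  obtain \<rho>v c where v: "vfix \<tau>1 \<tau>2 f = VClos \<tau>1 \<rho>v c" by (simp add: vfix_def)
  obtain \<rho>w c' where w: "wfix \<rho> g = WClos \<rho>w c'" by (simp add: wfix_def)
  have "sim d (vrel \<tau>2 d) j (sev (case_nat x \<rho>v) c) (uev (case_nat y \<rho>w) c')"
    if j: "j < k" and xy: "vrel \<tau>1 d j x y" for j x y
    unfolding sev_vfix_body[OF v f] uev_wfix_body[OF w]
  proof (rule sim_tick_right[OF antimono_vrel], rule sim_bind)
    have "vrel (TFun \<tau>1 \<tau>2) d j (vfix \<tau>1 \<tau>2 f) (wfix \<rho> g)"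
      using less.IH[OF j] less.prems vrel_antimono j by (meson less_imp_le)
    then show "sim d (vrel (TFun \<tau>1 \<tau>2) d) j (sapp f (vfix \<tau>1 \<tau>2 f)) (uapp g (wfix \<rho> g))"
      using vrel_app less.prems vrel_antimono j by (meson less_imp_le)
    show "sim d (vrel \<tau>2 d) i (sapp h x) (uapp h' y)"
      if "i \<le> j" "vrel (TFun \<tau>1 \<tau>2) d i h h'" for i h h'
      using that vrel_app vrel_antimono xy by blast
  qed
  then show ?case using v w by (auto simp: funrel_def)
qed

lemma logrel_SFix:
  assumes "logrel \<Gamma> r s u (TFun (TFun \<tau>1 \<tau>2) (TFun \<tau>1 \<tau>2))"
  shows "logrel \<Gamma> r (SFix \<tau>1 \<tau>2 s) (UApp ufix u) (TFun \<tau>1 \<tau>2)"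
  unfolding logrel_def sev_SFix uev_ufix
proof (intro allI impI, rule sim_bind, erule logrelD[OF assms], simp)
  fix d k \<rho> and \<rho>' :: "nat \<Rightarrow> uval" and j f g
  assume fg: "vrel (TFun (TFun \<tau>1 \<tau>2) (TFun \<tau>1 \<tau>2)) d j f g"
  obtain \<rho>f b where f: "f = VClos (TFun \<tau>1 \<tau>2) \<rho>f b"
    using fg by (auto simp: funrel_def)
  have "sim d (vrel (TFun \<tau>1 \<tau>2) d) j (sapp f (vfix \<tau>1 \<tau>2 f)) (tick (tick (uapp g (wfix \<rho>' g))))"
    by (intro sim_tick_right antimono_vrel vrel_app[OF fg] vrel_fix fg)
  then show "sim d (vrel (TFun \<tau>1 \<tau>2) d) j
      (case f of VClos \<tau> _ _ \<Rightarrow> if \<tau> = TFun \<tau>1 \<tau>2 then sapp f (vfix \<tau>1 \<tau>2 f) else fail | _ \<Rightarrow> fail)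
      (tick (tick (uapp g (wfix \<rho>' g))))"
    using f by simp
qed

lemmas logrel_intros = logrel_SUnit logrel_STrue logrel_SFalse logrel_SVar logrel_SLam logrel_SApp
  logrel_SFst logrel_SSnd logrel_SPair logrel_SInl logrel_SInr logrel_SCase logrel_SSeq logrel_SIf
  logrel_SFix

lemma uren_ufix: "uren r ufix = ufix"
  by (simp add: ufix_def up_ren_def Let_def)

text \<open>The fundamental property of the logical relation. It is proved for all relocations at
  once because each binder lifts the relocation.\<close>

lemma logrel_erase: "has_type \<Gamma> s \<tau> \<Longrightarrow> logrel \<Gamma> r s (uren r (erase s)) \<tau>"
  by (induction arbitrary: r rule: has_type.induct) (auto intro: logrel_intros simp: uren_ufix)

lemma uren_id: "uren id t = t"
  by (induction t) (simp_all add: up_ren_id[unfolded id_def] id_def)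

lemma logrel_erase_id: "has_type \<Gamma> s \<tau> \<Longrightarrow> logrel \<Gamma> id s (erase s) \<tau>"
  using logrel_erase[of \<Gamma> s \<tau> id] by (simp add: uren_id)

section \<open>Wrappers on source types\<close>

declare protect.simps [simp del] confine.simps [simp del]

text \<open>Every wrapper is an abstraction, so its value is a closure over the environment in which
  it happens to be evaluated. Facts about wrappers therefore hold for every such
  environment.\<close>

definition lam_body :: "utm \<Rightarrow> utm" where
  "lam_body u = (case u of ULam t \<Rightarrow> t | _ \<Rightarrow> u)"

definition wprotect :: "ty \<Rightarrow> (nat \<Rightarrow> uval) \<Rightarrow> uval" where
  "wprotect \<tau> \<rho> = WClos \<rho> (lam_body (protect \<tau>))"

definition wconfine :: "ty \<Rightarrow> (nat \<Rightarrow> uval) \<Rightarrow> uval" where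
  "wconfine \<tau> \<rho> = WClos \<rho> (lam_body (confine \<tau>))"

lemma uev_protect [simp]: "uev \<rho> (protect \<tau>) = ret (wprotect \<tau> \<rho>)"
  by (cases \<tau>) (simp_all add: wprotect_def protect.simps lam_body_def)

lemma uev_confine [simp]: "uev \<rho> (confine \<tau>) = ret (wconfine \<tau> \<rho>)"
  by (cases \<tau>) (simp_all add: wconfine_def confine.simps lam_body_def)

lemma uapp_wprotect:
  "uapp (wprotect \<tau> \<rho>) w = tick (uev (case_nat w \<rho>) (lam_body (protect \<tau>)))"
  by (simp add: wprotect_def)

lemma uapp_wconfine:
  "uapp (wconfine \<tau> \<rho>) w = tick (uev (case_nat w \<rho>) (lam_body (confine \<tau>)))"
  by (simp add: wconfine_def)

lemma uapp_wprotect_base [simp]: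
  "uapp (wprotect TUnit \<rho>) w = tick (ret w)" "uapp (wprotect TBool \<rho>) w = tick (ret w)"
  by (simp_all add: uapp_wprotect protect.simps lam_body_def)

lemma uapp_wprotect_TProd:
  "uapp (wprotect (TProd \<tau>1 \<tau>2) \<rho>) w = tick (bind
     (bind (case w of WPair a b \<Rightarrow> tick (ret a) | _ \<Rightarrow> fail) (uapp (wprotect \<tau>1 (case_nat w \<rho>))))
     (\<lambda>x. bind (bind (case w of WPair a b \<Rightarrow> tick (ret b) | _ \<Rightarrow> fail)
        (uapp (wprotect \<tau>2 (case_nat w \<rho>)))) (\<lambda>y. ret (WPair x y))))"
  by (subst uapp_wprotect) (simp add: protect.simps lam_body_def)

lemma uapp_wprotect_TSum:
  "uapp (wprotect (TSum \<tau>1 \<tau>2) \<rho>) w = tick (case w of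
      WInl a \<Rightarrow> tick (bind (uapp (wprotect \<tau>1 (case_nat a (case_nat w \<rho>))) a) (\<lambda>x. ret (WInl x)))
    | WInr a \<Rightarrow> tick (bind (uapp (wprotect \<tau>2 (case_nat a (case_nat w \<rho>))) a) (\<lambda>x. ret (WInr x)))
    | _ \<Rightarrow> fail)"
  by (subst uapp_wprotect) (cases w; simp add: protect.simps lam_body_def)

definition protect_fun_body :: "ty \<Rightarrow> ty \<Rightarrow> utm" where
  "protect_fun_body \<tau>1 \<tau>2 = UApp (protect \<tau>2) (UApp (UVar 1) (UApp (confine \<tau>1) (UVar 0)))"

lemma uapp_wprotect_TFun:
  "uapp (wprotect (TFun \<tau>1 \<tau>2) \<rho>) w = tick (ret (WClos (case_nat w \<rho>) (protect_fun_body \<tau>1 \<tau>2)))"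
  by (subst uapp_wprotect) (simp add: protect.simps lam_body_def protect_fun_body_def)

lemma uev_protect_fun_body:
  "uev (case_nat y (case_nat w \<rho>)) (protect_fun_body \<tau>1 \<tau>2) =
     bind (uapp (wconfine \<tau>1 (case_nat y (case_nat w \<rho>))) y)
       (\<lambda>y'. bind (uapp w y') (uapp (wprotect \<tau>2 (case_nat y (case_nat w \<rho>)))))"
  by (simp add: protect_fun_body_def)

lemma uapp_wconfine_TUnit:
  "uapp (wconfine TUnit \<rho>) w = tick (case w of WUnit \<Rightarrow> ret WUnit | _ \<Rightarrow> fail)"
  by (cases w) (simp_all add: uapp_wconfine confine.simps lam_body_def)

lemma uapp_wconfine_TBool:
  "uapp (wconfine TBool \<rho>) w =
     tick (case w of WTrue \<Rightarrow> ret WTrue | WFalse \<Rightarrow> ret WFalse | _ \<Rightarrow> fail)"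
  by (cases w) (simp_all add: uapp_wconfine confine.simps lam_body_def)

lemma uapp_wconfine_TProd:
  "uapp (wconfine (TProd \<tau>1 \<tau>2) \<rho>) w = tick (bind
     (bind (case w of WPair a b \<Rightarrow> tick (ret a) | _ \<Rightarrow> fail) (uapp (wconfine \<tau>1 (case_nat w \<rho>))))
     (\<lambda>x. bind (bind (case w of WPair a b \<Rightarrow> tick (ret b) | _ \<Rightarrow> fail)
        (uapp (wconfine \<tau>2 (case_nat w \<rho>)))) (\<lambda>y. ret (WPair x y))))"
  by (subst uapp_wconfine) (simp add: confine.simps lam_body_def)

lemma uapp_wconfine_TSum:
  "uapp (wconfine (TSum \<tau>1 \<tau>2) \<rho>) w = tick (case w of
      WInl a \<Rightarrow> tick (bind (uapp (wconfine \<tau>1 (case_nat a (case_nat w \<rho>))) a) (\<lambda>x. ret (WInl x)))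
    | WInr a \<Rightarrow> tick (bind (uapp (wconfine \<tau>2 (case_nat a (case_nat w \<rho>))) a) (\<lambda>x. ret (WInr x)))
    | _ \<Rightarrow> fail)"
  by (subst uapp_wconfine) (cases w; simp add: confine.simps lam_body_def)

definition confine_fun_body :: "ty \<Rightarrow> ty \<Rightarrow> utm" where
  "confine_fun_body \<tau>1 \<tau>2 = UApp (confine \<tau>2) (UApp (UVar 1) (UApp (protect \<tau>1) (UVar 0)))"

lemma uapp_wconfine_TFun:
  "uapp (wconfine (TFun \<tau>1 \<tau>2) \<rho>) w = tick (ret (WClos (case_nat w \<rho>) (confine_fun_body \<tau>1 \<tau>2)))"
  by (subst uapp_wconfine) (simp add: confine.simps lam_body_def confine_fun_body_def)

lemma uev_confine_fun_body:
  "uev (case_nat y (case_nat w \<rho>)) (confine_fun_body \<tau>1 \<tau>2) =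
     bind (uapp (wprotect \<tau>1 (case_nat y (case_nat w \<rho>))) y)
       (\<lambda>y'. bind (uapp w y') (uapp (wconfine \<tau>2 (case_nat y (case_nat w \<rho>)))))"
  by (simp add: confine_fun_body_def)

text \<open>A and B are the wrappers of argument and result. Their first parameter is the unwrapped
  argument, which the closures of both wrappers capture although it does not influence the
  relation.\<close>

lemma sim_wrap_fun:
  assumes "vrel (TFun \<tau>1 \<tau>2) d k f g"
    and "\<And>j x y. vrel \<tau>1 d j x y \<Longrightarrow> sim d (vrel \<tau>1 d) j (ret x) (A y y)"
    and "\<And>j x y y'. vrel \<tau>2 d j x y \<Longrightarrow> sim d (vrel \<tau>2 d) j (ret x) (B y' y)"
    and "\<And>y. uev (case_nat y \<rho>) c = bind (A y y) (\<lambda>y'. bind (uapp g y') (B y))"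
  shows "vrel (TFun \<tau>1 \<tau>2) d k f (WClos \<rho> c)"
proof -
  obtain \<rho>1 b \<rho>2 b' where f: "f = VClos \<tau>1 \<rho>1 b" and g: "g = WClos \<rho>2 b'"
    and *: "\<And>j x y. j < k \<Longrightarrow> vrel \<tau>1 d j x y
      \<Longrightarrow> sim d (vrel \<tau>2 d) j (sev (case_nat x \<rho>1) b) (uev (case_nat y \<rho>2) b')"
    using assms(1) by (auto simp: funrel_def)
  have "sim d (vrel \<tau>2 d) j (sev (case_nat x \<rho>1) b) (uev (case_nat y \<rho>) c)"
    if j: "j < k" and xy: "vrel \<tau>1 d j x y" for j x y
  proof -
    \<comment> \<open>The source call is padded with trivial computations at both ends, so that it
      has the three phases of the wrapped call: wrap, call, wrap.\<close>
    have "sim d (vrel \<tau>2 d) j (bind (ret x) (\<lambda>x. bind (sev (case_nat x \<rho>1) b) ret))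
        (bind (A y y) (\<lambda>y'. bind (uapp g y') (B y)))"
      unfolding g uapp_WClos bind_tick
      by (rule sim_bind[OF assms(2)[OF xy]], rule sim_tick_right[OF antimono_vrel],
          rule sim_bind[OF *]) (use j assms(3) in auto)
    then show ?thesis by (simp add: assms(4))
  qed
  then show ?thesis by (auto simp: f funrel_def)
qed

text \<open>On values that already behave according to \<tau> both wrappers are the identity up to
  target cost. They are treated together because each calls the other at argument types.\<close>

lemma sim_wrappers:
  assumes "vrel \<tau> d k v w"
  shows "sim d (vrel \<tau> d) k (ret v) (uapp (wprotect \<tau> \<rho>) w)"
    and "sim d (vrel \<tau> d) k (ret v) (uapp (wconfine \<tau> \<rho>) w)"
proof -
  have "(\<forall>\<rho>. sim d (vrel \<tau> d) k (ret v) (uapp (wprotect \<tau> \<rho>) w)) \<and>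
      (\<forall>\<rho>. sim d (vrel \<tau> d) k (ret v) (uapp (wconfine \<tau> \<rho>) w))"
    using assms
  proof (induction \<tau> arbitrary: k v w)
    case TUnit
    have "sim d (vrel TUnit d) k (ret v) (tick (ret w))"
      by (intro sim_tick_right antimono_vrel sim_ret TUnit)
    then show ?case using TUnit by (simp add: uapp_wconfine_TUnit)
  next
    case TBool
    have "sim d (vrel TBool d) k (ret v) (tick (ret w))"
      by (intro sim_tick_right antimono_vrel sim_ret TBool)
    then show ?case using TBool by (auto simp: uapp_wconfine_TBool)
  next
    case (TFun \<tau>1 \<tau>2)
    have "vrel (TFun \<tau>1 \<tau>2) d k v (WClos (case_nat w \<rho>) (protect_fun_body \<tau>1 \<tau>2))" for \<rho>
      by (rule sim_wrap_fun[OF TFun.prems, where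
            A = "\<lambda>y. uapp (wconfine \<tau>1 (case_nat y (case_nat w \<rho>)))" and
            B = "\<lambda>y. uapp (wprotect \<tau>2 (case_nat y (case_nat w \<rho>)))"])
        (use TFun.IH in \<open>auto simp: uev_protect_fun_body\<close>)
    moreover have "vrel (TFun \<tau>1 \<tau>2) d k v (WClos (case_nat w \<rho>) (confine_fun_body \<tau>1 \<tau>2))" for \<rho>
      by (rule sim_wrap_fun[OF TFun.prems, where
            A = "\<lambda>y. uapp (wprotect \<tau>1 (case_nat y (case_nat w \<rho>)))" and
            B = "\<lambda>y. uapp (wconfine \<tau>2 (case_nat y (case_nat w \<rho>)))"])
        (use TFun.IH in \<open>auto simp: uev_confine_fun_body\<close>)
    ultimately show ?case
      unfolding uapp_wprotect_TFun uapp_wconfine_TFun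
      by (blast intro: sim_tick_right antimono_vrel sim_ret)
  next
    case (TProd \<tau>1 \<tau>2)
    then obtain v1 v2 w1 w2 where vw: "v = VPair v1 v2" "w = WPair w1 w2"
      and 1: "vrel \<tau>1 d k v1 w1" and 2: "vrel \<tau>2 d k v2 w2" by auto
    have *: "sim d (vrel (TProd \<tau>1 \<tau>2) d) k (ret v)
        (tick (bind (tick c1) (\<lambda>x. bind (tick c2) (\<lambda>y. ret (WPair x y)))))"
      if c1: "sim d (vrel \<tau>1 d) k (ret v1) c1"
        and c2: "\<And>j. vrel \<tau>2 d j v2 w2 \<Longrightarrow> sim d (vrel \<tau>2 d) j (ret v2) c2" for c1 c2
    proof -
      have "sim d (vrel (TProd \<tau>1 \<tau>2) d) k
          (bind (ret v1) (\<lambda>x. bind (ret v2) (\<lambda>y. ret (VPair x y))))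
          (tick (bind (tick c1) (\<lambda>x. bind (tick c2) (\<lambda>y. ret (WPair x y)))))"
        by (rule sim_tick_right[OF antimono_vrel], rule sim_pair)
          (use c1 c2 2 vrel_antimono in \<open>auto intro!: sim_tick_right antimono_vrel\<close>)
      then show ?thesis using vw by simp
    qed
    show ?case
      using *[OF TProd.IH(1)[OF 1, THEN conjunct1, rule_format]
          TProd.IH(2)[THEN conjunct1, rule_format]]
        *[OF TProd.IH(1)[OF 1, THEN conjunct2, rule_format]
          TProd.IH(2)[THEN conjunct2, rule_format]] vw
      by (simp add: uapp_wprotect_TProd uapp_wconfine_TProd)
  next
    case (TSum \<tau>1 \<tau>2)
    have l: "sim d (vrel (TSum \<tau>1 \<tau>2) d) k (ret (VInl v1)) (tick (tick (bind c (\<lambda>x. ret (WInl x)))))"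
      if "sim d (vrel \<tau>1 d) k (ret v1) c" for v1 c
      by (intro sim_tick_right antimono_vrel sim_inl[OF that, of \<tau>2, unfolded bind_ret])
    have r: "sim d (vrel (TSum \<tau>1 \<tau>2) d) k (ret (VInr v1)) (tick (tick (bind c (\<lambda>x. ret (WInr x)))))"
      if "sim d (vrel \<tau>2 d) k (ret v1) c" for v1 c
      by (intro sim_tick_right antimono_vrel sim_inr[OF that, of \<tau>1, unfolded bind_ret])
    consider v1 w1 where "v = VInl v1" "w = WInl w1" "vrel \<tau>1 d k v1 w1"
      | v1 w1 where "v = VInr v1" "w = WInr w1" "vrel \<tau>2 d k v1 w1"
      using TSum.prems by auto
    then show ?case
    proof cases
      case 1
      then show ?thesis
        using TSum.IH(1)[OF 1(3)] l
        by (simp add: uapp_wprotect_TSum uapp_wconfine_TSum del: vrel.simps(5))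
    next
      case 2
      then show ?thesis
        using TSum.IH(2)[OF 2(3)] r
        by (simp add: uapp_wprotect_TSum uapp_wconfine_TSum del: vrel.simps(5))
    qed
  qed
  then show "sim d (vrel \<tau> d) k (ret v) (uapp (wprotect \<tau> \<rho>) w)"
    and "sim d (vrel \<tau> d) k (ret v) (uapp (wconfine \<tau> \<rho>) w)" by auto
qed

section \<open>Reflection of equivalence\<close>

definition swap_ren :: "nat \<Rightarrow> nat" where
  "swap_ren i = (case i of 0 \<Rightarrow> 1 | Suc 0 \<Rightarrow> 0 | Suc (Suc j) \<Rightarrow> j + 3)"

definition modcomp_body :: "ty \<Rightarrow> ty \<Rightarrow> stm \<Rightarrow> utm" where
  "modcomp_body \<sigma>' \<sigma> t =
     UApp (ULam (uren swap_ren (erase t))) (UApp (confine (TFun \<sigma>' \<sigma>)) (UVar 1))"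

lemma modcomp_eq:
  "modcomp \<sigma>' \<sigma> \<rho>' \<rho>r t = UApp (protect (TFun \<rho>' \<rho>r)) (ULam (modcomp_body \<sigma>' \<sigma> t))"
  by (simp only: modcomp_def modcomp_body_def swap_ren_def[abs_def])

lemma uev_modcomp:
  "uev \<rho> (modcomp \<sigma>' \<sigma> \<rho>' \<rho>r t) =
     uapp (wprotect (TFun \<rho>' \<rho>r) \<rho>) (WClos \<rho> (modcomp_body \<sigma>' \<sigma> t))"
  by (simp add: modcomp_eq)

lemma uev_modcomp_body:
  "uev (case_nat w \<rho>) (modcomp_body \<sigma>' \<sigma> t) =
     bind (uapp (wconfine (TFun \<sigma>' \<sigma>) (case_nat w \<rho>)) (\<rho> 0))
       (\<lambda>z. tick (uev (case_nat z (case_nat w \<rho>)) (uren swap_ren (erase t))))"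
  by (simp add: modcomp_body_def)

text \<open>The source computation c that supplies the free variable is left open. It is a plain
  lookup when source contexts are erased, and an extraction from \<open>uvt l\<close> in the
  back-translation.\<close>

lemma sim_modcomp_body:
  assumes t: "has_type [\<rho>', TFun \<sigma>' \<sigma>] t \<rho>r"
    and "sim d (vrel (TFun \<sigma>' \<sigma>) d) k c (uapp (wconfine (TFun \<sigma>' \<sigma>) (case_nat w \<rho>u)) (\<rho>u 0))"
    and "vrel \<rho>' d k v w"
  shows "sim d (vrel \<rho>r d) k (bind c (\<lambda>z. sev (case_nat v (case_nat z \<rho>s)) t))
    (uev (case_nat w \<rho>u) (modcomp_body \<sigma>' \<sigma> t))"
  unfolding uev_modcomp_body
proof (rule sim_bind[OF assms(2)], rule sim_tick_right[OF antimono_vrel])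
  fix j z z' assume "j \<le> k" "vrel (TFun \<sigma>' \<sigma>) d j z z'"
  moreover have "vrel \<rho>' d j v w" using assms(3) \<open>j \<le> k\<close> vrel_antimono by blast
  \<comment> \<open>The source binds w above z, the compiled body z above w; \<open>swap_ren\<close>
    mediates between the two environments.\<close>
  ultimately have "envrel d j [\<rho>', TFun \<sigma>' \<sigma>] swap_ren (case_nat v (case_nat z \<rho>s))
      (case_nat z' (case_nat w \<rho>u))"
    by (auto simp: envrel_def swap_ren_def less_Suc_eq split: nat.splits)
  then show "sim d (vrel \<rho>r d) j (sev (case_nat v (case_nat z \<rho>s)) t)
      (uev (case_nat z' (case_nat w \<rho>u)) (uren swap_ren (erase t)))"
    using logrel_erase[OF t] by (auto simp: logrel_def)
qed

lemma logrel_modcomp: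
  assumes t: "has_type [\<rho>', TFun \<sigma>' \<sigma>] t \<rho>r"
  shows "logrel [TFun \<sigma>' \<sigma>] id (SLam \<rho>' t) (modcomp \<sigma>' \<sigma> \<rho>' \<rho>r t) (TFun \<rho>' \<rho>r)"
  unfolding logrel_def uev_modcomp sev_SLam
proof (intro allI impI sim_wrappers(1))
  fix d k \<rho> \<rho>u assume env: "envrel d k [TFun \<sigma>' \<sigma>] id \<rho> \<rho>u"
  have "sim d (vrel \<rho>r d) j (sev (case_nat x \<rho>) t) (uev (case_nat y \<rho>u) (modcomp_body \<sigma>' \<sigma> t))"
    if j: "j < k" and xy: "vrel \<rho>' d j x y" for j x y
  proof -
    have z: "vrel (TFun \<sigma>' \<sigma>) d j (\<rho> 0) (\<rho>u 0)"
      using envrel_antimono[OF env, of j] j by (simp add: envrel_def)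
    have "case_nat (\<rho> 0) (\<rho> \<circ> Suc) = \<rho>" by (auto simp: fun_eq_iff split: nat.splits)
    then show ?thesis
      using sim_modcomp_body[OF t _ xy, where \<rho>s = "\<rho> \<circ> Suc" and \<rho>u = \<rho>u, OF sim_wrappers(2)[OF z]]
      by simp
  qed
  then show "vrel (TFun \<rho>' \<rho>r) d k (VClos \<rho>' \<rho> t) (WClos \<rho>u (modcomp_body \<sigma>' \<sigma> t))"
    by (auto simp: funrel_def)
qed

section \<open>Erasure of program contexts, and scoping\<close>

primrec erase_ctx :: "sctx \<Rightarrow> uctx" where
  "erase_ctx SCHole = UCHole"
| "erase_ctx (SCLam \<tau> C) = UCLam (erase_ctx C)"
| "erase_ctx (SCApp1 C u) = UCApp1 (erase_ctx C) (erase u)"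
| "erase_ctx (SCApp2 u C) = UCApp2 (erase u) (erase_ctx C)"
| "erase_ctx (SCFst C) = UCFst (erase_ctx C)"
| "erase_ctx (SCSnd C) = UCSnd (erase_ctx C)"
| "erase_ctx (SCPair1 C u) = UCPair1 (erase_ctx C) (erase u)"
| "erase_ctx (SCPair2 u C) = UCPair2 (erase u) (erase_ctx C)"
| "erase_ctx (SCInl C) = UCInl (erase_ctx C)"
| "erase_ctx (SCInr C) = UCInr (erase_ctx C)"
| "erase_ctx (SCCase0 C u1 u2) = UCCase0 (erase_ctx C) (erase u1) (erase u2)"
| "erase_ctx (SCCase1 u C u2) = UCCase1 (erase u) (erase_ctx C) (erase u2)"
| "erase_ctx (SCCase2 u u1 C) = UCCase2 (erase u) (erase u1) (erase_ctx C)"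
| "erase_ctx (SCSeq1 C u) = UCSeq1 (erase_ctx C) (erase u)"
| "erase_ctx (SCSeq2 u C) = UCSeq2 (erase u) (erase_ctx C)"
| "erase_ctx (SCIf0 C u1 u2) = UCIf0 (erase_ctx C) (erase u1) (erase u2)"
| "erase_ctx (SCIf1 u C u2) = UCIf1 (erase u) (erase_ctx C) (erase u2)"
| "erase_ctx (SCIf2 u u1 C) = UCIf2 (erase u) (erase u1) (erase_ctx C)"
| "erase_ctx (SCFix \<tau>1 \<tau>2 C) = UCApp2 ufix (erase_ctx C)"

text \<open>Any related pair may fill the hole, since the term plugged into the erased context is
  the compiled term and not the erasure of the source term.\<close>

lemma logrel_plug:
  "sctx_type C \<Delta> \<delta> \<Gamma> \<tau> \<Longrightarrow> logrel \<Delta> id s u \<delta> \<Longrightarrow>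
   logrel \<Gamma> id (splug C s) (uplug (erase_ctx C) u) \<tau>"
  by (induction rule: sctx_type.induct)
    (auto intro!: logrel_intros intro: logrel_erase_id[unfolded id_def] simp: up_ren_id[unfolded id_def] id_def)

lemma has_type_plug: "sctx_type C \<Delta> \<delta> \<Gamma> \<tau> \<Longrightarrow> has_type \<Delta> t \<delta> \<Longrightarrow> has_type \<Gamma> (splug C t) \<tau>"
  by (induction rule: sctx_type.induct) (auto intro: has_type.intros)

lemma uscoped_plug: "uctx_scoped C m n \<Longrightarrow> uscoped m t \<Longrightarrow> uscoped n (uplug C t)"
  by (induction rule: uctx_scoped.induct) (auto simp: uscoped_def)

lemma ufv_ufix: "ufv ufix = {}"
  by (auto simp: ufix_def Let_def)

lemma uscoped_erase: "has_type \<Gamma> t \<tau> \<Longrightarrow> uscoped (length \<Gamma>) (erase t)"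
  by (induction rule: has_type.induct) (auto simp: uscoped_def ufv_ufix)

lemma uctx_scoped_erase:
  "sctx_type C \<Delta> \<delta> \<Gamma> \<tau> \<Longrightarrow> uctx_scoped (erase_ctx C) (length \<Delta>) (length \<Gamma>)"
  by (induction rule: sctx_type.induct)
    (auto intro!: uctx_scoped.intros dest: uscoped_erase simp: ufv_ufix, simp add: uscoped_def ufv_ufix)

lemma ufv_uren: "ufv (uren r t) = r ` ufv t"
proof (induction t arbitrary: r)
  have *: "{i. Suc i \<in> up_ren r ` A} = r ` {i. Suc i \<in> A}" for r and A :: "nat set"
  proof -
    have "Suc i \<in> up_ren r ` A \<longleftrightarrow> i \<in> r ` {i. Suc i \<in> A}" for i
    proof
      assume "Suc i \<in> up_ren r ` A"
      then obtain j where "j \<in> A" "Suc i = up_ren r j" by blast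
      then show "i \<in> r ` {i. Suc i \<in> A}" by (cases j) (auto simp: up_ren_def)
    next
      assume "i \<in> r ` {i. Suc i \<in> A}"
      then obtain j where "Suc j \<in> A" "i = r j" by blast
      then show "Suc i \<in> up_ren r ` A" by (intro image_eqI[of _ _ "Suc j"]) (auto simp: up_ren_def)
    qed
    then show ?thesis by blast
  qed
  case (ULam t)
  then show ?case by (simp add: *)
  case (UCase t t1 t2)
  then show ?case by (simp add: * image_Un)
qed (simp_all add: image_Un)

lemma ufv_wrappers: "ufv (protect \<tau>) = {} \<and> ufv (confine \<tau>) = {}"
  by (induction \<tau>) (auto simp: protect.simps confine.simps)

lemma uscoped_modcomp:
  assumes "has_type [\<rho>', TFun \<sigma>' \<sigma>] t \<rho>r"
  shows "uscoped 1 (modcomp \<sigma>' \<sigma> \<rho>' \<rho>r t)"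
proof -
  have "ufv (erase t) \<subseteq> {..<2}" using uscoped_erase[OF assms] by (simp add: uscoped_def numeral_2_eq_2)
  then have "ufv (uren swap_ren (erase t)) \<subseteq> {..<2}"
    by (auto simp: ufv_uren swap_ren_def split: nat.splits)
  then show ?thesis
    by (auto simp: uscoped_def modcomp_eq modcomp_body_def ufv_wrappers)
qed

text \<open>A run of cost j is below the index j + 1, so one direction of the simulation at that
  index yields each implication.\<close>

lemma sim_terminates:
  assumes "\<And>d k. sim d (P d) k c c'"
  shows "(\<exists>j v. c j v) \<longleftrightarrow> (\<exists>j w. c' j w)"
proof
  assume "\<exists>j v. c j v"
  then obtain j v where "c j v" by blast
  then show "\<exists>j w. c' j w" using assms[of Fwd "Suc j"] by (fastforce simp: sim_def)
next
  assume "\<exists>j w. c' j w"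
  then obtain j v where "c' j v" by blast
  then show "\<exists>j w. c j w" using assms[of Bwd "Suc j"] by (fastforce simp: sim_def)
qed

lemma terminates_erase_ctx:
  assumes C: "sctx_type C [TFun \<sigma>' \<sigma>] (TFun \<rho>' \<rho>r) [] \<tau>"
    and t: "has_type [\<rho>', TFun \<sigma>' \<sigma>] t \<rho>r"
  shows "sterminates (splug C (SLam \<rho>' t)) \<longleftrightarrow>
    uterminates (uplug (erase_ctx C) (modcomp \<sigma>' \<sigma> \<rho>' \<rho>r t))"
proof -
  let ?u = "uplug (erase_ctx C) (modcomp \<sigma>' \<sigma> \<rho>' \<rho>r t)"
  have s: "has_type [] (splug C (SLam \<rho>' t)) \<tau>"
    using has_type_plug[OF C T_Lam[OF t]] .
  have u: "uscoped 0 ?u"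
    using uscoped_plug[OF uctx_scoped_erase[OF C]] uscoped_modcomp[OF t] by simp
  have "sim d (vrel \<tau> d) k (sev \<rho> (splug C (SLam \<rho>' t))) (uev \<rho>u ?u)" for d k \<rho> \<rho>u
    using logrel_plug[OF C logrel_modcomp[OF t]] by (simp add: logrel_def envrel_def)
  then show ?thesis
    unfolding sterminates_iff[OF s, of "\<lambda>_. VUnit"] uterminates_iff[OF u, of "\<lambda>_. WUnit"]
    by (rule sim_terminates)
qed

lemma sctx_equiv_if_uctx_equiv:
  assumes "has_type [\<rho>', TFun \<sigma>' \<sigma>] t1 \<rho>r" "has_type [\<rho>', TFun \<sigma>' \<sigma>] t2 \<rho>r"
    and "uctx_equiv 1 (modcomp \<sigma>' \<sigma> \<rho>' \<rho>r t1) (modcomp \<sigma>' \<sigma> \<rho>' \<rho>r t2)"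
  shows "sctx_equiv [TFun \<sigma>' \<sigma>] (SLam \<rho>' t1) (SLam \<rho>' t2) (TFun \<rho>' \<rho>r)"
  unfolding sctx_equiv_def
proof (intro allI impI)
  fix \<tau> C assume C: "sctx_type C [TFun \<sigma>' \<sigma>] (TFun \<rho>' \<rho>r) [] \<tau>"
  have "uctx_scoped (erase_ctx C) 1 0" using uctx_scoped_erase[OF C] by simp
  then show "sterminates (splug C (SLam \<rho>' t1)) \<longleftrightarrow> sterminates (splug C (SLam \<rho>' t2))"
    using assms(3) terminates_erase_ctx[OF C assms(1)] terminates_erase_ctx[OF C assms(2)]
    by (simp add: uctx_equiv_def)
qed

section \<open>Finite approximations of the universal type\<close>

primrec uvt :: "nat \<Rightarrow> ty" where
  "uvt 0 = TUnit"
| "uvt (Suc n) = TSum TUnit (TSum TUnit (TSum TBool (TSum (TProd (uvt n) (uvt n))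
     (TSum (TSum (uvt n) (uvt n)) (TFun (uvt n) (uvt n))))))"

(* The summands of uvt (Suc n): an unknown value, unit, booleans, pairs, sums and functions. *)
abbreviation "s_unk \<equiv> SInl SUnit"
abbreviation "s_unit t \<equiv> SInr (SInl t)"
abbreviation "s_bool t \<equiv> SInr (SInr (SInl t))"
abbreviation "s_pair t \<equiv> SInr (SInr (SInr (SInl t)))"
abbreviation "s_sum t \<equiv> SInr (SInr (SInr (SInr (SInl t))))"
abbreviation "s_fun t \<equiv> SInr (SInr (SInr (SInr (SInr t))))"

abbreviation "v_unk \<equiv> VInl VUnit"
abbreviation "v_unit v \<equiv> VInr (VInl v)"
abbreviation "v_bool v \<equiv> VInr (VInr (VInl v))"
abbreviation "v_pair v \<equiv> VInr (VInr (VInr (VInl v)))"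
abbreviation "v_sum v \<equiv> VInr (VInr (VInr (VInr (VInl v))))"
abbreviation "v_fun v \<equiv> VInr (VInr (VInr (VInr (VInr v))))"

text \<open>Each rejected alternative binds the rest of the sum, so \<open>SVar 0\<close> always
  denotes what remains to be analysed, and the payload of the selected summand is at index 0. The
  ticks of the chain have no counterpart in the target.\<close>

definition ucases :: "stm \<Rightarrow> stm \<Rightarrow> stm \<Rightarrow> stm \<Rightarrow> stm \<Rightarrow> stm \<Rightarrow> stm" where
  "ucases t0 t1 t2 t3 t4 t5 = SCase (SVar 0) t0 (SCase (SVar 0) t1 (SCase (SVar 0) t2
     (SCase (SVar 0) t3 (SCase (SVar 0) t4 t5))))"

lemma T_Var0: "has_type (\<tau> # \<Gamma>) (SVar 0) \<tau>"
  using T_Var[of 0 "\<tau> # \<Gamma>"] by simp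

lemma T_Var1: "has_type (\<tau>' # \<tau> # \<Gamma>) (SVar (Suc 0)) \<tau>"
  using T_Var[of 1 "\<tau>' # \<tau> # \<Gamma>"] by simp

lemma T_Var2: "has_type (\<tau>'' # \<tau>' # \<tau> # \<Gamma>) (SVar (Suc (Suc 0))) \<tau>"
  using T_Var[of 2 "\<tau>'' # \<tau>' # \<tau> # \<Gamma>"] by (simp add: numeral_2_eq_2)

lemmas typing = T_Unit T_True T_False T_Lam T_Var0 T_Var1 T_Var2 T_App T_Fst T_Snd T_Pair T_Inl
  T_Inr T_Case T_Seq T_If T_Fix

lemma has_type_ucases:
  assumes "\<And>\<Gamma>. has_type (TUnit # \<Gamma>) t0 \<tau>" "\<And>\<Gamma>. has_type (TUnit # \<Gamma>) t1 \<tau>"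
    "\<And>\<Gamma>. has_type (TBool # \<Gamma>) t2 \<tau>" "\<And>\<Gamma>. has_type (TProd (uvt n) (uvt n) # \<Gamma>) t3 \<tau>"
    "\<And>\<Gamma>. has_type (TSum (uvt n) (uvt n) # \<Gamma>) t4 \<tau>"
    "\<And>\<Gamma>. has_type (TFun (uvt n) (uvt n) # \<Gamma>) t5 \<tau>"
  shows "has_type (uvt (Suc n) # \<Gamma>) (ucases t0 t1 t2 t3 t4 t5) \<tau>"
  unfolding ucases_def uvt.simps by (rule T_Case T_Var0 assms)+

definition diverge :: "ty \<Rightarrow> stm" where
  "diverge \<tau> = SApp (SFix TUnit \<tau> (SLam (TFun TUnit \<tau>) (SVar 0))) SUnit"

lemma has_type_diverge: "has_type \<Gamma> (diverge \<tau>) \<tau>"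
  unfolding diverge_def by (rule typing)+

lemma sev_diverge [simp]: "sev \<rho> (diverge \<tau>) = fail"
proof -
  let ?g = "vfix TUnit \<tau> (VClos (TFun TUnit \<tau>) \<rho> (SVar 0))"
  \<comment> \<open>One turn of the loop enters the closure and applies the identity to it, hence
    the two ticks.\<close>
  have "sapp ?g VUnit = tick (tick (sapp ?g VUnit))"
    by (subst vfix_def) simp
  then have "sapp ?g VUnit = fail" by (rule tick_loop_eq_fail)
  then show ?thesis by (simp add: diverge_def)
qed

text \<open>Where \<open>urel\<close> says nothing about the target value, as at index 0 or for an
  unknown value, casts must still return. This is the shape of the source value that they rely on;
  functions are unconstrained since a cast wraps them without calling them.\<close>

primrec wfu :: "nat \<Rightarrow> sval \<Rightarrow> bool" where
  "wfu 0 v \<longleftrightarrow> v = VUnit"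
| "wfu (Suc n) v \<longleftrightarrow> v = v_unk \<or> v = v_unit VUnit \<or> v = v_bool VTrue \<or> v = v_bool VFalse \<or>
     (\<exists>a b. v = v_pair (VPair a b) \<and> wfu n a \<and> wfu n b) \<or>
     (\<exists>a. v = v_sum (VInl a) \<and> wfu n a) \<or> (\<exists>a. v = v_sum (VInr a) \<and> wfu n a) \<or>
     (\<exists>f. v = v_fun f)"

text \<open>Agreement of outermost constructors, with components left to P and functions to F. Being
  parametric, it allows antimonotonicity and casts to be handled by monotonicity or by cases on the
  shape.\<close>

inductive ushape :: "(sval \<Rightarrow> uval \<Rightarrow> bool) \<Rightarrow> (sval \<Rightarrow> uval \<Rightarrow> bool) \<Rightarrow> sval \<Rightarrow> uval \<Rightarrow> bool"
  for P F where
  "ushape P F (v_unit VUnit) WUnit"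
| "ushape P F (v_bool VTrue) WTrue"
| "ushape P F (v_bool VFalse) WFalse"
| "P a a' \<Longrightarrow> P b b' \<Longrightarrow> ushape P F (v_pair (VPair a b)) (WPair a' b')"
| "P a a' \<Longrightarrow> ushape P F (v_sum (VInl a)) (WInl a')"
| "P a a' \<Longrightarrow> ushape P F (v_sum (VInr a)) (WInr a')"
| "F f g \<Longrightarrow> ushape P F (v_fun f) g"

lemma ushape_mono:
  "ushape P F v w \<Longrightarrow> (\<And>a b. P a b \<Longrightarrow> P' a b) \<Longrightarrow> (\<And>a b. F a b \<Longrightarrow> F' a b) \<Longrightarrow> ushape P' F' v w"
  by (induction rule: ushape.induct) (auto intro: ushape.intros)

definition within :: "dir \<Rightarrow> nat \<Rightarrow> nat \<Rightarrow> bool" where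
  "within d n k \<longleftrightarrow> d = Fwd \<or> k \<le> n"

lemma within_mono: "within d n k \<Longrightarrow> j \<le> k \<Longrightarrow> within d n j"
  by (auto simp: within_def)

lemma within_SucD: "within d (Suc n) k \<Longrightarrow> j < k \<Longrightarrow> within d n j"
  by (auto simp: within_def)

lemma within_SucI: "within d n k \<Longrightarrow> within d (Suc n) k"
  by (auto simp: within_def)

(* A source value of type uvt n represents a target value. For Fwd the source may know less than the
   target (v_unk); for Bwd it must be precise, which is possible only up to k \<le> n steps. *)
primrec urel :: "nat \<Rightarrow> dir \<Rightarrow> nat \<Rightarrow> sval \<Rightarrow> uval \<Rightarrow> bool" where
  "urel 0 = (\<lambda>d k v w. v = VUnit \<and> within d 0 k)"
| "urel (Suc n) = (\<lambda>d k v w. wfu (Suc n) v \<and> within d (Suc n) k \<and>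
     (k = 0 \<or> v = v_unk \<and> d = Fwd \<or>
      ushape (urel n d (k - 1)) (funrel d (uvt n) (urel n d) (urel n d) k) v w))"

lemma urel_wfu: "urel n d k v w \<Longrightarrow> wfu n v"
  by (cases n) auto

lemma urel_within: "urel n d k v w \<Longrightarrow> within d n k"
  by (cases n) auto

lemma antimono_urel: "antimono_rel (urel n d)"
proof (induction n)
  case 0
  then show ?case by (auto simp: antimono_rel_def within_def)
next
  case (Suc n)
  have "urel (Suc n) d j v w" if kv: "urel (Suc n) d k v w" and j: "j \<le> k" for j k v w
  proof -
    have "ushape (urel n d (j - 1)) (funrel d (uvt n) (urel n d) (urel n d) j) v w"
      if "ushape (urel n d (k - 1)) (funrel d (uvt n) (urel n d) (urel n d) k) v w"
      using that
    proof (rule ushape_mono)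
      show "urel n d (j - 1) a b" if "urel n d (k - 1) a b" for a b
        using antimono_relD[OF Suc that] j by simp
      show "funrel d (uvt n) (urel n d) (urel n d) j a b"
        if "funrel d (uvt n) (urel n d) (urel n d) k a b" for a b
        using antimono_relD[OF antimono_funrel that j] .
    qed
    then show ?thesis using kv j within_mono by auto
  qed
  then show ?case by (auto simp: antimono_rel_def simp del: urel.simps)
qed

lemmas urel_antimono = antimono_relD[OF antimono_urel]

lemma urel_Suc_cases:
  assumes "urel (Suc n) d k v w"
  obtains "k = 0" | "0 < k" "v = v_unk" "d = Fwd"
  | "0 < k" "ushape (urel n d (k - 1)) (funrel d (uvt n) (urel n d) (urel n d) k) v w"
  using assms by auto

section \<open>Destructors of the summands, diverging on every other summand\<close>

definition dest_unit :: "nat \<Rightarrow> stm" where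
  "dest_unit n = (let z = diverge TUnit in ucases z (SVar 0) z z z z)"
definition dest_bool :: "nat \<Rightarrow> stm" where
  "dest_bool n = (let z = diverge TBool in ucases z z (SVar 0) z z z)"
definition dest_pair :: "nat \<Rightarrow> stm" where
  "dest_pair n = (let z = diverge (TProd (uvt n) (uvt n)) in ucases z z z (SVar 0) z z)"
definition dest_sum :: "nat \<Rightarrow> stm" where
  "dest_sum n = (let z = diverge (TSum (uvt n) (uvt n)) in ucases z z z z (SVar 0) z)"
definition dest_fun :: "nat \<Rightarrow> stm" where
  "dest_fun n = (let z = diverge (TFun (uvt n) (uvt n)) in ucases z z z z z (SVar 0))"

lemmas dest_defs = dest_unit_def dest_bool_def dest_pair_def dest_sum_def dest_fun_def

abbreviation (input) "ulam n t \<equiv> SLam (uvt (Suc n)) t"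
abbreviation (input) "vlam n \<rho> t \<equiv> VClos (uvt (Suc n)) \<rho> t"

lemma has_type_dest:
  "has_type \<Gamma> (ulam n (dest_unit n)) (TFun (uvt (Suc n)) TUnit)"
  "has_type \<Gamma> (ulam n (dest_bool n)) (TFun (uvt (Suc n)) TBool)"
  "has_type \<Gamma> (ulam n (dest_pair n)) (TFun (uvt (Suc n)) (TProd (uvt n) (uvt n)))"
  "has_type \<Gamma> (ulam n (dest_sum n)) (TFun (uvt (Suc n)) (TSum (uvt n) (uvt n)))"
  "has_type \<Gamma> (ulam n (dest_fun n)) (TFun (uvt (Suc n)) (TFun (uvt n) (uvt n)))"
  unfolding dest_defs Let_def
  by (rule T_Lam has_type_ucases has_type_diverge T_Var0)+

text \<open>If the shapes agree, the selection costs only source ticks, and a wrong summand has no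
  outcome on either side. An unknown value makes the source diverge, which is harmless because it
  occurs only for \<open>Fwd\<close>.\<close>

lemma sim_dest_unit:
  assumes "urel (Suc n) d k v w" "antimono_rel Q" "sim d Q k c c'"
  shows "sim d Q k (bind (sapp (vlam n \<rho> (dest_unit n)) v) (\<lambda>v. case v of VUnit \<Rightarrow> c | _ \<Rightarrow> fail))
    (case w of WUnit \<Rightarrow> c' | _ \<Rightarrow> fail)"
  using assms(1)
proof (cases rule: urel_Suc_cases)
  case 3
  from 3(2) show ?thesis
    using assms(2,3) by cases (auto simp: dest_defs Let_def ucases_def funrel_def intro!: sim_tick_left)
qed (auto simp: dest_defs Let_def ucases_def)

lemma sim_dest_bool:
  assumes "urel (Suc n) d k v w" "antimono_rel Q" "sim d Q k c1 c1'" "sim d Q k c2 c2'"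
  shows "sim d Q k (bind (sapp (vlam n \<rho> (dest_bool n)) v)
      (\<lambda>v. case v of VTrue \<Rightarrow> c1 | VFalse \<Rightarrow> c2 | _ \<Rightarrow> fail))
    (case w of WTrue \<Rightarrow> c1' | WFalse \<Rightarrow> c2' | _ \<Rightarrow> fail)"
  using assms(1)
proof (cases rule: urel_Suc_cases)
  case 3
  from 3(2) show ?thesis
    using assms(2-) by cases (auto simp: dest_defs Let_def ucases_def funrel_def intro!: sim_tick_left)
qed (auto simp: dest_defs Let_def ucases_def)

lemma sim_dest_pair:
  assumes "urel (Suc n) d k v w"
  shows "sim d (urel n d) k (bind (sapp (vlam n \<rho> (dest_pair n)) v)
      (\<lambda>v. case v of VPair a b \<Rightarrow> tick (ret a) | _ \<Rightarrow> fail))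
    (case w of WPair a b \<Rightarrow> tick (ret a) | _ \<Rightarrow> fail)"
  and "sim d (urel n d) k (bind (sapp (vlam n \<rho> (dest_pair n)) v)
      (\<lambda>v. case v of VPair a b \<Rightarrow> tick (ret b) | _ \<Rightarrow> fail))
    (case w of WPair a b \<Rightarrow> tick (ret b) | _ \<Rightarrow> fail)"
  using assms
  by (atomize (full), cases rule: urel_Suc_cases)
    (auto simp: dest_defs Let_def ucases_def funrel_def elim!: ushape.cases
      intro!: sim_tick_left antimono_urel sim_tick sim_ret)

lemma sim_dest_sum:
  assumes "urel (Suc n) d k v w" "antimono_rel Q"
    "\<And>j x y. j < k \<Longrightarrow> urel n d j x y \<Longrightarrow> sim d Q j (f1 x) (g1 y)"
    "\<And>j x y. j < k \<Longrightarrow> urel n d j x y \<Longrightarrow> sim d Q j (f2 x) (g2 y)"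
  shows "sim d Q k (bind (sapp (vlam n \<rho> (dest_sum n)) v)
      (\<lambda>v. case v of VInl a \<Rightarrow> tick (f1 a) | VInr a \<Rightarrow> tick (f2 a) | _ \<Rightarrow> fail))
    (case w of WInl a \<Rightarrow> tick (g1 a) | WInr a \<Rightarrow> tick (g2 a) | _ \<Rightarrow> fail)"
  using assms(1)
proof (cases rule: urel_Suc_cases)
  case 3
  from 3(2) show ?thesis
    using assms(2-) 3(1)
    by cases (auto simp: dest_defs Let_def ucases_def funrel_def intro!: sim_tick_left sim_tick)
qed (auto simp: dest_defs Let_def ucases_def)

text \<open>The source tests for a function before it computes the argument, whereas the target
  notices a non-function only at the call. Continuation and target computation are therefore
  arbitrary, and the last premise says that the target cannot succeed when w is not a
  closure.\<close>

lemma sim_dest_fun: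
  assumes "urel (Suc n) d k v w" "antimono_rel Q"
    "\<And>f. funrel d (uvt n) (urel n d) (urel n d) k f w \<Longrightarrow> sim d Q k (F f) c"
    "uapp w = (\<lambda>_. fail) \<Longrightarrow> c = fail"
  shows "sim d Q k (bind (sapp (vlam n \<rho> (dest_fun n)) v) F) c"
  using assms(1)
proof (cases rule: urel_Suc_cases)
  case 3
  have "c = fail" if "\<nexists>\<rho> b. w = WClos \<rho> b"
    using that assms(4) by (cases w) (auto simp: uapp_def[abs_def])
  from 3(2) this show ?thesis
    using assms(2,3) by cases (auto simp: dest_defs Let_def ucases_def intro!: sim_tick_left)
qed (auto simp: dest_defs Let_def ucases_def)

section \<open>Casts between levels\<close>

definition returns :: "'a comp \<Rightarrow> 'a \<Rightarrow> bool" where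
  "returns c v \<longleftrightarrow> (\<exists>j. c = (tick ^^ j) (ret v))"

lemma returns_ret: "returns (ret v) v"
  unfolding returns_def by (rule exI[of _ 0]) simp

lemma returns_tick: "returns c v \<Longrightarrow> returns (tick c) v"
  unfolding returns_def by (metis comp_apply funpow.simps(2))

lemma returns_bind: "returns c a \<Longrightarrow> returns (f a) v \<Longrightarrow> returns (bind c f) v"
  unfolding returns_def by (metis bind_funpow_tick bind_ret comp_apply funpow_add)

lemma sim_returns:
  assumes "returns c v" "antimono_rel P" "sim d P k (f v) c'"
  shows "sim d P k (bind c f) c'"
  using assms by (auto simp: returns_def intro: sim_funpow_tick_left)

text \<open>A context may use a variable at several levels, so values have to change level. Going
  down to 0 forgets everything, going up from 0 yields the unknown value. Functions are cast
  contravariantly, swapping the levels, so termination is measured by their sum.\<close>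

function castb :: "nat \<Rightarrow> nat \<Rightarrow> stm" where
  "castb m 0 = SUnit"
| "castb 0 (Suc n) = s_unk"
| "castb (Suc m) (Suc n) = ucases s_unk (s_unit (SVar 0)) (s_bool (SVar 0))
     (s_pair (SPair (SApp (SLam (uvt m) (castb m n)) (SFst (SVar 0)))
        (SApp (SLam (uvt m) (castb m n)) (SSnd (SVar 0)))))
     (s_sum (SCase (SVar 0) (SInl (SApp (SLam (uvt m) (castb m n)) (SVar 0)))
        (SInr (SApp (SLam (uvt m) (castb m n)) (SVar 0)))))
     (s_fun (SLam (uvt n) (SApp (SLam (uvt m) (castb m n))
        (SApp (SVar 1) (SApp (SLam (uvt n) (castb n m)) (SVar 0))))))"
  by pat_completeness auto
termination by (relation "measure (\<lambda>(m, n). m + n)") auto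

lemma has_type_castb: "has_type (uvt m # \<Gamma>) (castb m n) (uvt n)"
proof (induction m n arbitrary: \<Gamma> rule: castb.induct)
  case (3 m n)
  show ?case
    unfolding castb.simps One_nat_def
    by (rule has_type_ucases; unfold uvt.simps; (rule typing 3)+)
qed (auto intro: typing)

definition cast :: "nat \<Rightarrow> nat \<Rightarrow> stm" where
  "cast m n = SLam (uvt m) (castb m n)"

lemma has_type_cast: "has_type \<Gamma> (cast m n) (TFun (uvt m) (uvt n))"
  unfolding cast_def by (intro T_Lam has_type_castb)

definition vcast :: "nat \<Rightarrow> nat \<Rightarrow> (nat \<Rightarrow> sval) \<Rightarrow> sval" where
  "vcast m n \<rho> = VClos (uvt m) \<rho> (castb m n)"

lemma sev_cast [simp]: "sev \<rho> (cast m n) = ret (vcast m n \<rho>)"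
  by (simp add: cast_def vcast_def)

lemma castb_Suc: "castb (Suc m) (Suc n) = ucases s_unk (s_unit (SVar 0)) (s_bool (SVar 0))
     (s_pair (SPair (SApp (cast m n) (SFst (SVar 0))) (SApp (cast m n) (SSnd (SVar 0)))))
     (s_sum (SCase (SVar 0) (SInl (SApp (cast m n) (SVar 0))) (SInr (SApp (cast m n) (SVar 0)))))
     (s_fun (SLam (uvt n) (SApp (cast m n) (SApp (SVar 1) (SApp (cast n m) (SVar 0))))))"
  by (simp add: cast_def)

lemma sapp_vcast: "sapp (vcast m n \<rho>) = (\<lambda>v. tick (sev (case_nat v \<rho>) (castb m n)))"
  by (simp add: vcast_def)

lemma sev_ucases:
  "\<exists>\<rho>'. sev (case_nat (v_pair x) \<rho>) (ucases t0 t1 t2 t3 t4 t5) =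
     tick (tick (tick (tick (sev (case_nat x \<rho>') t3))))"
  "\<exists>\<rho>'. sev (case_nat (v_sum x) \<rho>) (ucases t0 t1 t2 t3 t4 t5) =
     tick (tick (tick (tick (tick (sev (case_nat x \<rho>') t4)))))"
  "\<exists>\<rho>'. sev (case_nat (v_fun x) \<rho>) (ucases t0 t1 t2 t3 t4 t5) =
     tick (tick (tick (tick (tick (sev (case_nat x \<rho>') t5)))))"
  by (auto simp: ucases_def)

text \<open>A cast is total, and its result depends on the source value alone; hence one v' serves
  all directions, indices and target values. A low target level loses precision, which is accounted
  for by asking \<open>within d n k'\<close> of the new index.\<close>

lemma vcast_returns:
  "wfu m v \<Longrightarrow> \<exists>v'. returns (sapp (vcast m n \<rho>) v) v' \<and> wfu n v' \<and>
     (\<forall>d k w k'. urel m d k v w \<longrightarrow> k' \<le> k \<longrightarrow> within d n k' \<longrightarrow> urel n d k' v' w)"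
proof (induction m n arbitrary: v \<rho> rule: castb.induct)
  case (1 m)
  then show ?case
    by (intro exI[of _ VUnit]) (auto simp: sapp_vcast intro: returns_tick returns_ret)
next
  case (2 n)
  then show ?case
    by (intro exI[of _ v_unk]) (auto simp: sapp_vcast within_def intro!: returns_tick returns_ret)
next
  case (3 m n)
  \<comment> \<open>The body has five calls at (m, n), with identical hypotheses, and one call at
    (n, m) for function arguments.\<close>
  note IH = 3(1) and IH' = 3(6)
  let ?c = "\<lambda>v v'. returns (sapp (vcast (Suc m) (Suc n) \<rho>) v) v'"
  note ev = sapp_vcast[of "Suc m" "Suc n"] castb_Suc ucases_def
  \<comment> \<open>Index 0 and the unknown value are disposed of once and for all; what remains in
    each case is to carry the shape from one level to the other.\<close>
  have rel: "urel (Suc n) d k' v' w"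
    if "urel (Suc m) d k v w" "k' \<le> k" "within d (Suc n) k'" "wfu (Suc n) v'" "v = v_unk \<Longrightarrow> v' = v_unk"
      "\<And>P F P' F'. 0 < k' \<Longrightarrow> P = urel m d (k - 1) \<Longrightarrow> P' = urel n d (k' - 1) \<Longrightarrow>
        F = funrel d (uvt m) (urel m d) (urel m d) k \<Longrightarrow>
        F' = funrel d (uvt n) (urel n d) (urel n d) k' \<Longrightarrow> within d (Suc m) k \<Longrightarrow>
        ushape P F v w \<Longrightarrow> ushape P' F' v' w" for d k k' w v'
    using that by auto
  from 3(7) consider "v = v_unk" | "v = v_unit VUnit" | "v = v_bool VTrue" | "v = v_bool VFalse"
    | (pair) a b where "v = v_pair (VPair a b)" "wfu m a" "wfu m b"
    | (inl) a where "v = v_sum (VInl a)" "wfu m a" | (inr) a where "v = v_sum (VInr a)" "wfu m a"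
    | (fn) f where "v = v_fun f"
    by auto
  then show ?case
  proof cases
    case 1
    then have "?c v v_unk" by (simp add: ev returns_tick returns_ret)
    then show ?thesis using 1 by (intro exI[of _ v_unk] conjI allI impI rel) (auto elim: ushape.cases)
  next
    case 2
    then have "?c v v" by (simp add: ev returns_tick returns_ret)
    then show ?thesis using 2
      by (intro exI[of _ v] conjI allI impI rel) (auto elim!: ushape.cases intro: ushape.intros)
  next
    case 3
    then have "?c v v" by (simp add: ev returns_tick returns_ret)
    then show ?thesis using 3
      by (intro exI[of _ v] conjI allI impI rel) (auto elim!: ushape.cases intro: ushape.intros)
  next
    case 4
    then have "?c v v" by (simp add: ev returns_tick returns_ret)
    then show ?thesis using 4
      by (intro exI[of _ v] conjI allI impI rel) (auto elim!: ushape.cases intro: ushape.intros)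
  next
    case pair
    obtain \<rho>' where "sapp (vcast (Suc m) (Suc n) \<rho>) v = tick (tick (tick (tick (tick
        (sev (case_nat (VPair a b) \<rho>') (s_pair (SPair (SApp (cast m n) (SFst (SVar 0)))
          (SApp (cast m n) (SSnd (SVar 0))))))))))"
      unfolding pair(1) sapp_vcast castb_Suc using sev_ucases(1) by metis
    then have ev: "sapp (vcast (Suc m) (Suc n) \<rho>) v = tick (tick (tick (tick (tick
        (tick (bind (sapp (vcast m n (case_nat (VPair a b) \<rho>')) a)
          (\<lambda>x. tick (bind (sapp (vcast m n (case_nat (VPair a b) \<rho>')) b)
            (\<lambda>y. ret (v_pair (VPair x y)))))))))))"
      by simp
    let ?c = "sapp (vcast m n (case_nat (VPair a b) \<rho>'))"
    obtain a' where a': "returns (?c a) a'" "wfu n a'"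
      "\<And>d k w k'. urel m d k a w \<Longrightarrow> k' \<le> k \<Longrightarrow> within d n k' \<Longrightarrow> urel n d k' a' w"
      using IH[OF pair(2)] by blast
    obtain b' where b': "returns (?c b) b'" "wfu n b'"
      "\<And>d k w k'. urel m d k b w \<Longrightarrow> k' \<le> k \<Longrightarrow> within d n k' \<Longrightarrow> urel n d k' b' w"
      using IH[OF pair(3)] by blast
    have r: "returns (sapp (vcast (Suc m) (Suc n) \<rho>) v) (v_pair (VPair a' b'))"
      unfolding ev by (intro returns_tick returns_bind[OF a'(1)] returns_bind[OF b'(1)] returns_ret)
    show ?thesis
    proof (intro exI[of _ "v_pair (VPair a' b')"] conjI allI impI rel)
      fix d k k' w P F P' F'
      assume "k' \<le> k" "within d (Suc n) k'" "0 < k'" and sh: "ushape P F v w"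
        "P = urel m d (k - 1)" "P' = urel n d (k' - 1)"
      \<comment> \<open>Level and index drop together on entering a component, so the bound
        persists.\<close>
      then have le: "k' - 1 \<le> k - 1" "within d n (k' - 1)" by (auto simp: within_def)
      from sh show "ushape P' F' (v_pair (VPair a' b')) w"
        using pair(1) a'(3)[OF _ le] b'(3)[OF _ le]
        by (auto elim!: ushape.cases intro!: ushape.intros)
    qed (use r a' b' pair in auto)
  next
    case inl
    obtain \<rho>' where "sapp (vcast (Suc m) (Suc n) \<rho>) v = tick (tick (tick (tick (tick (tick
        (sev (case_nat (VInl a) \<rho>') (s_sum (SCase (SVar 0) (SInl (SApp (cast m n) (SVar 0)))
          (SInr (SApp (cast m n) (SVar 0)))))))))))"
      unfolding inl(1) sapp_vcast castb_Suc using sev_ucases(2) by metis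
    then have ev: "sapp (vcast (Suc m) (Suc n) \<rho>) v = tick (tick (tick (tick (tick (tick (tick
        (bind (sapp (vcast m n (case_nat a (case_nat (VInl a) \<rho>'))) a)
          (\<lambda>x. ret (v_sum (VInl x))))))))))"
      by simp
    obtain a' where a': "returns (sapp (vcast m n (case_nat a (case_nat (VInl a) \<rho>'))) a) a'" "wfu n a'"
      "\<And>d k w k'. urel m d k a w \<Longrightarrow> k' \<le> k \<Longrightarrow> within d n k' \<Longrightarrow> urel n d k' a' w"
      using IH[OF inl(2)] by blast
    have r: "returns (sapp (vcast (Suc m) (Suc n) \<rho>) v) (v_sum (VInl a'))"
      unfolding ev by (intro returns_tick returns_bind[OF a'(1)] returns_ret)
    show ?thesis
    proof (intro exI[of _ "v_sum (VInl a')"] conjI allI impI rel)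
      fix d k k' w P F P' F'
      assume "k' \<le> k" "within d (Suc n) k'" "0 < k'" and sh: "ushape P F v w"
        "P = urel m d (k - 1)" "P' = urel n d (k' - 1)"
      then have le: "k' - 1 \<le> k - 1" "within d n (k' - 1)" by (auto simp: within_def)
      from sh show "ushape P' F' (v_sum (VInl a')) w"
        using inl(1) a'(3)[OF _ le]
        by (auto elim!: ushape.cases intro!: ushape.intros)
    qed (use r a' inl in auto)
  next
    case inr
    obtain \<rho>' where "sapp (vcast (Suc m) (Suc n) \<rho>) v = tick (tick (tick (tick (tick (tick
        (sev (case_nat (VInr a) \<rho>') (s_sum (SCase (SVar 0) (SInl (SApp (cast m n) (SVar 0)))
          (SInr (SApp (cast m n) (SVar 0)))))))))))"
      unfolding inr(1) sapp_vcast castb_Suc using sev_ucases(2) by metis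
    then have ev: "sapp (vcast (Suc m) (Suc n) \<rho>) v = tick (tick (tick (tick (tick (tick (tick
        (bind (sapp (vcast m n (case_nat a (case_nat (VInr a) \<rho>'))) a)
          (\<lambda>x. ret (v_sum (VInr x))))))))))"
      by simp
    obtain a' where a': "returns (sapp (vcast m n (case_nat a (case_nat (VInr a) \<rho>'))) a) a'" "wfu n a'"
      "\<And>d k w k'. urel m d k a w \<Longrightarrow> k' \<le> k \<Longrightarrow> within d n k' \<Longrightarrow> urel n d k' a' w"
      using IH[OF inr(2)] by blast
    have r: "returns (sapp (vcast (Suc m) (Suc n) \<rho>) v) (v_sum (VInr a'))"
      unfolding ev by (intro returns_tick returns_bind[OF a'(1)] returns_ret)
    show ?thesis
    proof (intro exI[of _ "v_sum (VInr a')"] conjI allI impI rel)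
      fix d k k' w P F P' F'
      assume "k' \<le> k" "within d (Suc n) k'" "0 < k'" and sh: "ushape P F v w"
        "P = urel m d (k - 1)" "P' = urel n d (k' - 1)"
      then have le: "k' - 1 \<le> k - 1" "within d n (k' - 1)" by (auto simp: within_def)
      from sh show "ushape P' F' (v_sum (VInr a')) w"
        using inr(1) a'(3)[OF _ le]
        by (auto elim!: ushape.cases intro!: ushape.intros)
    qed (use r a' inr in auto)
  next
    case fn
    let ?b = "SApp (cast m n) (SApp (SVar 1) (SApp (cast n m) (SVar 0)))"
    obtain \<rho>' where "sapp (vcast (Suc m) (Suc n) \<rho>) v =
        tick (tick (tick (tick (tick (tick (sev (case_nat f \<rho>') (s_fun (SLam (uvt n) ?b))))))))"
      unfolding fn(1) sapp_vcast castb_Suc using sev_ucases(3) by metis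
    then have ev: "sapp (vcast (Suc m) (Suc n) \<rho>) v =
        tick (tick (tick (tick (tick (tick (ret (v_fun (VClos (uvt n) (case_nat f \<rho>') ?b))))))))"
      by simp
    have r: "returns (sapp (vcast (Suc m) (Suc n) \<rho>) v) (v_fun (VClos (uvt n) (case_nat f \<rho>') ?b))"
      unfolding ev by (intro returns_tick returns_ret)
    show ?thesis
    proof (intro exI[of _ "v_fun (VClos (uvt n) (case_nat f \<rho>') ?b)"] conjI allI impI rel)
      fix d k k' w P F P' F'
      assume k: "k' \<le> k" "within d (Suc n) k'" "0 < k'" "within d (Suc m) k"
        and "ushape P F v w" and F: "F = funrel d (uvt m) (urel m d) (urel m d) k"
        and F': "F' = funrel d (uvt n) (urel n d) (urel n d) k'"
      then have "funrel d (uvt m) (urel m d) (urel m d) k f w"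
        using fn by (auto elim: ushape.cases)
      then obtain \<rho>1 b \<rho>2 c where fw: "f = VClos (uvt m) \<rho>1 b" "w = WClos \<rho>2 c"
        and *: "\<And>j x y. j < k \<Longrightarrow> urel m d j x y
          \<Longrightarrow> sim d (urel m d) j (sev (case_nat x \<rho>1) b) (uev (case_nat y \<rho>2) c)"
        by (auto simp: funrel_def)
      have "sim d (urel n d) j (sev (case_nat x (case_nat f \<rho>')) ?b) (uev (case_nat y \<rho>2) c)"
        if j: "j < k'" and xy: "urel n d j x y" for j x y
      proof -
        let ?e = "case_nat x (case_nat f \<rho>')"
        obtain x' where x': "returns (sapp (vcast n m ?e) x) x'" "urel m d j x' y"
          \<comment> \<open>The argument may be cast up or down to level m without loss: j < k, and
            k is at most m + 1 when the direction is \<open>Bwd\<close>.\<close>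
          using IH'[OF urel_wfu[OF xy], of ?e] xy within_SucD[OF k(4), of j] j k(1)
          by (meson less_le_trans order_refl)
        have 1: "sim d (urel m d) j (sev (case_nat x' \<rho>1) b) (uev (case_nat y \<rho>2) c)"
          using * j k(1) x'(2) by simp
        have "sim d (urel n d) j (bind (sev (case_nat x' \<rho>1) b) (sapp (vcast m n ?e)))
            (bind (uev (case_nat y \<rho>2) c) ret)"
        proof (rule sim_bind[OF 1])
          fix i z z' assume i: "i \<le> j" and z: "urel m d i z z'"
          have "within d n i" using within_SucD[OF k(2)] i j by simp
          then obtain z1 where z1: "returns (sapp (vcast m n ?e) z) z1" "urel n d i z1 z'"
            using IH[OF urel_wfu[OF z], of ?e] z by blast
          have "sim d (urel n d) i (bind (sapp (vcast m n ?e) z) ret) (ret z')"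
            by (intro sim_returns[OF z1(1)] antimono_urel sim_ret z1(2))
          then show "sim d (urel n d) i (sapp (vcast m n ?e) z) (ret z')" by simp
        qed
        then have "sim d (urel n d) j (bind (sapp (vcast n m ?e) x)
            (\<lambda>x. tick (bind (sev (case_nat x \<rho>1) b) (sapp (vcast m n ?e))))) (uev (case_nat y \<rho>2) c)"
          by (intro sim_returns[OF x'(1)] antimono_urel sim_tick_left) simp
        then show ?thesis by (simp add: fw(1))
      qed
      then show "ushape P' F' (v_fun (VClos (uvt n) (case_nat f \<rho>') ?b)) w"
        unfolding F' fw(2) by (intro ushape.intros) (auto simp: funrel_def)
    qed (use r fn in auto)
  qed
qed

section \<open>Injection into and extraction from the approximations\<close>

text \<open>The clauses follow \<open>protect\<close> and \<open>confine\<close>, including the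
  order of evaluation. In particular \<open>extb\<close> at a function type tests for a function
  only when the result is called, since \<open>confine\<close> does not inspect its argument before
  that. At level 0 divergence is sound for \<open>Fwd\<close>, and for \<open>Bwd\<close> only index
  0 is left.\<close>

fun injb :: "ty \<Rightarrow> nat \<Rightarrow> stm" and extb :: "ty \<Rightarrow> nat \<Rightarrow> stm" where
  "injb \<tau> 0 = diverge TUnit"
| "injb TUnit (Suc n) = s_unit (SVar 0)"
| "injb TBool (Suc n) = s_bool (SVar 0)"
| "injb (TProd \<tau>1 \<tau>2) (Suc n) = s_pair (SPair (SApp (SLam \<tau>1 (injb \<tau>1 n)) (SFst (SVar 0)))
     (SApp (SLam \<tau>2 (injb \<tau>2 n)) (SSnd (SVar 0))))"
| "injb (TSum \<tau>1 \<tau>2) (Suc n) = s_sum (SCase (SVar 0)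
     (SInl (SApp (SLam \<tau>1 (injb \<tau>1 n)) (SVar 0))) (SInr (SApp (SLam \<tau>2 (injb \<tau>2 n)) (SVar 0))))"
| "injb (TFun \<tau>1 \<tau>2) (Suc n) = s_fun (SLam (uvt n) (SApp (SLam \<tau>2 (injb \<tau>2 n))
     (SApp (SVar 1) (SApp (SLam (uvt n) (extb \<tau>1 n)) (SVar 0)))))"
| "extb \<tau> 0 = diverge \<tau>"
| "extb TUnit (Suc n) = SSeq (SApp (ulam n (dest_unit n)) (SVar 0)) SUnit"
| "extb TBool (Suc n) = SIf (SApp (ulam n (dest_bool n)) (SVar 0)) STrue SFalse"
| "extb (TProd \<tau>1 \<tau>2) (Suc n) = SPair
     (SApp (SLam (uvt n) (extb \<tau>1 n)) (SFst (SApp (ulam n (dest_pair n)) (SVar 0))))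
     (SApp (SLam (uvt n) (extb \<tau>2 n)) (SSnd (SApp (ulam n (dest_pair n)) (SVar 0))))"
| "extb (TSum \<tau>1 \<tau>2) (Suc n) = SCase (SApp (ulam n (dest_sum n)) (SVar 0))
     (SInl (SApp (SLam (uvt n) (extb \<tau>1 n)) (SVar 0)))
     (SInr (SApp (SLam (uvt n) (extb \<tau>2 n)) (SVar 0)))"
| "extb (TFun \<tau>1 \<tau>2) (Suc n) = SLam \<tau>1 (SApp (SLam (uvt n) (extb \<tau>2 n))
     (SApp (SApp (ulam n (dest_fun n)) (SVar 1)) (SApp (SLam \<tau>1 (injb \<tau>1 n)) (SVar 0))))"

lemma has_type_inject:
  "has_type \<Gamma> t TUnit \<Longrightarrow> has_type \<Gamma> (s_unit t) (uvt (Suc n))"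
  "has_type \<Gamma> t TBool \<Longrightarrow> has_type \<Gamma> (s_bool t) (uvt (Suc n))"
  "has_type \<Gamma> t (TProd (uvt n) (uvt n)) \<Longrightarrow> has_type \<Gamma> (s_pair t) (uvt (Suc n))"
  "has_type \<Gamma> t (TSum (uvt n) (uvt n)) \<Longrightarrow> has_type \<Gamma> (s_sum t) (uvt (Suc n))"
  "has_type \<Gamma> t (TFun (uvt n) (uvt n)) \<Longrightarrow> has_type \<Gamma> (s_fun t) (uvt (Suc n))"
  by (auto intro!: T_Inl T_Inr)

lemma has_type_injb_extb:
  "has_type (\<tau> # \<Gamma>) (injb \<tau> n) (uvt n)" "has_type (uvt n # \<Gamma>) (extb \<tau> n) \<tau>"
proof -
  have "(\<forall>\<Gamma>. has_type (\<tau> # \<Gamma>) (injb \<tau> n) (uvt n)) \<and> (\<forall>\<Gamma>. has_type (uvt n # \<Gamma>) (extb \<tau> n) \<tau>)"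
  proof (induction \<tau> arbitrary: n)
    case TUnit
    show ?case
      by (cases n; intro conjI allI; simp only: injb.simps extb.simps uvt.simps(1) One_nat_def;
          (rule has_type_dest has_type_diverge has_type_inject typing)+)
  next
    case TBool
    show ?case
      by (cases n; intro conjI allI; simp only: injb.simps extb.simps uvt.simps(1) One_nat_def;
          (rule has_type_dest has_type_diverge has_type_inject typing)+)
  next
    case (TFun \<tau>1 \<tau>2)
    note IH = TFun[THEN conjunct1, rule_format] TFun[THEN conjunct2, rule_format]
    show ?case
      by (cases n; intro conjI allI; simp only: injb.simps extb.simps uvt.simps(1) One_nat_def;
          (rule IH has_type_dest has_type_diverge has_type_inject typing)+)
  next
    case (TProd \<tau>1 \<tau>2)
    note IH = TProd[THEN conjunct1, rule_format] TProd[THEN conjunct2, rule_format]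
    show ?case
      by (cases n; intro conjI allI; simp only: injb.simps extb.simps uvt.simps(1) One_nat_def;
          (rule IH has_type_dest has_type_diverge has_type_inject typing)+)
  next
    case (TSum \<tau>1 \<tau>2)
    note IH = TSum[THEN conjunct1, rule_format] TSum[THEN conjunct2, rule_format]
    show ?case
      by (cases n; intro conjI allI; simp only: injb.simps extb.simps uvt.simps(1) One_nat_def;
          (rule IH has_type_dest has_type_diverge has_type_inject typing)+)
  qed
  then show "has_type (\<tau> # \<Gamma>) (injb \<tau> n) (uvt n)" "has_type (uvt n # \<Gamma>) (extb \<tau> n) \<tau>" by auto
qed

definition vinj :: "ty \<Rightarrow> nat \<Rightarrow> (nat \<Rightarrow> sval) \<Rightarrow> sval" where
  "vinj \<tau> n \<rho> = VClos \<tau> \<rho> (injb \<tau> n)"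

definition vext :: "ty \<Rightarrow> nat \<Rightarrow> (nat \<Rightarrow> sval) \<Rightarrow> sval" where
  "vext \<tau> n \<rho> = VClos (uvt n) \<rho> (extb \<tau> n)"

lemma sev_inj: "sev \<rho> (SApp (SLam \<tau> (injb \<tau> n)) t) = bind (sev \<rho> t) (sapp (vinj \<tau> n \<rho>))"
  by (simp add: vinj_def)

lemma sev_ext: "sev \<rho> (SApp (SLam (uvt n) (extb \<tau> n)) t) = bind (sev \<rho> t) (sapp (vext \<tau> n \<rho>))"
  by (simp add: vext_def)

lemma sapp_vinj: "sapp (vinj \<tau> n \<rho>) v = tick (sev (case_nat v \<rho>) (injb \<tau> n))"
  by (simp add: vinj_def)

lemma sapp_vext: "sapp (vext \<tau> n \<rho>) v = tick (sev (case_nat v \<rho>) (extb \<tau> n))"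
  by (simp add: vext_def)

lemma sev_dest:
  "sev \<rho> (SApp (ulam n b) t) = bind (sev \<rho> t) (sapp (vlam n \<rho> b))"
  by simp

lemma urel_pairI:
  assumes "urel n d k a a'" "urel n d k b b'" "within d n k"
  shows "urel (Suc n) d k (v_pair (VPair a b)) (WPair a' b')"
  using assms urel_wfu[OF assms(1)] urel_wfu[OF assms(2)]
  by (auto intro!: ushape.intros intro: urel_antimono simp: within_SucI)

lemma urel_inlI:
  assumes "urel n d k a a'" "within d n k"
  shows "urel (Suc n) d k (v_sum (VInl a)) (WInl a')"
  using assms urel_wfu[OF assms(1)]
  by (auto intro!: ushape.intros intro: urel_antimono simp: within_SucI)

lemma urel_inrI:
  assumes "urel n d k a a'" "within d n k"
  shows "urel (Suc n) d k (v_sum (VInr a)) (WInr a')"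
  using assms urel_wfu[OF assms(1)]
  by (auto intro!: ushape.intros intro: urel_antimono simp: within_SucI)

lemma sim_fail_within_0: "within d 0 k \<Longrightarrow> sim d P k fail c"
  by (cases d) (auto simp: within_def)

text \<open>Both claims are proved together by induction on \<tau>, for all levels, because function
  types exchange their roles. Injection has to be told that the level suffices for the index;
  extraction learns it from \<open>urel\<close>.\<close>

lemma
  shows sim_inject: "vrel \<tau> d k v w \<Longrightarrow> within d n k \<Longrightarrow>
      sim d (urel n d) k (sapp (vinj \<tau> n \<rho>) v) (uapp (wprotect \<tau> \<rho>') w)"
    and sim_extract: "urel n d k v w \<Longrightarrow>
      sim d (vrel \<tau> d) k (sapp (vext \<tau> n \<rho>) v) (uapp (wconfine \<tau> \<rho>') w)"
proof -
  have "(\<forall>\<rho> \<rho>'. vrel \<tau> d k v w \<longrightarrow> within d n k \<longrightarrow>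
      sim d (urel n d) k (sapp (vinj \<tau> n \<rho>) v) (uapp (wprotect \<tau> \<rho>') w)) \<and>
    (\<forall>\<rho> \<rho>'. urel n d k v w \<longrightarrow>
      sim d (vrel \<tau> d) k (sapp (vext \<tau> n \<rho>) v) (uapp (wconfine \<tau> \<rho>') w))"
  proof (induction \<tau> arbitrary: n k v w)
    case TUnit
    show ?case
    proof (cases n)
      case 0
      then show ?thesis by (auto simp: sapp_vinj sapp_vext intro: sim_fail_within_0 dest: urel_within)
    next
      case (Suc n)
      have "sim d (urel (Suc n) d) k (sapp (vinj TUnit (Suc n) \<rho>) v) (uapp (wprotect TUnit \<rho>') w)"
        if "vrel TUnit d k v w" "within d (Suc n) k" for \<rho> \<rho>'
        using that
        by (auto simp: sapp_vinj intro!: sim_tick sim_ret ushape.intros intro: within_mono)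
      moreover have "sim d (vrel TUnit d) k (sapp (vext TUnit (Suc n) \<rho>) v)
          (uapp (wconfine TUnit \<rho>') w)" if "urel (Suc n) d k v w" for \<rho> \<rho>'
        unfolding sapp_vext extb.simps sev_SSeq sev_dest uapp_wconfine_TUnit sev_SVar bind_ret nat.case
        by (intro sim_tick sim_dest_unit[OF urel_antimono[OF that]] antimono_vrel) (simp_all add: sim_ret)
      ultimately show ?thesis using Suc by blast
    qed
  next
    case TBool
    show ?case
    proof (cases n)
      case 0
      then show ?thesis by (auto simp: sapp_vinj sapp_vext intro: sim_fail_within_0 dest: urel_within)
    next
      case (Suc n)
      have "sim d (urel (Suc n) d) k (sapp (vinj TBool (Suc n) \<rho>) v) (uapp (wprotect TBool \<rho>') w)"
        if "vrel TBool d k v w" "within d (Suc n) k" for \<rho> \<rho>'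
        using that
        by (auto simp: sapp_vinj intro!: sim_tick sim_ret ushape.intros intro: within_mono)
      moreover have "sim d (vrel TBool d) k (sapp (vext TBool (Suc n) \<rho>) v)
          (uapp (wconfine TBool \<rho>') w)" if "urel (Suc n) d k v w" for \<rho> \<rho>'
        unfolding sapp_vext extb.simps sev_SIf sev_dest uapp_wconfine_TBool sev_SVar bind_ret nat.case
        by (intro sim_tick sim_dest_bool[OF urel_antimono[OF that]] antimono_vrel) (auto intro: sim_ret)
      ultimately show ?thesis using Suc by blast
    qed
  next
    case (TFun \<tau>1 \<tau>2)
    note inj1 = TFun.IH(1)[THEN conjunct1, rule_format] and ext1 = TFun.IH(1)[THEN conjunct2, rule_format]
    note inj2 = TFun.IH(2)[THEN conjunct1, rule_format] and ext2 = TFun.IH(2)[THEN conjunct2, rule_format]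
    show ?case
    proof (cases n)
      case 0
      then show ?thesis by (auto simp: sapp_vinj sapp_vext intro: sim_fail_within_0 dest: urel_within)
    next
      case (Suc n)
      have "sim d (urel (Suc n) d) k (sapp (vinj (TFun \<tau>1 \<tau>2) (Suc n) \<rho>) v)
          (uapp (wprotect (TFun \<tau>1 \<tau>2) \<rho>') w)"
        if vw: "vrel (TFun \<tau>1 \<tau>2) d k v w" and k: "within d (Suc n) k" for \<rho> \<rho>'
      proof -
        let ?b = "SApp (SLam \<tau>2 (injb \<tau>2 n)) (SApp (SVar 1) (SApp (SLam (uvt n) (extb \<tau>1 n)) (SVar 0)))"
        have "sim d (urel n d) j (sev (case_nat x (case_nat v \<rho>)) ?b)
            (uev (case_nat y (case_nat w \<rho>')) (protect_fun_body \<tau>1 \<tau>2))"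
          if j: "j < k" and xy: "urel n d j x y" for j x y
          unfolding uev_protect_fun_body sev_inj sev_ext sev_SApp[of _ "SVar 1"] sev_SVar bind_ret
            bind_bind
        proof (simp, rule sim_bind[OF ext1[OF xy]], rule sim_bind)
          fix i x' y' assume i: "i \<le> j" "vrel \<tau>1 d i x' y'"
          have "vrel (TFun \<tau>1 \<tau>2) d i v w" by (rule vrel_antimono[OF vw]) (use i j in simp)
          then show "sim d (vrel \<tau>2 d) i (sapp v x') (uapp w y')" using vrel_app i(2) by blast
          fix l z z' assume "l \<le> i" "vrel \<tau>2 d l z z'"
          then show "sim d (urel n d) l (sapp (vinj \<tau>2 n (case_nat x (case_nat v \<rho>))) z)
              (uapp (wprotect \<tau>2 (case_nat y (case_nat w \<rho>'))) z')"
            using inj2 within_SucD[OF k] i j by simp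
        qed
        then have "urel (Suc n) d k (v_fun (VClos (uvt n) (case_nat v \<rho>) ?b))
            (WClos (case_nat w \<rho>') (protect_fun_body \<tau>1 \<tau>2))"
          using k by (auto intro!: ushape.intros simp: funrel_def simp del: sev_SApp)
        then show ?thesis
          unfolding sapp_vinj injb.simps uapp_wprotect_TFun
          by (intro sim_tick_left sim_tick_right antimono_urel) (simp add: sim_ret del: urel.simps)
      qed
      moreover have "sim d (vrel (TFun \<tau>1 \<tau>2) d) k (sapp (vext (TFun \<tau>1 \<tau>2) (Suc n) \<rho>) v)
          (uapp (wconfine (TFun \<tau>1 \<tau>2) \<rho>') w)" if vw: "urel (Suc n) d k v w" for \<rho> \<rho>'
      proof -
        let ?b = "SApp (SLam (uvt n) (extb \<tau>2 n))
          (SApp (SApp (ulam n (dest_fun n)) (SVar 1)) (SApp (SLam \<tau>1 (injb \<tau>1 n)) (SVar 0)))"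
        have "sim d (vrel \<tau>2 d) j (sev (case_nat x (case_nat v \<rho>)) ?b)
            (uev (case_nat y (case_nat w \<rho>')) (confine_fun_body \<tau>1 \<tau>2))"
          if j: "j < k" and xy: "vrel \<tau>1 d j x y" for j x y
        proof -
          let ?e = "case_nat x (case_nat v \<rho>)" and ?e' = "case_nat y (case_nat w \<rho>')"
          have vj: "urel (Suc n) d j v w" by (rule urel_antimono[OF vw]) (use j in simp)
          have n: "within d n j" using within_SucD[OF urel_within[OF vw] j] .
          have "sim d (vrel \<tau>2 d) j (bind (sapp (vlam n ?e (dest_fun n)) v)
              (\<lambda>f. bind (sapp (vinj \<tau>1 n ?e) x) (\<lambda>x'. bind (sapp f x') (sapp (vext \<tau>2 n ?e)))))
            (bind (uapp (wprotect \<tau>1 ?e') y)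
              (\<lambda>y'. bind (uapp w y') (uapp (wconfine \<tau>2 ?e'))))"
          \<comment> \<open>The source tests v before it injects the argument, whereas the target
            first protects y. If w is no function, the target has no outcome whatever protection
            yields.\<close>
          proof (rule sim_dest_fun[OF vj antimono_vrel])
            fix f assume f: "funrel d (uvt n) (urel n d) (urel n d) j f w"
            show "sim d (vrel \<tau>2 d) j
                (bind (sapp (vinj \<tau>1 n ?e) x) (\<lambda>x'. bind (sapp f x') (sapp (vext \<tau>2 n ?e))))
                (bind (uapp (wprotect \<tau>1 ?e') y) (\<lambda>y'. bind (uapp w y') (uapp (wconfine \<tau>2 ?e'))))"
            proof (rule sim_bind[OF inj1[OF xy n]], rule sim_bind)
              fix i x' y' assume i: "i \<le> j" "urel n d i x' y'"
              show "sim d (urel n d) i (sapp f x') (uapp w y')"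
                using funrel_app antimono_relD[OF antimono_funrel f i(1)] i(2) antimono_urel by blast
            qed (rule ext2)
          qed simp
          then show ?thesis
            by (simp add: uev_confine_fun_body vinj_def vext_def)
        qed
        then have "vrel (TFun \<tau>1 \<tau>2) d k (VClos \<tau>1 (case_nat v \<rho>) ?b)
            (WClos (case_nat w \<rho>') (confine_fun_body \<tau>1 \<tau>2))"
          by (auto simp: funrel_def simp del: sev_SApp)
        then show ?thesis
          unfolding sapp_vext extb.simps uapp_wconfine_TFun sev_SLam
          by (intro sim_tick_left sim_tick_right antimono_vrel sim_ret)
      qed
      ultimately show ?thesis using Suc by blast
    qed
  next
    case (TProd \<tau>1 \<tau>2)
    note inj1 = TProd.IH(1)[THEN conjunct1, rule_format] and ext1 = TProd.IH(1)[THEN conjunct2, rule_format]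
    note inj2 = TProd.IH(2)[THEN conjunct1, rule_format] and ext2 = TProd.IH(2)[THEN conjunct2, rule_format]
    show ?case
    proof (cases n)
      case 0
      then show ?thesis by (auto simp: sapp_vinj sapp_vext intro: sim_fail_within_0 dest: urel_within)
    next
      case (Suc n)
      have "sim d (urel (Suc n) d) k (sapp (vinj (TProd \<tau>1 \<tau>2) (Suc n) \<rho>) v)
          (uapp (wprotect (TProd \<tau>1 \<tau>2) \<rho>') w)"
        if vw: "vrel (TProd \<tau>1 \<tau>2) d k v w" and k: "within d (Suc n) k" for \<rho> \<rho>'
      proof -
        obtain a b a' b' where v: "v = VPair a b" "w = WPair a' b'"
          and ab: "vrel \<tau>1 d k a a'" "vrel \<tau>2 d k b b'" using vw by auto
        \<comment> \<open>Here j is strictly below k owing to the tick of the outer wrapper call.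
          This tick pays for the passage from level n + 1 to level n.\<close>
        have "sim d (urel (Suc n) d) j
            (bind (tick (sapp (vinj \<tau>1 n (case_nat v \<rho>)) a))
              (\<lambda>x. bind (tick (sapp (vinj \<tau>2 n (case_nat v \<rho>)) b)) (\<lambda>y. ret (v_pair (VPair x y)))))
            (bind (tick (uapp (wprotect \<tau>1 (case_nat w \<rho>')) a'))
              (\<lambda>x. bind (tick (uapp (wprotect \<tau>2 (case_nat w \<rho>')) b')) (\<lambda>y. ret (WPair x y))))"
          if j: "j < k" for j
        proof (rule sim_bind, rule sim_tick)
          fix i assume "j = Suc i"
          then show "sim d (urel n d) i (sapp (vinj \<tau>1 n (case_nat v \<rho>)) a)
              (uapp (wprotect \<tau>1 (case_nat w \<rho>')) a')"
            using inj1 vrel_antimono[OF ab(1)] within_SucD[OF k] j by simp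
        next
          fix i x x' assume i: "i \<le> j" and x: "urel n d i x x'"
          have b: "sim d (urel n d) i (tick (sapp (vinj \<tau>2 n (case_nat v \<rho>)) b))
              (tick (uapp (wprotect \<tau>2 (case_nat w \<rho>')) b'))"
            using inj2 vrel_antimono[OF ab(2)] within_SucD[OF k] i j by (intro sim_tick) simp
          show "sim d (urel (Suc n) d) i
              (bind (tick (sapp (vinj \<tau>2 n (case_nat v \<rho>)) b)) (\<lambda>y. ret (v_pair (VPair x y))))
              (bind (tick (uapp (wprotect \<tau>2 (case_nat w \<rho>')) b')) (\<lambda>y. ret (WPair x' y)))"
            using urel_pairI[OF urel_antimono[OF x]] within_SucD[OF k] i j
            by (intro sim_bind[OF b] sim_ret) (simp del: urel.simps)
        qed
        then show ?thesis
          unfolding sapp_vinj uapp_wprotect_TProd injb.simps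
          by (intro sim_tick) (simp add: v vinj_def del: urel.simps)
      qed
      moreover have "sim d (vrel (TProd \<tau>1 \<tau>2) d) k (sapp (vext (TProd \<tau>1 \<tau>2) (Suc n) \<rho>) v)
          (uapp (wconfine (TProd \<tau>1 \<tau>2) \<rho>') w)" if vw: "urel (Suc n) d k v w" for \<rho> \<rho>'
        unfolding sapp_vext[of "TProd \<tau>1 \<tau>2"] uapp_wconfine_TProd extb.simps sev_SPair sev_ext sev_SFst sev_SSnd sev_dest
          sev_SVar bind_ret nat.case
        by (rule sim_tick, rule sim_pair; (rule sim_bind, rule sim_dest_pair, rule urel_antimono[OF vw]))
          (auto intro: ext1 ext2)
      ultimately show ?thesis using Suc by blast
    qed
  next
    case (TSum \<tau>1 \<tau>2)
    note inj1 = TSum.IH(1)[THEN conjunct1, rule_format] and ext1 = TSum.IH(1)[THEN conjunct2, rule_format]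
    note inj2 = TSum.IH(2)[THEN conjunct1, rule_format] and ext2 = TSum.IH(2)[THEN conjunct2, rule_format]
    show ?case
    proof (cases n)
      case 0
      then show ?thesis by (auto simp: sapp_vinj sapp_vext intro: sim_fail_within_0 dest: urel_within)
    next
      case (Suc n)
      have "sim d (urel (Suc n) d) k (sapp (vinj (TSum \<tau>1 \<tau>2) (Suc n) \<rho>) v)
          (uapp (wprotect (TSum \<tau>1 \<tau>2) \<rho>') w)"
        if vw: "vrel (TSum \<tau>1 \<tau>2) d k v w" and k: "within d (Suc n) k" for \<rho> \<rho>'
      proof -
        have l: "sim d (urel (Suc n) d) k (tick (tick (bind c (\<lambda>x. ret (v_sum (VInl x))))))
            (tick (tick (bind c' (\<lambda>x. ret (WInl x)))))"
          if "\<And>j. j < k \<Longrightarrow> sim d (urel n d) j c c'" for c c'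
          using urel_inlI within_SucD[OF k]
          by (intro sim_tick sim_bind[OF that] sim_ret) (auto simp del: urel.simps)
        have r: "sim d (urel (Suc n) d) k (tick (tick (bind c (\<lambda>x. ret (v_sum (VInr x))))))
            (tick (tick (bind c' (\<lambda>x. ret (WInr x)))))"
          if "\<And>j. j < k \<Longrightarrow> sim d (urel n d) j c c'" for c c'
          using urel_inrI within_SucD[OF k]
          by (intro sim_tick sim_bind[OF that] sim_ret) (auto simp del: urel.simps)
        consider a a' where "v = VInl a" "w = WInl a'" "vrel \<tau>1 d k a a'"
          | a a' where "v = VInr a" "w = WInr a'" "vrel \<tau>2 d k a a'"
          using vw by auto
        then show ?thesis
        proof cases
          case 1
          then show ?thesis
            unfolding sapp_vinj uapp_wprotect_TSum injb.simps
            using l[OF inj1[OF vrel_antimono[OF 1(3)] within_SucD[OF k]]]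
            by (simp add: vinj_def del: urel.simps)
        next
          case 2
          then show ?thesis
            unfolding sapp_vinj uapp_wprotect_TSum injb.simps
            using r[OF inj2[OF vrel_antimono[OF 2(3)] within_SucD[OF k]]]
            by (simp add: vinj_def del: urel.simps)
        qed
      qed
      moreover have "sim d (vrel (TSum \<tau>1 \<tau>2) d) k (sapp (vext (TSum \<tau>1 \<tau>2) (Suc n) \<rho>) v)
          (uapp (wconfine (TSum \<tau>1 \<tau>2) \<rho>') w)" if vw: "urel (Suc n) d k v w" for \<rho> \<rho>'
        unfolding sapp_vext[of "TSum \<tau>1 \<tau>2"] uapp_wconfine_TSum extb.simps sev_SCase sev_SInl sev_SInr sev_ext sev_dest
          sev_SVar bind_ret nat.case
        by (rule sim_tick, rule sim_dest_sum[OF urel_antimono[OF vw] antimono_vrel])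
          (auto intro: sim_inl sim_inr ext1 ext2 simp del: vrel.simps)
      ultimately show ?thesis using Suc by blast
    qed
  qed
  then show "vrel \<tau> d k v w \<Longrightarrow> within d n k \<Longrightarrow>
      sim d (urel n d) k (sapp (vinj \<tau> n \<rho>) v) (uapp (wprotect \<tau> \<rho>') w)"
    and "urel n d k v w \<Longrightarrow>
      sim d (vrel \<tau> d) k (sapp (vext \<tau> n \<rho>) v) (uapp (wconfine \<tau> \<rho>') w)" by auto
qed

section \<open>Approximate back-translation\<close>

definition uenv :: "dir \<Rightarrow> nat \<Rightarrow> nat list \<Rightarrow> (nat \<Rightarrow> sval) \<Rightarrow> (nat \<Rightarrow> uval) \<Rightarrow> bool" where
  "uenv d k ls \<rho> \<rho>' \<longleftrightarrow> (\<forall>i < length ls. urel (ls ! i) d k (\<rho> i) (\<rho>' i))"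

lemma uenv_antimono: "uenv d k ls \<rho> \<rho>' \<Longrightarrow> j \<le> k \<Longrightarrow> uenv d j ls \<rho> \<rho>'"
  using urel_antimono by (auto simp: uenv_def)

lemma uenv_Cons:
  "urel n d k v w \<Longrightarrow> uenv d k ls \<rho> \<rho>' \<Longrightarrow> uenv d k (n # ls) (case_nat v \<rho>) (case_nat w \<rho>')"
  by (auto simp: uenv_def less_Suc_eq_0_disj)

(* s emulates the target terms F M, where the last variable of s holds a source function that
   stands for M in the sense of H; the other variables have types uvt l for the levels l in ls. *)
definition emu :: "ty \<Rightarrow> (sval \<Rightarrow> utm \<Rightarrow> bool) \<Rightarrow> nat list \<Rightarrow> nat \<Rightarrow> stm \<Rightarrow> (utm \<Rightarrow> utm) \<Rightarrow> bool" where
  "emu T H ls n s F \<longleftrightarrow> has_type (map uvt ls @ [T]) s (uvt n) \<and>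
     (\<forall>d k \<rho> \<rho>' M. uenv d k ls \<rho> \<rho>' \<longrightarrow> H (\<rho> (length ls)) M \<longrightarrow>
        within d n k \<longrightarrow> sim d (urel n d) k (sev \<rho> s) (uev \<rho>' (F M)))"

lemma emu_sim:
  assumes "emu T H ls n s F" "uenv d k ls \<rho> \<rho>'"
    "H (\<rho> (length ls)) M" "within d n j" "j \<le> k"
  shows "sim d (urel n d) j (sev \<rho> s) (uev \<rho>' (F M))"
  using assms uenv_antimono unfolding emu_def by blast

lemma emu_type: "emu T H ls n s F \<Longrightarrow> has_type (map uvt ls @ [T]) s (uvt n)"
  by (simp add: emu_def)

lemma emuI:
  assumes "has_type (map uvt ls @ [T]) s (uvt n)"
    and "\<And>d k \<rho> \<rho>' M. uenv d k ls \<rho> \<rho>' \<Longrightarrow>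
      H (\<rho> (length ls)) M \<Longrightarrow> within d n k \<Longrightarrow> sim d (urel n d) k (sev \<rho> s) (uev \<rho>' (F M))"
  shows "emu T H ls n s F"
  using assms unfolding emu_def by blast

text \<open>All levels are required at once: to eliminate with a result at level n, the operand must
  be emulated at level n + 1. The source term is chosen before M, so one emulation serves both
  compiled terms.\<close>

definition emulable :: "ty \<Rightarrow> (sval \<Rightarrow> utm \<Rightarrow> bool) \<Rightarrow> nat list \<Rightarrow> (utm \<Rightarrow> utm) \<Rightarrow> bool" where
  "emulable T H ls F \<longleftrightarrow> (\<forall>n. \<exists>s. emu T H ls n s F)"

lemma emulableI:
  assumes "\<And>n. \<exists>s. emu T H ls (Suc n) s F"
  shows "emulable T H ls F"
  unfolding emulable_def
proof
  fix n show "\<exists>s. emu T H ls n s F"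
  proof (cases n)
    case 0
    \<comment> \<open>Returning unit would be unsound for \<open>Fwd\<close>, since the target term
      may fail or diverge.\<close>
    have "emu T H ls 0 (diverge TUnit) F"
      by (rule emuI) (auto simp: has_type_diverge sim_fail_within_0)
    then show ?thesis using 0 by blast
  qed (simp add: assms)
qed

lemma emulableE:
  assumes "emulable T H ls F"
  obtains s where "emu T H ls n s F"
  using assms by (auto simp: emulable_def)

lemma emulable_const:
  assumes "\<And>\<Gamma> n. has_type \<Gamma> s (uvt (Suc n))"
    and "\<And>\<rho> \<rho>' d k n M. within d (Suc n) k \<Longrightarrow> sim d (urel (Suc n) d) k (sev \<rho> s) (uev \<rho>' (F M))"
  shows "emulable T H ls F"
  using assms by (intro emulableI exI emuI) auto

lemma emulable_base:
  "emulable T H ls (\<lambda>_. UUnit)" "emulable T H ls (\<lambda>_. UTrue)" "emulable T H ls (\<lambda>_. UFalse)"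
proof -
  show "emulable T H ls (\<lambda>_. UUnit)"
    by (rule emulable_const[of "s_unit SUnit"], (rule has_type_inject typing)+)
      (auto intro!: sim_ret ushape.intros)
  show "emulable T H ls (\<lambda>_. UTrue)"
    by (rule emulable_const[of "s_bool STrue"], (rule has_type_inject typing)+)
      (auto intro!: sim_ret ushape.intros)
  show "emulable T H ls (\<lambda>_. UFalse)"
    by (rule emulable_const[of "s_bool SFalse"], (rule has_type_inject typing)+)
      (auto intro!: sim_ret ushape.intros)
qed

lemma emulable_wrong: "emulable T H ls (\<lambda>_. UWrong)"
proof (intro emulableI exI emuI)
  show "has_type (map uvt ls @ [T]) (diverge (uvt (Suc n))) (uvt (Suc n))" for n
    by (rule has_type_diverge)
qed auto

lemma sim_vcast:
  assumes "urel m d k v w" "j \<le> k" "within d n j"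
  shows "sim d (urel n d) j (sapp (vcast m n \<rho>) v) (ret w)"
proof -
  obtain v' where v': "returns (sapp (vcast m n \<rho>) v) v'" "urel n d j v' w"
    using vcast_returns[OF urel_wfu[OF assms(1)]] assms by blast
  have "sim d (urel n d) j (bind (sapp (vcast m n \<rho>) v) ret) (ret w)"
    by (intro sim_returns[OF v'(1)] antimono_urel sim_ret v'(2))
  then show ?thesis by simp
qed

(* Casting to the lower level costs the target nothing, so the step index of the result refers to one
   step less. *)
lemma sim_vcast_pred:
  assumes "urel (Suc n) d k v w"
  shows "sim d (\<lambda>k. urel n d (k - 1)) k (sapp (vcast (Suc n) n \<rho>) v) (ret w)"
proof -
  have "within d n (k - 1)" using urel_within[OF assms] by (auto simp: within_def)
  then obtain v' where v': "returns (sapp (vcast (Suc n) n \<rho>) v) v'" "urel n d (k - 1) v' w"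
    using vcast_returns[OF urel_wfu[OF assms]] assms by (meson diff_le_self)
  have "antimono_rel (\<lambda>k. urel n d (k - 1))"
    using urel_antimono by (auto simp: antimono_rel_def intro: diff_le_mono)
  then have "sim d (\<lambda>k. urel n d (k - 1)) k (bind (sapp (vcast (Suc n) n \<rho>) v) ret) (ret w)"
    using v'(2) by (intro sim_returns[OF v'(1)] sim_ret)
  then show ?thesis by simp
qed

text \<open>The variable was bound at the level chosen by its binder, so it is cast to the level
  wanted at this occurrence.\<close>

lemma emulable_var:
  assumes "i < length ls"
  shows "emulable T H ls (\<lambda>_. UVar i)"
proof (intro emulableI exI emuI)
  fix n
  have "has_type (map uvt ls @ [T]) (SVar i) (uvt (ls ! i))"
    using T_Var[of i "map uvt ls @ [T]"] assms by (simp add: nth_append)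
  then show "has_type (map uvt ls @ [T]) (SApp (cast (ls ! i) (Suc n)) (SVar i)) (uvt (Suc n))"
    using T_App[OF has_type_cast] by blast
qed (use assms in \<open>auto simp: uenv_def simp del: urel.simps intro!: sim_vcast\<close>)

text \<open>The binder takes the level n of the function summand in \<open>uvt (Suc n)\<close>. The
  body at level n is precise enough, as it runs only at indices below k.\<close>

lemma emulable_lam:
  assumes "\<And>n. emulable T H (n # ls) F"
  shows "emulable T H ls (\<lambda>M. ULam (F M))"
proof (rule emulableI)
  fix n
  obtain s where s: "emu T H (n # ls) n s F" using assms by (rule emulableE)
  have "emu T H ls (Suc n) (s_fun (SLam (uvt n) s)) (\<lambda>M. ULam (F M))"
  proof (rule emuI)
    show "has_type (map uvt ls @ [T]) (s_fun (SLam (uvt n) s)) (uvt (Suc n))"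
      using emu_type[OF s] by (intro has_type_inject T_Lam) simp
    fix d k \<rho> \<rho>' M
    assume env: "uenv d k ls \<rho> \<rho>'"
      and H: "H (\<rho> (length ls)) M" and k: "within d (Suc n) k"
    have "sim d (urel n d) j (sev (case_nat x \<rho>) s) (uev (case_nat y \<rho>') (F M))"
      if j: "j < k" and xy: "urel n d j x y" for j x y
      using j H within_SucD[OF k j] uenv_antimono[OF env, of j]
      by (intro emu_sim[OF s uenv_Cons[OF xy]]) auto
    then have "urel (Suc n) d k (v_fun (VClos (uvt n) \<rho> s)) (WClos \<rho>' (F M))"
      using k by (auto intro!: ushape.intros simp: funrel_def)
    then show "sim d (urel (Suc n) d) k (sev \<rho> (s_fun (SLam (uvt n) s))) (uev \<rho>' (ULam (F M)))"
      by (simp add: sim_ret del: urel.simps)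
  qed
  then show "\<exists>s. emu T H ls (Suc n) s (\<lambda>M. ULam (F M))" by blast
qed

lemma emulable_app:
  assumes "emulable T H ls F1" "emulable T H ls F2"
  shows "emulable T H ls (\<lambda>M. UApp (F1 M) (F2 M))"
  unfolding emulable_def
proof
  fix n
  obtain s1 where s1: "emu T H ls (Suc n) s1 F1" using assms(1) by (rule emulableE)
  obtain s2 where s2: "emu T H ls n s2 F2" using assms(2) by (rule emulableE)
  have "emu T H ls n (SApp (SApp (ulam n (dest_fun n)) s1) s2) (\<lambda>M. UApp (F1 M) (F2 M))"
  proof (rule emuI)
    show "has_type (map uvt ls @ [T]) (SApp (SApp (ulam n (dest_fun n)) s1) s2) (uvt n)"
      by (rule T_App T_App[OF has_type_dest(5)] emu_type[OF s1] emu_type[OF s2])+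
    fix d k \<rho> \<rho>' M
    assume env: "uenv d k ls \<rho> \<rho>'"
      and H: "H (\<rho> (length ls)) M" and k: "within d n k"
    have "sim d (urel n d) k
        (bind (sev \<rho> s1) (\<lambda>v. bind (sapp (vlam n \<rho> (dest_fun n)) v) (\<lambda>f. bind (sev \<rho> s2) (sapp f))))
        (bind (uev \<rho>' (F1 M)) (\<lambda>w. bind (uev \<rho>' (F2 M)) (uapp w)))"
    proof (rule sim_bind[OF emu_sim[OF s1 env H within_SucI[OF k] order_refl]],
        rule sim_dest_fun[OF _ antimono_urel])
      fix j v w f
      assume j: "j \<le> k" and f: "funrel d (uvt n) (urel n d) (urel n d) j f w"
      show "sim d (urel n d) j (bind (sev \<rho> s2) (sapp f)) (bind (uev \<rho>' (F2 M)) (uapp w))"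
        by (rule sim_bind[OF emu_sim[OF s2 env H within_mono[OF k j] j]])
          (meson funrel_app antimono_relD[OF antimono_funrel f] antimono_urel)
    qed simp_all
    then show "sim d (urel n d) k (sev \<rho> (SApp (SApp (ulam n (dest_fun n)) s1) s2))
        (uev \<rho>' (UApp (F1 M) (F2 M)))"
      by simp
  qed
  then show "\<exists>s. emu T H ls n s (\<lambda>M. UApp (F1 M) (F2 M))" by blast
qed

lemma emulable_fst:
  assumes "emulable T H ls F"
  shows "emulable T H ls (\<lambda>M. UFst (F M))"
  unfolding emulable_def
proof
  fix n
  obtain s where s: "emu T H ls (Suc n) s F" using assms by (rule emulableE)
  have "emu T H ls n (SFst (SApp (ulam n (dest_pair n)) s)) (\<lambda>M. UFst (F M))"
  proof (rule emuI)
    show "has_type (map uvt ls @ [T]) (SFst (SApp (ulam n (dest_pair n)) s)) (uvt n)"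
      by (rule T_Fst T_App[OF has_type_dest(3)] emu_type[OF s])+
    fix d k \<rho> \<rho>' M
    assume env: "uenv d k ls \<rho> \<rho>'" and H: "H (\<rho> (length ls)) M" and k: "within d n k"
    show "sim d (urel n d) k (sev \<rho> (SFst (SApp (ulam n (dest_pair n)) s))) (uev \<rho>' (UFst (F M)))"
      unfolding sev_SFst uev_UFst sev_dest bind_bind
      by (rule sim_bind[OF emu_sim[OF s env H within_SucI[OF k] order_refl] sim_dest_pair(1)])
  qed
  then show "\<exists>s. emu T H ls n s (\<lambda>M. UFst (F M))" by blast
qed

lemma emulable_snd:
  assumes "emulable T H ls F"
  shows "emulable T H ls (\<lambda>M. USnd (F M))"
  unfolding emulable_def
proof
  fix n
  obtain s where s: "emu T H ls (Suc n) s F" using assms by (rule emulableE)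
  have "emu T H ls n (SSnd (SApp (ulam n (dest_pair n)) s)) (\<lambda>M. USnd (F M))"
  proof (rule emuI)
    show "has_type (map uvt ls @ [T]) (SSnd (SApp (ulam n (dest_pair n)) s)) (uvt n)"
      by (rule T_Snd T_App[OF has_type_dest(3)] emu_type[OF s])+
    fix d k \<rho> \<rho>' M
    assume env: "uenv d k ls \<rho> \<rho>'" and H: "H (\<rho> (length ls)) M" and k: "within d n k"
    show "sim d (urel n d) k (sev \<rho> (SSnd (SApp (ulam n (dest_pair n)) s))) (uev \<rho>' (USnd (F M)))"
      unfolding sev_SSnd uev_USnd sev_dest bind_bind
      by (rule sim_bind[OF emu_sim[OF s env H within_SucI[OF k] order_refl] sim_dest_pair(2)])
  qed
  then show "\<exists>s. emu T H ls n s (\<lambda>M. USnd (F M))" by blast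
qed

text \<open>An introduction form at level n + 1 needs components at level n, but it costs nothing
  and the index may still be n + 1. So the component is computed at level n + 1, precisely up to
  that index, and only its value is cast down.\<close>

lemma emu_pred:
  assumes s: "emu T H ls (Suc n) s F"
    and "uenv d k ls \<rho> \<rho>'"
    and "H (\<rho> (length ls)) M" "within d (Suc n) j" "j \<le> k"
  shows "sim d (\<lambda>k. urel n d (k - 1)) j (sev \<rho> (SApp (cast (Suc n) n) s)) (uev \<rho>' (F M))"
proof -
  have "sim d (\<lambda>k. urel n d (k - 1)) j (bind (sev \<rho> s) (sapp (vcast (Suc n) n \<rho>)))
      (bind (uev \<rho>' (F M)) ret)"
    by (rule sim_bind[OF emu_sim[OF assms] sim_vcast_pred])
  then show ?thesis by simp
qed

lemma has_type_cast_pred: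
  "emu T H ls (Suc n) s F \<Longrightarrow> has_type (map uvt ls @ [T]) (SApp (cast (Suc n) n) s) (uvt n)"
  using T_App[OF has_type_cast] emu_type by blast

lemma emulable_pair:
  assumes "emulable T H ls F1" "emulable T H ls F2"
  shows "emulable T H ls (\<lambda>M. UPair (F1 M) (F2 M))"
proof (rule emulableI)
  fix n
  obtain s1 where s1: "emu T H ls (Suc n) s1 F1" using assms(1) by (rule emulableE)
  obtain s2 where s2: "emu T H ls (Suc n) s2 F2" using assms(2) by (rule emulableE)
  let ?p = "SPair (SApp (cast (Suc n) n) s1) (SApp (cast (Suc n) n) s2)"
  have "emu T H ls (Suc n) (s_pair ?p) (\<lambda>M. UPair (F1 M) (F2 M))"
  proof (rule emuI)
    show "has_type (map uvt ls @ [T]) (s_pair ?p) (uvt (Suc n))"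
      by (intro has_type_inject T_Pair has_type_cast_pred[OF s1] has_type_cast_pred[OF s2])
    fix d k \<rho> \<rho>' M
    assume env: "uenv d k ls \<rho> \<rho>'"
      and H: "H (\<rho> (length ls)) M" and k: "within d (Suc n) k"
    have "sim d (urel (Suc n) d) k
        (bind (sev \<rho> (SApp (cast (Suc n) n) s1)) (\<lambda>x.
          bind (sev \<rho> (SApp (cast (Suc n) n) s2)) (\<lambda>y. ret (v_pair (VPair x y)))))
        (bind (uev \<rho>' (F1 M)) (\<lambda>x. bind (uev \<rho>' (F2 M)) (\<lambda>y. ret (WPair x y))))"
    proof (rule sim_bind[OF emu_pred[OF s1 env H k order_refl]])
      fix j x x' assume j: "j \<le> k" and x: "urel n d (j - 1) x x'"
      show "sim d (urel (Suc n) d) j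
          (bind (sev \<rho> (SApp (cast (Suc n) n) s2)) (\<lambda>y. ret (v_pair (VPair x y))))
          (bind (uev \<rho>' (F2 M)) (\<lambda>y. ret (WPair x' y)))"
      proof (rule sim_bind[OF emu_pred[OF s2 env H within_mono[OF k j] j]], rule sim_ret)
        fix i y y' assume i: "i \<le> j" and y: "urel n d (i - 1) y y'"
        have "urel n d (i - 1) x x'" by (rule urel_antimono[OF x]) (use i in simp)
        then show "urel (Suc n) d i (v_pair (VPair x y)) (WPair x' y')"
          using y urel_wfu[OF x] urel_wfu[OF y] within_mono[OF k] i j
          by (auto intro!: ushape.intros)
      qed
    qed
    then show "sim d (urel (Suc n) d) k (sev \<rho> (s_pair ?p)) (uev \<rho>' (UPair (F1 M) (F2 M)))"
      by (simp del: urel.simps)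
  qed
  then show "\<exists>s. emu T H ls (Suc n) s (\<lambda>M. UPair (F1 M) (F2 M))" by blast
qed

lemma emulable_inl:
  assumes "emulable T H ls F"
  shows "emulable T H ls (\<lambda>M. UInl (F M))"
proof (rule emulableI)
  fix n
  obtain s where s: "emu T H ls (Suc n) s F" using assms(1) by (rule emulableE)
  let ?p = "SInl (SApp (cast (Suc n) n) s)"
  have "emu T H ls (Suc n) (s_sum ?p) (\<lambda>M. UInl (F M))"
  proof (rule emuI)
    show "has_type (map uvt ls @ [T]) (s_sum ?p) (uvt (Suc n))"
      by (intro has_type_inject T_Inl has_type_cast_pred[OF s])
    fix d k \<rho> \<rho>' M
    assume env: "uenv d k ls \<rho> \<rho>'"
      and H: "H (\<rho> (length ls)) M" and k: "within d (Suc n) k"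
    have "sim d (urel (Suc n) d) k
        (bind (sev \<rho> (SApp (cast (Suc n) n) s)) (\<lambda>x. ret (v_sum (VInl x))))
        (bind (uev \<rho>' (F M)) (\<lambda>x. ret (WInl x)))"
    proof (rule sim_bind[OF emu_pred[OF s env H k order_refl]], rule sim_ret)
      fix j x x' assume j: "j \<le> k" and x: "urel n d (j - 1) x x'"
      then show "urel (Suc n) d j (v_sum (VInl x)) (WInl x')"
        using urel_wfu[OF x] within_mono[OF k j] by (auto intro!: ushape.intros)
    qed
    then show "sim d (urel (Suc n) d) k (sev \<rho> (s_sum ?p)) (uev \<rho>' (UInl (F M)))"
      by (simp del: urel.simps)
  qed
  then show "\<exists>s. emu T H ls (Suc n) s (\<lambda>M. UInl (F M))" by blast
qed

lemma emulable_inr: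
  assumes "emulable T H ls F"
  shows "emulable T H ls (\<lambda>M. UInr (F M))"
proof (rule emulableI)
  fix n
  obtain s where s: "emu T H ls (Suc n) s F" using assms(1) by (rule emulableE)
  let ?p = "SInr (SApp (cast (Suc n) n) s)"
  have "emu T H ls (Suc n) (s_sum ?p) (\<lambda>M. UInr (F M))"
  proof (rule emuI)
    show "has_type (map uvt ls @ [T]) (s_sum ?p) (uvt (Suc n))"
      by (intro has_type_inject T_Inr has_type_cast_pred[OF s])
    fix d k \<rho> \<rho>' M
    assume env: "uenv d k ls \<rho> \<rho>'"
      and H: "H (\<rho> (length ls)) M" and k: "within d (Suc n) k"
    have "sim d (urel (Suc n) d) k
        (bind (sev \<rho> (SApp (cast (Suc n) n) s)) (\<lambda>x. ret (v_sum (VInr x))))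
        (bind (uev \<rho>' (F M)) (\<lambda>x. ret (WInr x)))"
    proof (rule sim_bind[OF emu_pred[OF s env H k order_refl]], rule sim_ret)
      fix j x x' assume j: "j \<le> k" and x: "urel n d (j - 1) x x'"
      then show "urel (Suc n) d j (v_sum (VInr x)) (WInr x')"
        using urel_wfu[OF x] within_mono[OF k j] by (auto intro!: ushape.intros)
    qed
    then show "sim d (urel (Suc n) d) k (sev \<rho> (s_sum ?p)) (uev \<rho>' (UInr (F M)))"
      by (simp del: urel.simps)
  qed
  then show "\<exists>s. emu T H ls (Suc n) s (\<lambda>M. UInr (F M))" by blast
qed

lemma emulable_case:
  assumes "emulable T H ls F" "\<And>n. emulable T H (n # ls) F1" "\<And>n. emulable T H (n # ls) F2"
  shows "emulable T H ls (\<lambda>M. UCase (F M) (F1 M) (F2 M))"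
  unfolding emulable_def
proof
  fix n
  obtain s where s: "emu T H ls (Suc n) s F" using assms(1) by (rule emulableE)
  obtain s1 where s1: "emu T H (n # ls) n s1 F1" using assms(2) by (rule emulableE)
  obtain s2 where s2: "emu T H (n # ls) n s2 F2" using assms(3) by (rule emulableE)
  let ?s = "SCase (SApp (ulam n (dest_sum n)) s) s1 s2"
  have "emu T H ls n ?s (\<lambda>M. UCase (F M) (F1 M) (F2 M))"
  proof (rule emuI)
    show "has_type (map uvt ls @ [T]) ?s (uvt n)"
      using emu_type[OF s1] emu_type[OF s2]
      by (intro T_Case[OF T_App[OF has_type_dest(4) emu_type[OF s]]]) simp_all
    fix d k \<rho> \<rho>' M
    assume env: "uenv d k ls \<rho> \<rho>'"
      and H: "H (\<rho> (length ls)) M" and k: "within d n k"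
    have branch: "sim d (urel n d) j (sev (case_nat x \<rho>) t) (uev (case_nat y \<rho>') (G M))"
      if t: "emu T H (n # ls) n t G" and j: "j \<le> k" and xy: "urel n d j x y" for t G j x y
      using j H within_mono[OF k j] uenv_antimono[OF env, of j]
      by (intro emu_sim[OF t uenv_Cons[OF xy]]) auto
    show "sim d (urel n d) k (sev \<rho> ?s) (uev \<rho>' (UCase (F M) (F1 M) (F2 M)))"
      unfolding sev_SCase uev_UCase sev_dest bind_bind
      by (rule sim_bind[OF emu_sim[OF s env H within_SucI[OF k] order_refl]],
          rule sim_dest_sum[OF _ antimono_urel]) (use branch[OF s1] branch[OF s2] in auto)
  qed
  then show "\<exists>s. emu T H ls n s (\<lambda>M. UCase (F M) (F1 M) (F2 M))" by blast
qed

lemma emulable_seq: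
  assumes "emulable T H ls F1" "emulable T H ls F2"
  shows "emulable T H ls (\<lambda>M. USeq (F1 M) (F2 M))"
  unfolding emulable_def
proof
  fix n
  obtain s1 where s1: "emu T H ls (Suc n) s1 F1" using assms(1) by (rule emulableE)
  obtain s2 where s2: "emu T H ls n s2 F2" using assms(2) by (rule emulableE)
  let ?s = "SSeq (SApp (ulam n (dest_unit n)) s1) s2"
  have "emu T H ls n ?s (\<lambda>M. USeq (F1 M) (F2 M))"
  proof (rule emuI)
    show "has_type (map uvt ls @ [T]) ?s (uvt n)"
      by (rule T_Seq T_App[OF has_type_dest(1)] emu_type[OF s1] emu_type[OF s2])+
    fix d k \<rho> \<rho>' M
    assume env: "uenv d k ls \<rho> \<rho>'"
      and H: "H (\<rho> (length ls)) M" and k: "within d n k"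
    show "sim d (urel n d) k (sev \<rho> ?s) (uev \<rho>' (USeq (F1 M) (F2 M)))"
      unfolding sev_SSeq uev_USeq sev_dest bind_bind
      by (rule sim_bind[OF emu_sim[OF s1 env H within_SucI[OF k] order_refl]],
          rule sim_dest_unit[OF _ antimono_urel])
        (use emu_sim[OF s2 env H within_mono[OF k]] in auto)
  qed
  then show "\<exists>s. emu T H ls n s (\<lambda>M. USeq (F1 M) (F2 M))" by blast
qed

lemma emulable_if:
  assumes "emulable T H ls F" "emulable T H ls F1" "emulable T H ls F2"
  shows "emulable T H ls (\<lambda>M. UIf (F M) (F1 M) (F2 M))"
  unfolding emulable_def
proof
  fix n
  obtain s where s: "emu T H ls (Suc n) s F" using assms(1) by (rule emulableE)
  obtain s1 where s1: "emu T H ls n s1 F1" using assms(2) by (rule emulableE)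
  obtain s2 where s2: "emu T H ls n s2 F2" using assms(3) by (rule emulableE)
  let ?s = "SIf (SApp (ulam n (dest_bool n)) s) s1 s2"
  have "emu T H ls n ?s (\<lambda>M. UIf (F M) (F1 M) (F2 M))"
  proof (rule emuI)
    show "has_type (map uvt ls @ [T]) ?s (uvt n)"
      by (rule T_If T_App[OF has_type_dest(2)] emu_type[OF s] emu_type[OF s1] emu_type[OF s2])+
    fix d k \<rho> \<rho>' M
    assume env: "uenv d k ls \<rho> \<rho>'"
      and H: "H (\<rho> (length ls)) M" and k: "within d n k"
    show "sim d (urel n d) k (sev \<rho> ?s) (uev \<rho>' (UIf (F M) (F1 M) (F2 M)))"
      unfolding sev_SIf uev_UIf sev_dest bind_bind
      by (rule sim_bind[OF emu_sim[OF s env H within_SucI[OF k] order_refl]],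
          rule sim_dest_bool[OF _ antimono_urel])
        (use emu_sim[OF s1 env H within_mono[OF k]] emu_sim[OF s2 env H within_mono[OF k]] in auto)
  qed
  then show "\<exists>s. emu T H ls n s (\<lambda>M. UIf (F M) (F1 M) (F2 M))" by blast
qed

lemmas emulable_intros = emulable_base emulable_wrong emulable_var emulable_lam emulable_app
  emulable_fst emulable_snd emulable_pair emulable_inl emulable_inr emulable_case emulable_seq
  emulable_if

lemma emulable_term: "uscoped (length ls) u \<Longrightarrow> emulable T H ls (\<lambda>_. u)"
proof (induction u arbitrary: ls)
  case (ULam u)
  have "ufv u \<subseteq> {..<Suc (length ls)}"
    using ULam.prems by (auto simp: uscoped_def subset_iff less_Suc_eq_0_disj) (metis not0_implies_Suc)
  then show ?case using ULam.IH by (intro emulable_lam) (simp add: uscoped_def)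
next
  case (UCase u u1 u2)
  have "ufv u1 \<subseteq> {..<Suc (length ls)}" "ufv u2 \<subseteq> {..<Suc (length ls)}"
    using UCase.prems by (auto simp: uscoped_def subset_iff less_Suc_eq_0_disj) (metis not0_implies_Suc)+
  then show ?case using UCase by (intro emulable_case) (simp_all add: uscoped_def)
qed (auto intro!: emulable_intros simp: uscoped_def)

text \<open>The binders on the path to the hole decide the levels of its variables, hence the
  hypothesis on the hole for every list of levels of the right length.\<close>

lemma emulable_plug:
  assumes "uctx_scoped C m n" "\<And>ls. length ls = m \<Longrightarrow> emulable T H ls (\<lambda>M. M)" "length ls = n"
  shows "emulable T H ls (\<lambda>M. uplug C M)"
  using assms by (induction arbitrary: ls rule: uctx_scoped.induct)
    (auto simp: uplug.simps[abs_def] intro!: emulable_intros emulable_term)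

text \<open>h is the value of the source term abstracted over its free variable. Its environment is
  arbitrary, as t mentions nothing beyond that variable and its own argument.\<close>

definition hole_rel :: "ty \<Rightarrow> ty \<Rightarrow> ty \<Rightarrow> ty \<Rightarrow> sval \<Rightarrow> utm \<Rightarrow> bool" where
  "hole_rel \<sigma>' \<sigma> \<rho>' \<rho>r h M \<longleftrightarrow> (\<exists>t \<rho>. has_type [\<rho>', TFun \<sigma>' \<sigma>] t \<rho>r \<and>
     h = VClos (TFun \<sigma>' \<sigma>) \<rho> (SLam \<rho>' t) \<and> M = modcomp \<sigma>' \<sigma> \<rho>' \<rho>r t)"

abbreviation hole_ty :: "ty \<Rightarrow> ty \<Rightarrow> ty \<Rightarrow> ty \<Rightarrow> ty" where
  "hole_ty \<sigma>' \<sigma> \<rho>' \<rho>r \<equiv> TFun (TFun \<sigma>' \<sigma>) (TFun \<rho>' \<rho>r)"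

lemma bind_tick_right: "bind c (\<lambda>v. tick (f v)) = tick (bind c f)"
  unfolding bind_def tick_def fun_eq_iff by (metis add_Suc_right)

text \<open>The emulation copies the shape of \<open>modcomp\<close>: injection plays the role of
  the outer \<open>protect\<close>, and extraction, performed anew at each call, that of the inner
  \<open>confine\<close>.\<close>

lemma emulable_hole:
  "emulable (hole_ty \<sigma>' \<sigma> \<rho>' \<rho>r) (hole_rel \<sigma>' \<sigma> \<rho>' \<rho>r) [l] (\<lambda>M. M)"
  unfolding emulable_def
proof
  fix n
  \<comment> \<open>Index 0 is the argument w, index 1 the free variable at level l, and index 2 the
    abstracted hole.\<close>
  let ?b = "SApp (SApp (SVar (Suc (Suc 0)))
    (SApp (SLam (uvt l) (extb (TFun \<sigma>' \<sigma>) l)) (SVar (Suc 0)))) (SVar 0)"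
  let ?s = "SApp (SLam (TFun \<rho>' \<rho>r) (injb (TFun \<rho>' \<rho>r) n)) (SLam \<rho>' ?b)"
  have "emu (hole_ty \<sigma>' \<sigma> \<rho>' \<rho>r) (hole_rel \<sigma>' \<sigma> \<rho>' \<rho>r) [l] n ?s (\<lambda>M. M)"
  proof (rule emuI)
    show "has_type (map uvt [l] @ [hole_ty \<sigma>' \<sigma> \<rho>' \<rho>r]) ?s (uvt n)"
      unfolding list.map append.simps by (rule has_type_injb_extb typing)+
    fix d k and \<rho> \<rho>u M
    assume env: "uenv d k [l] \<rho> \<rho>u" and H: "hole_rel \<sigma>' \<sigma> \<rho>' \<rho>r (\<rho> (length [l])) M"
      and k: "within d n k"
    from H obtain t \<rho>h where t: "has_type [\<rho>', TFun \<sigma>' \<sigma>] t \<rho>r" "M = modcomp \<sigma>' \<sigma> \<rho>' \<rho>r t"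
      and h: "\<rho> (Suc 0) = VClos (TFun \<sigma>' \<sigma>) \<rho>h (SLam \<rho>' t)"
      by (auto simp: hole_rel_def)
    have "sim d (vrel \<rho>r d) j (sev (case_nat x \<rho>) ?b) (uev (case_nat y \<rho>u) (modcomp_body \<sigma>' \<sigma> t))"
      if j: "j < k" and xy: "vrel \<rho>' d j x y" for j x y
    proof -
      have z: "urel l d j (\<rho> 0) (\<rho>u 0)"
        using uenv_antimono[OF env, of j] j by (simp add: uenv_def)
      have "sim d (vrel \<rho>r d) j
          (bind (sapp (vext (TFun \<sigma>' \<sigma>) l (case_nat x \<rho>)) (\<rho> 0)) (\<lambda>z. sev (case_nat x (case_nat z \<rho>h)) t))
          (uev (case_nat y \<rho>u) (modcomp_body \<sigma>' \<sigma> t))"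
        by (rule sim_modcomp_body[OF t(1) _ xy], rule sim_extract[OF z])
      \<comment> \<open>The two ticks are the calls of the abstracted hole on the extracted value
        and of its result on x.\<close>
      then have "sim d (vrel \<rho>r d) j
          (tick (tick (bind (sapp (vext (TFun \<sigma>' \<sigma>) l (case_nat x \<rho>)) (\<rho> 0))
            (\<lambda>z. sev (case_nat x (case_nat z \<rho>h)) t))))
          (uev (case_nat y \<rho>u) (modcomp_body \<sigma>' \<sigma> t))"
        by (intro sim_tick_left antimono_vrel)
      then show ?thesis by (simp add: h vext_def bind_tick_right)
    qed
    then have "vrel (TFun \<rho>' \<rho>r) d k (VClos \<rho>' \<rho> ?b) (WClos \<rho>u (modcomp_body \<sigma>' \<sigma> t))"
      by (auto simp: funrel_def simp del: sev_SApp)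
    then show "sim d (urel n d) k (sev \<rho> ?s) (uev \<rho>u M)"
      unfolding sev_inj t(2) uev_modcomp sev_SLam bind_ret using sim_inject k by blast
  qed
  then show "\<exists>s. emu (hole_ty \<sigma>' \<sigma> \<rho>' \<rho>r) (hole_rel \<sigma>' \<sigma> \<rho>' \<rho>r) [l] n s (\<lambda>M. M)" by blast
qed

text \<open>S depends on C and n only, so the assumed equivalence can be applied to it with both
  terms.\<close>

lemma backtranslation:
  assumes "uctx_scoped C 1 0"
  obtains S where "sctx_type S [TFun \<sigma>' \<sigma>] (TFun \<rho>' \<rho>r) [] (uvt n)"
    and "\<And>d k t \<rho> \<rho>u. has_type [\<rho>', TFun \<sigma>' \<sigma>] t \<rho>r \<Longrightarrow> within d n k \<Longrightarrow>
      sim d (urel n d) k (sev \<rho> (splug S (SLam \<rho>' t))) (uev \<rho>u (uplug C (modcomp \<sigma>' \<sigma> \<rho>' \<rho>r t)))"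
proof -
  let ?T = "hole_ty \<sigma>' \<sigma> \<rho>' \<rho>r"
  have "emulable ?T (hole_rel \<sigma>' \<sigma> \<rho>' \<rho>r) [] (\<lambda>M. uplug C M)"
    by (rule emulable_plug[OF assms]) (auto simp: length_Suc_conv intro: emulable_hole)
  then obtain s where s: "emu ?T (hole_rel \<sigma>' \<sigma> \<rho>' \<rho>r) [] n s (\<lambda>M. uplug C M)"
    by (rule emulableE)
  \<comment> \<open>The abstraction over the free variable belongs to the context and captures it in
    the plugged term; the resulting function is passed to the emulation s.\<close>
  let ?S = "SCApp2 (SLam ?T s) (SCLam (TFun \<sigma>' \<sigma>) SCHole)"
  show ?thesis
  proof
    show "sctx_type ?S [TFun \<sigma>' \<sigma>] (TFun \<rho>' \<rho>r) [] (uvt n)"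
      using emu_type[OF s] by (auto intro!: sctx_type.intros T_Lam)
    fix d k t \<rho> \<rho>u
    assume t: "has_type [\<rho>', TFun \<sigma>' \<sigma>] t \<rho>r" and k: "within d n k"
    let ?h = "VClos (TFun \<sigma>' \<sigma>) \<rho> (SLam \<rho>' t)"
    have "sim d (urel n d) k (sev (case_nat ?h \<rho>) s) (uev \<rho>u (uplug C (modcomp \<sigma>' \<sigma> \<rho>' \<rho>r t)))"
      by (rule emu_sim[OF s _ _ k order_refl]) (use t in \<open>auto simp: uenv_def hole_rel_def\<close>)
    then show "sim d (urel n d) k (sev \<rho> (splug ?S (SLam \<rho>' t)))
        (uev \<rho>u (uplug C (modcomp \<sigma>' \<sigma> \<rho>' \<rho>r t)))"
      by (simp add: sim_tick_left antimono_urel)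
  qed
qed

lemma uterminates_transfer:
  assumes t1: "has_type [\<rho>', TFun \<sigma>' \<sigma>] t1 \<rho>r" and t2: "has_type [\<rho>', TFun \<sigma>' \<sigma>] t2 \<rho>r"
    and equiv: "sctx_equiv [TFun \<sigma>' \<sigma>] (SLam \<rho>' t1) (SLam \<rho>' t2) (TFun \<rho>' \<rho>r)"
    and C: "uctx_scoped C 1 0"
    and "uterminates (uplug C (modcomp \<sigma>' \<sigma> \<rho>' \<rho>r t1))"
  shows "uterminates (uplug C (modcomp \<sigma>' \<sigma> \<rho>' \<rho>r t2))"
proof -
  let ?\<rho> = "\<lambda>_. VUnit" and ?\<rho>u = "\<lambda>_. WUnit"
  have scoped: "uscoped 0 (uplug C (modcomp \<sigma>' \<sigma> \<rho>' \<rho>r t))" if "has_type [\<rho>', TFun \<sigma>' \<sigma>] t \<rho>r" for t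
    using uscoped_plug[OF C uscoped_modcomp[OF that]] .
  obtain j w where j: "uev ?\<rho>u (uplug C (modcomp \<sigma>' \<sigma> \<rho>' \<rho>r t1)) j w"
    using assms(5) uterminates_iff[OF scoped[OF t1]] by blast
  obtain S where S: "sctx_type S [TFun \<sigma>' \<sigma>] (TFun \<rho>' \<rho>r) [] (uvt (Suc j))"
    and sim: "\<And>d k t \<rho> \<rho>u. has_type [\<rho>', TFun \<sigma>' \<sigma>] t \<rho>r \<Longrightarrow> within d (Suc j) k \<Longrightarrow>
      sim d (urel (Suc j) d) k (sev \<rho> (splug S (SLam \<rho>' t)))
        (uev \<rho>u (uplug C (modcomp \<sigma>' \<sigma> \<rho>' \<rho>r t)))"
    using backtranslation[OF C] by blast
  have "\<exists>i v. sev ?\<rho> (splug S (SLam \<rho>' t1)) i v"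
    \<comment> \<open>Costs are compared strictly, so a run of cost j needs index j + 1, which the
      chosen level just allows.\<close>
    using sim[OF t1, of Bwd "Suc j" ?\<rho> ?\<rho>u] j by (fastforce simp: sim_def within_def)
  then have "sterminates (splug S (SLam \<rho>' t1))"
    using sterminates_iff[OF has_type_plug[OF S T_Lam[OF t1]]] by blast
  then have "sterminates (splug S (SLam \<rho>' t2))"
    using equiv S by (simp add: sctx_equiv_def)
  then obtain i v where "sev ?\<rho> (splug S (SLam \<rho>' t2)) i v"
    using sterminates_iff[OF has_type_plug[OF S T_Lam[OF t2]]] by blast
  then have "\<exists>i w. uev ?\<rho>u (uplug C (modcomp \<sigma>' \<sigma> \<rho>' \<rho>r t2)) i w"
    \<comment> \<open>The cost i has no relation to j; for \<open>Fwd\<close> the level imposes no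
      bound on the index.\<close>
    using sim[OF t2, of Fwd "Suc i" ?\<rho> ?\<rho>u] by (fastforce simp: sim_def within_def)
  then show ?thesis using uterminates_iff[OF scoped[OF t2]] by blast
qed

theorem theorem7p7:
  fixes \<tau> \<tau>' \<tau>1 \<tau>1' :: ty and t1 t2 :: stm
  assumes "has_type [TFun \<tau>' \<tau>] (SLam \<tau>1' t1) (TFun \<tau>1' \<tau>1)"
    and "has_type [TFun \<tau>' \<tau>] (SLam \<tau>1' t2) (TFun \<tau>1' \<tau>1)"
  shows "sctx_equiv [TFun \<tau>' \<tau>] (SLam \<tau>1' t1) (SLam \<tau>1' t2) (TFun \<tau>1' \<tau>1) \<longleftrightarrow>
    uctx_equiv 1 (modcomp \<tau>' \<tau> \<tau>1' \<tau>1 t1) (modcomp \<tau>' \<tau> \<tau>1' \<tau>1 t2)"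
proof
  have t: "has_type [\<tau>1', TFun \<tau>' \<tau>] t1 \<tau>1" "has_type [\<tau>1', TFun \<tau>' \<tau>] t2 \<tau>1"
    using assms by (auto elim: has_type.cases)
  {
    assume "sctx_equiv [TFun \<tau>' \<tau>] (SLam \<tau>1' t1) (SLam \<tau>1' t2) (TFun \<tau>1' \<tau>1)"
    \<comment> \<open>The transfer of termination goes one way, so it is applied a second time with
      the two terms exchanged.\<close>
    moreover from this have "sctx_equiv [TFun \<tau>' \<tau>] (SLam \<tau>1' t2) (SLam \<tau>1' t1) (TFun \<tau>1' \<tau>1)"
      by (auto simp: sctx_equiv_def)
    ultimately show "uctx_equiv 1 (modcomp \<tau>' \<tau> \<tau>1' \<tau>1 t1) (modcomp \<tau>' \<tau> \<tau>1' \<tau>1 t2)"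
      unfolding uctx_equiv_def using uterminates_transfer t by blast
  }
  assume "uctx_equiv 1 (modcomp \<tau>' \<tau> \<tau>1' \<tau>1 t1) (modcomp \<tau>' \<tau> \<tau>1' \<tau>1 t2)"
  then show "sctx_equiv [TFun \<tau>' \<tau>] (SLam \<tau>1' t1) (SLam \<tau>1' t2) (TFun \<tau>1' \<tau>1)"
    by (rule sctx_equiv_if_uctx_equiv[OF t])
qed

end
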